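(* Let $\Omega,\eta,\rho$ satisfy the standing assumptions in the context, let $\varepsilon>0$, $1<q\le\infty$ and $h\in L^q(\Omega)$. If $u\in L^1(\Omega)$ is a solution of the nonlocal Poisson equation $$-\Delta^\eta_{\rho,\varepsilon}u(x)=h(x),\qquad x\in\Omega,$$ then $u\in L^q(\Omega)$. Furthermore: (i) for $1<q<2$, $$\int_\Omega|u|^qdx+\int_\Omega\int_\Omega\eta_\varepsilon(|x-y|)\left|\frac{u(y)-u(x)}{\varepsilon}\right|^qdy\,dx\le C\left(\int_\Omega|u|dx\right)^q+C\int_\Omega|h|^qdx+C;$$ (ii) for $2\le q<\infty$, $$\int_\Omega|u|^qdx+\int_\Omega\int_\Omega\eta_\varepsilon(|x-y|)\left|\frac{(|u|^{(q-2)/2}u)(y)-(|u|^{(q-2)/2}u)(x)}{\varepsilon}\right|^2dy\,dx\le C\left(\int_\Omega|u|^{q/2}dx\right)^2+C\int_\Omega|h|^qdx;$$ (iii) for $q=\infty$, $$\|u\|_{L^\infty(\Omega)}\le C\|u\|_{L^1(\Omega)}+C\|h\|_{L^\infty(\Omega)}.$$ Here the constant $C$ in (i)–(iii) does not depend on $\varepsilon$, nor on $u$ and $h$.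
   Context: Standing assumptions: $\Omega\subset\mathbb{R}^d$ ($d\ge2$) is a connected bounded open domain with sufficiently smooth boundary. $\eta:[0,\infty)\to[0,\infty)$ is nonincreasing, piecewise Lipschitz (finitely many pieces), compactly supported, with $\eta(1)\ge1$ and $\eta(2)=0$; $\eta_\varepsilon(s)=\varepsilon^{-d}\eta(s/\varepsilon)$. $\rho\in C^1(\overline\Omega)$ is a probability density on $\Omega$ with $0<\inf_\Omega\rho\le\sup_\Omega\rho<\infty$. Weighted nonlocal Laplacian: $$\Delta^\eta_{\rho,\varepsilon}u(x)=\frac1{\varepsilon^2}\int_\Omega\eta_\varepsilon(|x-y|)(u(y)-u(x))\rho(y)\,dy,\qquad x\in\Omega.$$
   Formalization: The constant C in (i)–(iii) is uniform for ε in (0, ε₀] with ε₀ > 0 arbitrary, and may depend on ε₀; one C for all ε > 0 is impossible, since for ε ≥ diam Ω, constant ρ and η = 1 on [0,1], 0 beyond, u = ε^{d+2}h solves the equation for mean-zero h. *)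

theory Defs
  imports "HOL-Analysis.Analysis" "HOL-Probability.Essential_Supremum"
begin

text \<open>Local graph formulation: after a rotation of the coordinates taking a unit vector
  \<open>\<nu>\<close> to the last coordinate axis, \<open>\<Omega>\<close> lies near each boundary point exactly on one side of
  the graph of a \<open>C\<^sup>1\<close> function \<open>g\<close> of the remaining coordinates. Here \<open>g\<close> is a function on
  the whole space, but only its values on the hyperplane orthogonal to \<open>\<nu>\<close> are used.\<close>

definition C1_boundary :: "'a::euclidean_space set \<Rightarrow> bool" where
  "C1_boundary \<Omega> \<longleftrightarrow>
     (\<forall>x\<^sub>0\<in>frontier \<Omega>. \<exists>r>0. \<exists>\<nu> g Dg. norm \<nu> = 1 \<and>
        (\<forall>x. GDERIV g x :> Dg x) \<and> continuous_on UNIV Dg \<and>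
        \<Omega> \<inter> ball x\<^sub>0 r = {x \<in> ball x\<^sub>0 r. g (x - (x \<bullet> \<nu>) *\<^sub>R \<nu>) < x \<bullet> \<nu>})"

text \<open>``Sufficiently smooth boundary'' is read as \<open>C\<^sup>1\<close> boundary, the least restrictive
  degree of smoothness.\<close>

definition smooth_bounded_domain :: "'a::euclidean_space set \<Rightarrow> bool" where
  "smooth_bounded_domain \<Omega> \<longleftrightarrow> open \<Omega> \<and> connected \<Omega> \<and> bounded \<Omega> \<and> C1_boundary \<Omega>"

text \<open>The pieces may be degenerate intervals, so values at jump points are unrestricted.\<close>

definition piecewise_lipschitz_on :: "real set \<Rightarrow> (real \<Rightarrow> real) \<Rightarrow> bool" where
  "piecewise_lipschitz_on S f \<longleftrightarrow>
     (\<exists>\<I>. finite \<I> \<and> \<Union>\<I> = S \<and> (\<forall>I\<in>\<I>. is_interval I \<and> (\<exists>L. L-lipschitz_on I f)))"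

definition kernel_profile :: "(real \<Rightarrow> real) \<Rightarrow> bool" where
  "kernel_profile \<eta> \<longleftrightarrow>
     (\<forall>s\<ge>0. 0 \<le> \<eta> s) \<and> antimono_on {0..} \<eta> \<and> piecewise_lipschitz_on {0..} \<eta> \<and>
     (\<exists>R. \<forall>s>R. \<eta> s = 0) \<and> 1 \<le> \<eta> 1 \<and> \<eta> 2 = 0"

definition rescaled_kernel :: "nat \<Rightarrow> (real \<Rightarrow> real) \<Rightarrow> real \<Rightarrow> real \<Rightarrow> real" where
  "rescaled_kernel d \<eta> \<epsilon> s = \<eta> (s / \<epsilon>) / \<epsilon> ^ d"

text \<open>\<open>C\<^sup>1(closure \<Omega>)\<close>: the function is continuous up to the boundary, and its gradient in
  \<open>\<Omega>\<close> extends continuously to the closure.\<close>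

definition C1_closure :: "'a::euclidean_space set \<Rightarrow> ('a \<Rightarrow> real) \<Rightarrow> bool" where
  "C1_closure \<Omega> f \<longleftrightarrow> continuous_on (closure \<Omega>) f \<and>
     (\<exists>Df. (\<forall>x\<in>\<Omega>. GDERIV f x :> Df x) \<and> continuous_on (closure \<Omega>) Df)"

text \<open>The boundedness conditions make the real-valued infimum meaningful and say that the
  supremum is finite.\<close>

definition positive_C1_density :: "'a::euclidean_space set \<Rightarrow> ('a \<Rightarrow> real) \<Rightarrow> bool" where
  "positive_C1_density \<Omega> \<rho> \<longleftrightarrow>
     C1_closure \<Omega> \<rho> \<and> (LINT x|lebesgue_on \<Omega>. \<rho> x) = 1 \<and>
     bdd_below (\<rho> ` \<Omega>) \<and> 0 < (INF x\<in>\<Omega>. \<rho> x) \<and> bdd_above (\<rho> ` \<Omega>)"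

definition Linf_norm :: "'a measure \<Rightarrow> ('a \<Rightarrow> real) \<Rightarrow> ereal" where
  "Linf_norm M f = esssup M (\<lambda>x. ereal \<bar>f x\<bar>)"

text \<open>Functions rather than equivalence classes modulo null sets; used for \<open>1 \<le> q \<le> \<infinity>\<close>.\<close>

definition Lq_space :: "'a measure \<Rightarrow> ereal \<Rightarrow> ('a \<Rightarrow> real) set" where
  "Lq_space M q = {f \<in> borel_measurable M.
     if q = \<infinity> then Linf_norm M f < \<infinity> else integrable M (\<lambda>x. \<bar>f x\<bar> powr real_of_ereal q)}"

definition nonlocal_laplacian ::
  "'a::euclidean_space set \<Rightarrow> (real \<Rightarrow> real) \<Rightarrow> ('a \<Rightarrow> real) \<Rightarrow> real \<Rightarrow> ('a \<Rightarrow> real) \<Rightarrow> 'a \<Rightarrow> real"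
where
  "nonlocal_laplacian \<Omega> \<eta> \<rho> \<epsilon> u x =
     1 / \<epsilon>\<^sup>2 * (LINT y|lebesgue_on \<Omega>.
        rescaled_kernel DIM('a) \<eta> \<epsilon> (norm (x - y)) * (u y - u x) * \<rho> y)"

text \<open>As usual for Lebesgue classes, the equation is required almost everywhere in \<open>\<Omega>\<close>.\<close>

definition solves_nonlocal_poisson ::
  "'a::euclidean_space set \<Rightarrow> (real \<Rightarrow> real) \<Rightarrow> ('a \<Rightarrow> real) \<Rightarrow> real \<Rightarrow> ('a \<Rightarrow> real) \<Rightarrow> ('a \<Rightarrow> real) \<Rightarrow> bool"
where
  "solves_nonlocal_poisson \<Omega> \<eta> \<rho> \<epsilon> h u \<longleftrightarrow>
     (AE x in lebesgue_on \<Omega>. - nonlocal_laplacian \<Omega> \<eta> \<rho> \<epsilon> u x = h x)"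

text \<open>The double integral over \<open>\<Omega> \<times> \<Omega>\<close> of
  \<open>\<eta>\<^sub>\<epsilon>(|x - y|) |(w(y) - w(x)) / \<epsilon>|\<^sup>p\<close>. It is a nonnegative integral, so that an upper bound on
  it includes its finiteness.\<close>

definition nonlocal_energy ::
  "'a::euclidean_space set \<Rightarrow> (real \<Rightarrow> real) \<Rightarrow> real \<Rightarrow> real \<Rightarrow> ('a \<Rightarrow> real) \<Rightarrow> ennreal"
where
  "nonlocal_energy \<Omega> \<eta> \<epsilon> p w =
     (\<integral>\<^sup>+ x. (\<integral>\<^sup>+ y. ennreal (rescaled_kernel DIM('a) \<eta> \<epsilon> (norm (x - y)) *
        \<bar>(w y - w x) / \<epsilon>\<bar> powr p) \<partial>lebesgue_on \<Omega>) \<partial>lebesgue_on \<Omega>)"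

end

theory Submission
  imports Defs
begin

text \<open>Two facts make the constants independent of \<open>\<epsilon>\<close>. First, testing the equation with
  \<open>\<rho> \<phi>(u)\<close> for a monotone \<open>\<phi>\<close> and symmetrising controls the nonlocal energy of a function of \<open>u\<close>:
  the choice \<open>\<phi>(t) = |t|\<^sup>q\<^sup>-\<^sup>2 t\<close> serves for finite \<open>q\<close>, truncations \<open>\<phi>(t) = (t - l)\<^sub>+\<close> for \<open>q = \<infinity>\<close>.
  Second, for \<open>\<epsilon> \<le> r\<close> the energy at scale \<open>\<epsilon>\<close> dominates the one at scale \<open>r\<close>: two nearby points are
  joined through a third one in the intersection of their interior cones, and both segments are cut
  into about \<open>r / \<epsilon>\<close> steps, which are averaged over all positions of the third point. Together with
  the lower density bound for \<open>\<Omega>\<close> this is a Poincare inequality at every scale \<open>r \<ge> \<epsilon>\<close>, with the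
  \<open>L\<^sup>1\<close> norm in place of the mean. At a fixed scale it gives the estimates for finite \<open>q\<close>; at shrinking scales it drives a De Giorgi iteration, which the
  equation itself closes once the scale has reached \<open>\<epsilon>\<close>.\<close>

section \<open>Uniform interior cones\<close>

text \<open>The constants depend on an upper bound for \<epsilon>, and they must. If \<eta> is
  constant on [0,1] and \<epsilon> exceeds the diameter, the operator is u minus its weighted mean,
  up to a factor of order \<epsilon>^(-d-2). For h of weighted mean zero, a multiple of
  \<epsilon>^(d+2) h is then a solution: nothing is smoothed, and concentrated h defeat any uniform
  bound. Testing meets the obstacle that u is only known to be in L^1. The equation removes it: u is
  an average, bounded for fixed \<epsilon>, plus a multiple of h. The resulting constants degenerate
  as \<epsilon> tends to 0, so this serves only for integrability and for \<epsilon> bounded below.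
  Cutting a segment into n steps costs n^(p-1) by convexity, n by the number of steps and n^d by
  substitution. With n of order r/\<epsilon>, the total (r/\<epsilon>)^(p+d) leaves only r^p once
  the kernel is normalised and the average over a ball of radius r is taken. The iteration for q =
  \<infinity> uses no Sobolev embedding. The factor r^2 in the Poincare inequality makes the gaps
  between levels summable, while halving r leaves room for the level sets to shrink by a fixed
  factor.\<close>

text \<open>The balls fill a truncated open cone with apex \<open>x\<close> and axis
  \<open>\<nu>\<close>. Describing it by balls instead of angles provides sets of known volume over
  which intermediate points can be averaged.\<close>

definition cone_at :: "'a::euclidean_space set \<Rightarrow> real \<Rightarrow> real \<Rightarrow> 'a \<Rightarrow> 'a \<Rightarrow> bool" where
  "cone_at \<Omega> c s\<^sub>0 \<nu> x \<longleftrightarrow> (\<forall>s\<in>{0<..s\<^sub>0}. ball (x + s *\<^sub>R \<nu>) (c * s) \<subseteq> \<Omega>)"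

lemma cone_at_mono:
  assumes "cone_at \<Omega> c s\<^sub>0 \<nu> x" "c' \<le> c" "s' \<le> s\<^sub>0"
  shows "cone_at \<Omega> c' s' \<nu> x"
  unfolding cone_at_def
proof
  fix s assume s: "s \<in> {0<..s'}"
  then have "ball (x + s *\<^sub>R \<nu>) (c' * s) \<subseteq> ball (x + s *\<^sub>R \<nu>) (c * s)"
    using assms(2) by (intro subset_ball mult_right_mono) auto
  also have "\<dots> \<subseteq> \<Omega>" using s assms(1,3) by (auto simp: cone_at_def)
  finally show "ball (x + s *\<^sub>R \<nu>) (c' * s) \<subseteq> \<Omega>" .
qed

text \<open>The homothety with centre \<open>x\<close> and ratio \<open>t\<close> maps the ball at
  height \<open>s\<close> to the ball at height \<open>t * s\<close>, which again belongs to the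
  cone.\<close>

lemma cone_at_segment:
  assumes "cone_at \<Omega> c s\<^sub>0 \<nu> x" "x \<in> \<Omega>" "0 < s" "s \<le> s\<^sub>0" "p \<in> ball (x + s *\<^sub>R \<nu>) (c * s)" "0 \<le> t" "t \<le> 1"
  shows "x + t *\<^sub>R (p - x) \<in> \<Omega>"
proof (cases "t = 0")
  case False
  with assms have t: "0 < t" by simp
  have "t * s \<le> s\<^sub>0"
    using mult_right_mono[OF assms(7), of s] assms(3,4) by linarith
  then have "t * s \<in> {0<..s\<^sub>0}" using t assms(3) by simp
  moreover have "x + t *\<^sub>R (p - x) \<in> ball (x + (t * s) *\<^sub>R \<nu>) (c * (t * s))"
  proof -
    have "dist (x + (t * s) *\<^sub>R \<nu>) (x + t *\<^sub>R (p - x)) = norm (t *\<^sub>R (x + s *\<^sub>R \<nu> - p))"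
      by (simp add: dist_norm algebra_simps)
    also have "\<dots> = t * dist (x + s *\<^sub>R \<nu>) p" using t by (simp add: dist_norm)
    also have "\<dots> < t * (c * s)" using assms(5) t by simp
    finally show ?thesis by (simp add: mult.left_commute)
  qed
  ultimately show ?thesis using assms(1) unfolding cone_at_def by blast
qed (use assms in auto)

text \<open>Moving by \<open>s\<close> along \<open>\<nu>\<close> raises the height by
  \<open>s\<close> and leaves the argument of \<open>g\<close> unchanged. A further displacement
  shorter than \<open>c * s\<close> lowers the height by less than \<open>c * s\<close> and raises
  the graph by at most \<open>L * c * s\<close>, so the point stays above the graph when (1 + L) c =
  1.\<close>

lemma C1_graph_cone:
  fixes x\<^sub>0 :: "'a::euclidean_space"
  assumes "C1_boundary \<Omega>" "x\<^sub>0 \<in> frontier \<Omega>"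
  shows "\<exists>R>0. \<exists>c>0. c \<le> 1 \<and> (\<exists>s>0. \<exists>\<nu>. norm \<nu> = 1 \<and> (\<forall>x\<in>\<Omega> \<inter> ball x\<^sub>0 R. cone_at \<Omega> c s \<nu> x))"
proof -
  obtain r \<nu> g Dg where r: "r > 0" and \<nu>: "norm \<nu> = 1" and g: "\<And>x. GDERIV g x :> Dg x"
    and Dg: "continuous_on UNIV Dg"
    and om: "\<Omega> \<inter> ball x\<^sub>0 r = {x \<in> ball x\<^sub>0 r. g (x - (x \<bullet> \<nu>) *\<^sub>R \<nu>) < x \<bullet> \<nu>}"
    using assms unfolding C1_boundary_def by blast
  define P where "P x = x - (x \<bullet> \<nu>) *\<^sub>R \<nu>" for x :: 'a
  have \<nu>\<nu>: "\<nu> \<bullet> \<nu> = 1" using \<nu> by (simp add: norm_eq_1)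
  have Padd: "P (x + y) = P x + P y" for x y by (simp add: P_def algebra_simps)
  have Pdiff: "P (x - y) = P x - P y" for x y by (simp add: P_def algebra_simps)
  have Pnu: "P (s *\<^sub>R \<nu>) = 0" for s by (simp add: P_def \<nu>\<nu>)
  have Pnorm: "norm (P x) \<le> norm x" for x
  proof -
    have "(norm (P x))\<^sup>2 = x \<bullet> x - (x \<bullet> \<nu>)\<^sup>2"
      by (simp add: P_def power2_norm_eq_inner inner_diff_left inner_diff_right \<nu>\<nu> inner_commute)
        (simp add: power2_eq_square)
    also have "\<dots> \<le> (norm x)\<^sup>2" by (simp add: power2_norm_eq_inner)
    finally show ?thesis by (rule power2_le_imp_le) simp
  qed
  have "compact (Dg ` cball (P x\<^sub>0) r)"
    by (intro compact_continuous_image continuous_on_subset[OF Dg]) auto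
  then obtain L where L: "L > 0" "\<And>x. x \<in> cball (P x\<^sub>0) r \<Longrightarrow> norm (Dg x) \<le> L"
    using compact_imp_bounded[of "Dg ` cball (P x\<^sub>0) r"] unfolding bounded_pos by (metis imageI)
  have lip: "\<bar>g a - g b\<bar> \<le> L * norm (a - b)" if "a \<in> cball (P x\<^sub>0) r" "b \<in> cball (P x\<^sub>0) r" for a b
  proof -
    have "norm (g a - g b) \<le> L * norm (a - b)"
    proof (rule differentiable_bound[where S="cball (P x\<^sub>0) r" and f=g and f'="\<lambda>x h. h \<bullet> Dg x"])
      show "(g has_derivative (\<lambda>h. h \<bullet> Dg x)) (at x within cball (P x\<^sub>0) r)" for x
        using g[of x] unfolding gderiv_def by (rule has_derivative_at_withinI)
      show "onorm (\<lambda>h. h \<bullet> Dg x) \<le> L" if "x \<in> cball (P x\<^sub>0) r" for x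
      proof (rule onorm_bound)
        show "norm (h \<bullet> Dg x) \<le> L * norm h" for h
          using Cauchy_Schwarz_ineq2[of h "Dg x"] L(2)[OF that] mult_left_mono[of "norm (Dg x)" L "norm h"]
          by (simp add: mult.commute)
      qed (use L in auto)
    qed (use that in auto)
    then show ?thesis by simp
  qed
  define c where "c = 1 / (1 + L)"
  have c: "0 < c" "c \<le> 1" using L by (auto simp: c_def)
  have Lc: "L * c = 1 - c" using L by (simp add: c_def field_simps)
  \<comment> \<open>Starting within r/2 of the centre and moving by less than s + c s, at most r/2,
    never leaves the ball in which the graph description is valid.\<close>
  have "cone_at \<Omega> c (r/4) \<nu> x" if x: "x \<in> \<Omega> \<inter> ball x\<^sub>0 (r/2)" for x
    unfolding cone_at_def
  proof (intro ballI subsetI)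
    fix s p assume s: "s \<in> {0<..r/4}" and p: "p \<in> ball (x + s *\<^sub>R \<nu>) (c * s)"
    define z where "z = p - (x + s *\<^sub>R \<nu>)"
    have z: "norm z < c * s" using p by (simp add: z_def dist_norm norm_minus_commute)
    have peq: "p = x + s *\<^sub>R \<nu> + z" by (simp add: z_def)
    have cs: "c * s \<le> s" using c s by (simp add: mult_left_le_one_le)
    have "dist x\<^sub>0 p \<le> dist x\<^sub>0 x + norm (s *\<^sub>R \<nu> + z)"
      using dist_triangle[of x\<^sub>0 p x] norm_minus_cancel[of "s *\<^sub>R \<nu> + z"]
      by (simp add: peq dist_norm algebra_simps)
    also have "norm (s *\<^sub>R \<nu> + z) \<le> s + norm z" using norm_triangle_ineq[of "s *\<^sub>R \<nu>" z] \<nu> s by simp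
    finally have pin: "p \<in> ball x\<^sub>0 r" using x s z cs unfolding mem_ball Int_iff greaterThanAtMost_iff by linarith
    have Pin: "P y \<in> cball (P x\<^sub>0) r" if "y \<in> ball x\<^sub>0 r" for y
      using that Pnorm[of "x\<^sub>0 - y"] by (simp add: dist_norm Pdiff)
    have xin: "x \<in> ball x\<^sub>0 r" using x r by auto
    have gx: "g (P x) < x \<bullet> \<nu>" using x xin om unfolding P_def by blast
    have "\<bar>g (P p) - g (P x)\<bar> \<le> L * norm (P p - P x)" by (rule lip[OF Pin[OF pin] Pin[OF xin]])
    also have "P p - P x = P z" by (simp add: peq Padd Pnu)
    also have "L * norm (P z) \<le> L * (c * s)"
      using Pnorm[of z] z L by (intro mult_left_mono) auto
    also have "\<dots> = (1 - c) * s" using Lc by (simp flip: mult.assoc)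
    finally have "g (P p) < x \<bullet> \<nu> + (1 - c) * s" using gx by simp
    also have "\<dots> < x \<bullet> \<nu> + s + z \<bullet> \<nu>"
      using Cauchy_Schwarz_ineq2[of z \<nu>] z \<nu> by (simp add: algebra_simps)
    also have "\<dots> = p \<bullet> \<nu>" by (simp add: peq inner_add_left \<nu>\<nu>)
    finally show "p \<in> \<Omega>" using om pin unfolding P_def by blast
  qed
  then show ?thesis using r c \<nu> by (intro exI[of _ "r/2"] exI[of _ c] exI[of _ "r/4"] conjI exI[of _ \<nu>]) auto
qed

lemma interior_cone:
  fixes x\<^sub>0 :: "'a::euclidean_space"
  assumes "open \<Omega>" "x\<^sub>0 \<in> \<Omega>"
  shows "\<exists>R>0. \<exists>c>0. c \<le> 1 \<and> (\<exists>s>0. \<exists>\<nu>. norm \<nu> = 1 \<and> (\<forall>x\<in>\<Omega> \<inter> ball x\<^sub>0 R. cone_at \<Omega> c s \<nu> x))"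
proof -
  obtain r where r: "r > 0" "ball x\<^sub>0 r \<subseteq> \<Omega>" using assms open_contains_ball by blast
  obtain \<nu> :: 'a where \<nu>: "norm \<nu> = 1" using vector_choose_size[of 1] by auto
  have "cone_at \<Omega> 1 (r/4) \<nu> x" if x: "x \<in> \<Omega> \<inter> ball x\<^sub>0 (r/2)" for x
    unfolding cone_at_def
  proof (intro ballI subsetI)
    fix s p assume s: "s \<in> {0<..r/4}" and p: "p \<in> ball (x + s *\<^sub>R \<nu>) (1 * s)"
    have "dist x\<^sub>0 p \<le> dist x\<^sub>0 x + (dist x (x + s *\<^sub>R \<nu>) + dist (x + s *\<^sub>R \<nu>) p)"
      by (meson dist_triangle add_left_mono order_trans)
    also have "\<dots> < r" using x s p \<nu> by (simp add: dist_norm)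
    finally show "p \<in> \<Omega>" using r by auto
  qed
  then show ?thesis using r \<nu> by (intro exI[of _ "r/2"] exI[of _ 1] exI[of _ "r/4"] conjI exI[of _ \<nu>]) auto
qed

text \<open>Nearby points share one axis, which makes their cones intersect in a ball visible from
  both. Finiteness of \<open>T\<close> lets a quantity that depends on the axis of a pair be
  dominated by a sum over all axes.\<close>

definition uniform_cone :: "'a::euclidean_space set \<Rightarrow> real \<Rightarrow> real \<Rightarrow> 'a set \<Rightarrow> bool" where
  "uniform_cone \<Omega> c s\<^sub>0 T \<longleftrightarrow> 0 < c \<and> c \<le> 1 \<and> 0 < s\<^sub>0 \<and> finite T \<and> (\<forall>\<nu>\<in>T. norm \<nu> = 1) \<and>
     (\<forall>x\<in>\<Omega>. \<forall>y\<in>\<Omega>. dist x y < s\<^sub>0 \<longrightarrow> (\<exists>\<nu>\<in>T. cone_at \<Omega> c s\<^sub>0 \<nu> x \<and> cone_at \<Omega> c s\<^sub>0 \<nu> y))"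

text \<open>Compactness of the closure leaves finitely many local axes. A common axis for two
  points, not just one for each of them, comes from a Lebesgue number of the finite cover.\<close>

lemma uniform_cone_exists:
  fixes \<Omega> :: "'a::euclidean_space set"
  assumes "open \<Omega>" "bounded \<Omega>" "C1_boundary \<Omega>" "\<Omega> \<noteq> {}"
  shows "\<exists>c s\<^sub>0 T. uniform_cone \<Omega> c s\<^sub>0 T"
proof -
  have "\<forall>x\<^sub>0\<in>closure \<Omega>. \<exists>R>0. \<exists>c>0. c \<le> 1 \<and>
      (\<exists>s>0. \<exists>\<nu>. norm \<nu> = 1 \<and> (\<forall>x\<in>\<Omega> \<inter> ball x\<^sub>0 R. cone_at \<Omega> c s \<nu> x))"
    using C1_graph_cone[OF assms(3)] interior_cone[OF assms(1)] assms(1)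
    by (metis Diff_iff frontier_def interior_open)
  then obtain R c s \<nu> where *: "\<And>z. z \<in> closure \<Omega> \<Longrightarrow> R z > 0 \<and> c z > 0 \<and> c z \<le> (1::real) \<and> s z > 0 \<and>
      norm (\<nu> z) = 1 \<and> (\<forall>x\<in>\<Omega> \<inter> ball z (R z). cone_at \<Omega> (c z) (s z) (\<nu> z) x)"
    by metis
  have cpt: "compact (closure \<Omega>)" using assms(2) by (simp add: compact_closure)
  have cov: "closure \<Omega> \<subseteq> (\<Union>z\<in>closure \<Omega>. ball z (R z))" 
  proof
    fix z assume z: "z \<in> closure \<Omega>"
    then have "z \<in> ball z (R z)" using *[OF z] by simp
    then show "z \<in> (\<Union>z\<in>closure \<Omega>. ball z (R z))" using z by blast
  qed
  obtain F where F: "F \<subseteq> closure \<Omega>" "finite F" "closure \<Omega> \<subseteq> (\<Union>z\<in>F. ball z (R z))"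
  proof (rule compactE_image[OF cpt, of "closure \<Omega>" "\<lambda>z. ball z (R z)"])
  qed (use cov in simp_all)
  obtain e where e: "0 < e" "\<And>x. x \<in> closure \<Omega> \<Longrightarrow> \<exists>G\<in>(\<lambda>z. ball z (R z)) ` F. ball x e \<subseteq> G"
    using Heine_Borel_lemma[OF cpt, of "(\<lambda>z. ball z (R z)) ` F"] F(3) by auto
  have Fne: "F \<noteq> {}" using F(3) assms(4) closure_subset by fastforce
  define c0 where "c0 = Min (c ` F)"
  \<comment> \<open>Keeping \<open>s0\<close> below the Lebesgue number \<open>e\<close> puts both
    points of a pair into the same ball of the cover.\<close>
  define s0 where "s0 = min e (Min (s ` F))"
  have "c0 \<in> c ` F" unfolding c0_def using F Fne by (intro Min_in) auto
  then have c0: "0 < c0" "c0 \<le> 1" using * F by auto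
  have "Min (s ` F) \<in> s ` F" using F Fne by (intro Min_in) auto
  then have s0: "0 < s0" using * F e by (auto simp: s0_def)
  have "\<exists>\<mu>\<in>\<nu> ` F. cone_at \<Omega> c0 s0 \<mu> x \<and> cone_at \<Omega> c0 s0 \<mu> y"
    if xy: "x \<in> \<Omega>" "y \<in> \<Omega>" "dist x y < s0" for x y
  proof -
    obtain z where z: "z \<in> F" "ball x e \<subseteq> ball z (R z)" using e(2)[of x] xy(1) closure_subset by blast
    have "x \<in> ball x e" "y \<in> ball x e" using e(1) xy by (auto simp: s0_def)
    then have "x \<in> ball z (R z)" "y \<in> ball z (R z)" using z(2) by blast+
    then have "cone_at \<Omega> (c z) (s z) (\<nu> z) x" "cone_at \<Omega> (c z) (s z) (\<nu> z) y"
      using *[of z] z F xy by auto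
    moreover have "c0 \<le> c z" "s0 \<le> s z" using z F unfolding c0_def s0_def by (auto simp: min.coboundedI2)
    ultimately show ?thesis using z cone_at_mono by (metis imageI)
  qed
  moreover have "\<forall>\<mu>\<in>\<nu> ` F. norm \<mu> = 1" using * F by auto
  ultimately have "uniform_cone \<Omega> c0 s0 (\<nu> ` F)" unfolding uniform_cone_def using c0 s0 F by auto
  then show ?thesis by blast
qed

section \<open>Comparing energies at different length scales\<close>

lemma nn_integral_lborel_shift:
  fixes f :: "'a::euclidean_space \<Rightarrow> ennreal"
  assumes [measurable]: "f \<in> borel_measurable borel"
  shows "(\<integral>\<^sup>+x. f (a + x) \<partial>lborel) = (\<integral>\<^sup>+x. f x \<partial>lborel)"
  by (subst (2) lborel_distr_plus[of a, symmetric]) (simp add: nn_integral_distr)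

lemma nn_integral_lborel_scale:
  fixes f :: "'a::euclidean_space \<Rightarrow> ennreal"
  assumes [measurable]: "f \<in> borel_measurable borel" and "c > 0"
  shows "(\<integral>\<^sup>+x. f x \<partial>lborel) = ennreal (c ^ DIM('a)) * (\<integral>\<^sup>+x. f (c *\<^sub>R x) \<partial>lborel)"
  using assms(2)
  by (subst lborel_affine[of c 0])
     (simp_all add: nn_integral_density nn_integral_distr nn_integral_cmult)

text \<open>Jensen's inequality for the p-th power, derived by applying Young's inequality to each
  term paired with a power of the arithmetic mean \<open>m\<close>.\<close>

lemma powr_sum_le:
  fixes a :: "'i \<Rightarrow> real"
  assumes "p > 1" "finite I" "I \<noteq> {}" "\<And>i. i \<in> I \<Longrightarrow> 0 \<le> a i"
  shows "(\<Sum>i\<in>I. a i) powr p \<le> real (card I) powr (p - 1) * (\<Sum>i\<in>I. a i powr p)"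
proof (cases "(\<Sum>i\<in>I. a i) = 0")
  case True
  then show ?thesis by (simp add: sum_nonneg)
next
  case False
  define n where "n = real (card I)"
  define m where "m = (\<Sum>i\<in>I. a i) / n"
  have n: "n > 0" using assms by (auto simp: n_def card_gt_0_iff)
  have m: "m > 0" using False sum_nonneg[of I a] assms n by (simp add: m_def order_less_le)
  have sm: "(\<Sum>i\<in>I. a i) = n * m" using n by (simp add: m_def)
  define q where "q = p / (p - 1)"
  have q: "q > 1" "1/p + 1/q = 1" "(p - 1) * q = p" using assms by (auto simp: q_def field_simps)
  have "a i * m powr (p - 1) \<le> a i powr p / p + m powr p / q" if "i \<in> I" for i
    using Youngs_inequality[OF \<open>p>1\<close> q(1,2), of "a i" "m powr (p - 1)"] assms that q by (simp add: powr_powr)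
  then have "(\<Sum>i\<in>I. a i * m powr (p - 1)) \<le> (\<Sum>i\<in>I. a i powr p / p + m powr p / q)"
    by (rule sum_mono)
  also have "\<dots> = (\<Sum>i\<in>I. a i powr p) / p + n * (m powr p / q)"
    by (simp add: sum.distrib sum_divide_distrib n_def)
  also have "(\<Sum>i\<in>I. a i * m powr (p - 1)) = n * m powr p"
    unfolding sum_distrib_right[symmetric] sm using m by (simp add: powr_diff)
  finally have "n * m powr p * (1 - 1/q) \<le> (\<Sum>i\<in>I. a i powr p) / p" by (simp add: algebra_simps)
  moreover have "1 - 1/q = 1/p" using q by simp
  ultimately have "n * m powr p \<le> (\<Sum>i\<in>I. a i powr p)" using assms(1) by (simp add: divide_right_mono_neg field_simps)
  then have "n powr (p - 1) * (n * m powr p) \<le> n powr (p - 1) * (\<Sum>i\<in>I. a i powr p)"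
    by (rule mult_left_mono) simp
  moreover have "n powr (p - 1) * (n * m powr p) = (n * m) powr p"
    using n m by (simp add: powr_mult powr_diff)
  ultimately show ?thesis by (simp add: sm n_def)
qed

lemma powr_add_le:
  fixes a b :: real
  assumes "0 \<le> a" "0 \<le> b" "0 \<le> p"
  shows "(a + b) powr p \<le> 2 powr p * (a powr p + b powr p)"
proof -
  have "(a + b) powr p \<le> (2 * max a b) powr p" using assms by (intro powr_mono2) auto
  also have "\<dots> = 2 powr p * (max a b) powr p" using assms by (simp add: powr_mult)
  also have "\<dots> \<le> 2 powr p * (a powr p + b powr p)" by (intro mult_left_mono) (auto simp: max_def)
  finally show ?thesis .
qed

lemma pred_mem_ball[measurable (raw)]:
  fixes f g :: "'b \<Rightarrow> 'a::euclidean_space"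
  assumes [measurable]: "f \<in> borel_measurable M" "g \<in> borel_measurable M"
  shows "Measurable.pred M (\<lambda>x. f x \<in> ball (g x) r)"
  unfolding mem_ball by measurable

text \<open>A sharp cutoff replaces the kernel and no normalisation is made. The quantity is
  therefore monotone in \<open>t\<close>, and for smooth \<open>w\<close> it is of order
  t^(p+d).\<close>

definition near_energy :: "'a::euclidean_space set \<Rightarrow> real \<Rightarrow> ('a \<Rightarrow> real) \<Rightarrow> real \<Rightarrow> ennreal" where
  "near_energy \<Omega> p w t =
     (\<integral>\<^sup>+x. (\<integral>\<^sup>+y. ennreal (\<bar>w y - w x\<bar> powr p) * indicator (ball x t) y \<partial>lebesgue_on \<Omega>) \<partial>lebesgue_on \<Omega>)"

lemma nn_integral_lebesgue_on_eq:
  assumes "\<Omega> \<in> sets lebesgue"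
  shows "(\<integral>\<^sup>+x. f x \<partial>lebesgue_on \<Omega>) = (\<integral>\<^sup>+x. f x * indicator \<Omega> x \<partial>lborel)"
  using assms by (simp add: nn_integral_restrict_space nn_integral_completion)

lemma near_energy_eq:
  assumes "open \<Omega>"
  shows "near_energy \<Omega> p w t = (\<integral>\<^sup>+x. (\<integral>\<^sup>+y. ennreal (\<bar>w y - w x\<bar> powr p) * indicator (ball x t) y
     * indicator \<Omega> y \<partial>lborel) * indicator \<Omega> x \<partial>lborel)"
  using assms unfolding near_energy_def by (simp add: nn_integral_lebesgue_on_eq)

section \<open>Chains of short steps along a segment\<close>

context
  fixes \<Omega> :: "'a::euclidean_space set" and w :: "'a \<Rightarrow> real" and p :: real
  assumes open_\<Omega>: "open \<Omega>" and \<Omega>_borel[measurable]: "\<Omega> \<in> sets borel"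
    and w[measurable]: "w \<in> borel_measurable borel" and p: "p > 1"
begin

definition step_energy :: "'a \<Rightarrow> 'a \<Rightarrow> ennreal" where
  "step_energy x h = ennreal (\<bar>w (x + h) - w x\<bar> powr p) * indicator \<Omega> x * indicator \<Omega> (x + h)"

text \<open>Only the grid points of the segment have to lie in \<open>\<Omega>\<close>, since the
  telescoping sum sees nothing else. Encoding this as a zero-one factor lets \<open>x\<close> and
  \<open>z\<close> range over the whole space, where translation invariance is available.\<close>

definition chain_energy :: "nat \<Rightarrow> 'a \<Rightarrow> 'a \<Rightarrow> ennreal" where
  "chain_energy n x z = ennreal (\<bar>w (x + z) - w x\<bar> powr p) *
     (if \<forall>i\<in>{..n}. x + (real i / real n) *\<^sub>R z \<in> \<Omega> then 1 else 0)"

lemma step_energy_measurable[measurable]: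
  "(\<lambda>(x, h). step_energy x h) \<in> borel_measurable (borel \<Otimes>\<^sub>M borel)"
  unfolding step_energy_def by measurable

lemma chain_energy_measurable[measurable]:
  "(\<lambda>(x, h). chain_energy n x h) \<in> borel_measurable (borel \<Otimes>\<^sub>M borel)"
  unfolding chain_energy_def by measurable

text \<open>Telescoping along the grid followed by Jensen's inequality; consecutive grid points are
  both in \<open>\<Omega>\<close>, so each increment is a genuine
  \<open>step_energy\<close>.\<close>

lemma chain_energy_le:
  assumes "n > 0"
  shows "chain_energy n x z \<le> ennreal (real n powr (p - 1)) *
     (\<Sum>i<n. step_energy ((real i / real n) *\<^sub>R z + x) ((1 / real n) *\<^sub>R z))"
proof (cases "\<forall>i\<in>{..n}. x + (real i / real n) *\<^sub>R z \<in> \<Omega>")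
  case True
  let ?x = "\<lambda>i. x + (real i / real n) *\<^sub>R z"
  have st: "?x (Suc i) = (real i / real n) *\<^sub>R z + x + (1 / real n) *\<^sub>R z" for i
    by (simp add: add_divide_distrib scaleR_add_left algebra_simps)
  have "\<bar>w (x + z) - w x\<bar> = \<bar>\<Sum>i<n. w (?x (Suc i)) - w (?x i)\<bar>"
    using assms by (subst sum_lessThan_telescope) simp
  also have "\<dots> \<le> (\<Sum>i<n. \<bar>w (?x (Suc i)) - w (?x i)\<bar>)" by (rule sum_abs)
  finally have "\<bar>w (x + z) - w x\<bar> powr p \<le> (\<Sum>i<n. \<bar>w (?x (Suc i)) - w (?x i)\<bar>) powr p"
    using p by (intro powr_mono2) auto
  also have "\<dots> \<le> real n powr (p - 1) * (\<Sum>i<n. \<bar>w (?x (Suc i)) - w (?x i)\<bar> powr p)"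
    using powr_sum_le[OF p, of "{..<n}" "\<lambda>i. \<bar>w (?x (Suc i)) - w (?x i)\<bar>"] assms by auto
  finally have "ennreal (\<bar>w (x + z) - w x\<bar> powr p) \<le>
      ennreal (real n powr (p - 1)) * (\<Sum>i<n. ennreal (\<bar>w (?x (Suc i)) - w (?x i)\<bar> powr p))"
    by (simp add: ennreal_mult'[symmetric] sum_nonneg)
  also have "(\<Sum>i<n. ennreal (\<bar>w (?x (Suc i)) - w (?x i)\<bar> powr p)) =
      (\<Sum>i<n. step_energy ((real i / real n) *\<^sub>R z + x) ((1 / real n) *\<^sub>R z))"
  proof (rule sum.cong)
    fix i assume "i \<in> {..<n}"
    then have "?x i \<in> \<Omega>" "?x (Suc i) \<in> \<Omega>" using True by (auto simp del: of_nat_Suc)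
    then show "ennreal (\<bar>w (?x (Suc i)) - w (?x i)\<bar> powr p) =
       step_energy ((real i / real n) *\<^sub>R z + x) ((1 / real n) *\<^sub>R z)"
      unfolding step_energy_def st by (simp add: add.commute)
  qed simp
  finally show ?thesis using True by (simp add: chain_energy_def)
qed (auto simp: chain_energy_def)

text \<open>After integration over the base point all \<open>n\<close> steps contribute equally by
  translation invariance. This upgrades the factor n^(p-1) to n^p.\<close>

lemma nn_integral_chain_energy_le:
  assumes "n > 0"
  shows "(\<integral>\<^sup>+x. chain_energy n x z \<partial>lborel)
     \<le> ennreal (real n powr p) * (\<integral>\<^sup>+x. step_energy x ((1 / real n) *\<^sub>R z) \<partial>lborel)"
proof -
  have "(\<integral>\<^sup>+x. chain_energy n x z \<partial>lborel) \<le> (\<integral>\<^sup>+x. ennreal (real n powr (p - 1)) *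
     (\<Sum>i<n. step_energy ((real i / real n) *\<^sub>R z + x) ((1 / real n) *\<^sub>R z)) \<partial>lborel)"
    by (intro nn_integral_mono chain_energy_le assms)
  also have "\<dots> = ennreal (real n powr (p - 1)) * (\<Sum>i<n. \<integral>\<^sup>+x.
     step_energy ((real i / real n) *\<^sub>R z + x) ((1 / real n) *\<^sub>R z) \<partial>lborel)"
    by (simp add: nn_integral_cmult nn_integral_sum)
  also have "\<dots> = ennreal (real n powr (p - 1)) * (of_nat n * (\<integral>\<^sup>+x. step_energy x ((1 / real n) *\<^sub>R z) \<partial>lborel))"
    by (subst nn_integral_lborel_shift) simp_all
  also have "\<dots> = ennreal (real n powr (p - 1) * real n) * (\<integral>\<^sup>+x. step_energy x ((1 / real n) *\<^sub>R z) \<partial>lborel)"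
    by (simp add: ennreal_mult' ennreal_of_nat_eq_real_of_nat mult.assoc)
  also have "real n powr (p - 1) * real n = real n powr p" using assms by (simp add: powr_diff)
  finally show ?thesis .
qed

text \<open>The substitution h = z / n turns displacements below \<open>R\<close> into steps below
  \<open>R / n\<close>, and its Jacobian supplies the additional factor n^d.\<close>

lemma nn_integral_chain_energy_ball_le:
  assumes "n > 0"
  shows "(\<integral>\<^sup>+x. (\<integral>\<^sup>+z. chain_energy n x z * indicator (ball 0 R) z \<partial>lborel) \<partial>lborel)
     \<le> ennreal (real n powr (p + DIM('a))) * near_energy \<Omega> p w (R / n)"
proof -
  have "(\<integral>\<^sup>+x. (\<integral>\<^sup>+z. chain_energy n x z * indicator (ball 0 R) z \<partial>lborel) \<partial>lborel)
      = (\<integral>\<^sup>+z. (\<integral>\<^sup>+x. chain_energy n x z * indicator (ball 0 R) z \<partial>lborel) \<partial>lborel)"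
    by (rule lborel_pair.Fubini'[symmetric]) measurable
  also have "\<dots> = (\<integral>\<^sup>+z. (\<integral>\<^sup>+x. chain_energy n x z \<partial>lborel) * indicator (ball 0 R) z \<partial>lborel)"
    by (simp add: nn_integral_multc)
  also have "\<dots> \<le> (\<integral>\<^sup>+z. ennreal (real n powr p) * (\<integral>\<^sup>+x. step_energy x ((1 / real n) *\<^sub>R z) \<partial>lborel)
       * indicator (ball 0 R) z \<partial>lborel)"
    by (intro nn_integral_mono mult_right_mono nn_integral_chain_energy_le assms) auto
  also have "\<dots> = ennreal (real n powr p) * (\<integral>\<^sup>+z. (\<integral>\<^sup>+x. step_energy x ((1 / real n) *\<^sub>R z) \<partial>lborel)
       * indicator (ball 0 R) z \<partial>lborel)"
    by (simp add: mult.assoc nn_integral_cmult)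
  also have "(\<integral>\<^sup>+z. (\<integral>\<^sup>+x. step_energy x ((1 / real n) *\<^sub>R z) \<partial>lborel) * indicator (ball 0 R) z \<partial>lborel)
      = ennreal (real n ^ DIM('a)) * (\<integral>\<^sup>+h. (\<integral>\<^sup>+x. step_energy x h \<partial>lborel) * indicator (ball 0 (R / n)) h \<partial>lborel)"
    using assms by (subst nn_integral_lborel_scale[where c="real n"])
      (auto intro!: arg_cong2[where f="(*)"] nn_integral_cong simp: indicator_def field_simps)
  also have "(\<integral>\<^sup>+h. (\<integral>\<^sup>+x. step_energy x h \<partial>lborel) * indicator (ball 0 (R / n)) h \<partial>lborel)
      = (\<integral>\<^sup>+h. (\<integral>\<^sup>+x. step_energy x h * indicator (ball 0 (R / n)) h \<partial>lborel) \<partial>lborel)"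
    by (simp add: nn_integral_multc)
  also have "\<dots> = (\<integral>\<^sup>+x. (\<integral>\<^sup>+h. step_energy x h * indicator (ball 0 (R / n)) h \<partial>lborel) \<partial>lborel)"
    by (rule lborel_pair.Fubini') measurable
  also have "\<dots> = (\<integral>\<^sup>+x. (\<integral>\<^sup>+y. step_energy x ((-x) + y) * indicator (ball 0 (R / n)) ((-x) + y) \<partial>lborel) \<partial>lborel)"
    by (subst nn_integral_lborel_shift) simp_all
  also have "\<dots> = near_energy \<Omega> p w (R / n)"
    unfolding near_energy_eq[OF open_\<Omega>]
    by (intro nn_integral_cong, subst nn_integral_multc[symmetric])
       (auto intro!: nn_integral_cong simp: step_energy_def indicator_def dist_norm norm_minus_commute)
  also have "ennreal (real n powr p) * (ennreal (real n ^ DIM('a)) * near_energy \<Omega> p w (R / real n)) =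
      ennreal (real n powr (p + DIM('a))) * near_energy \<Omega> p w (R / real n)"
    using assms by (simp add: powr_add powr_realpow ennreal_mult' mult.assoc)
  finally show ?thesis .
qed

text \<open>The segment between two nearby points may leave \<open>\<Omega>\<close>, so a third
  point is inserted above both along their common axis. Both legs lie in \<open>\<Omega>\<close> by
  the cone property, and each is cut into \<open>n\<close> steps. Averaging over the third point
  makes the legs range over an open set of directions, so that they can be compared with a double
  integral.\<close>

lemma near_energy_scale_borel:
  assumes uc: "uniform_cone \<Omega> c s\<^sub>0 T" and s: "0 < s" "s \<le> s\<^sub>0" and n: "n > 0"
  shows "near_energy \<Omega> p w (c * s / 2)
     \<le> ennreal (2 * 2 powr p * card T * real n powr (p + DIM('a))) * near_energy \<Omega> p w (2 * s / n)"
proof -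
  have c: "0 < c" "c \<le> 1" and T: "finite T" "\<And>\<nu>. \<nu> \<in> T \<Longrightarrow> norm \<nu> = 1" using uc by (auto simp: uniform_cone_def)
  \<comment> \<open>For \<open>y\<close> within \<open>r\<close> of \<open>x\<close>, the ball of
    radius \<open>r\<close> about x + s \<nu> lies in the ball of radius 2 r = c s about y + s
    \<nu>, hence in both cones.\<close>
  define r where "r = c * s / 2"
  have r: "r > 0" "c * s = 2 * r" using c s by (auto simp: r_def)
  define V where "V = emeasure lborel (ball (0::'a) r)"
  have V: "V \<noteq> 0" "V \<noteq> top" using r emeasure_lborel_ball_finite[of "0::'a" r]
      less_imp_neq[OF unit_ball_vol_pos[of "real DIM('a)"]]
    by (auto simp: V_def emeasure_ball)
  have Vx: "emeasure lborel (ball x r) = V" for x :: 'a using r by (simp add: V_def emeasure_ball)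
  \<comment> \<open>Relative to either endpoint the third point lies in the ball of radius 2 r about
    s \<nu>, so one function covers both legs.\<close>
  define H where "H \<nu> x z = chain_energy n x z * indicator (ball (s *\<^sub>R \<nu>) (2 * r)) z" for \<nu> x z
  have Hm[measurable]: "(\<lambda>(x, z). H \<nu> x z) \<in> borel_measurable (borel \<Otimes>\<^sub>M borel)" for \<nu>
    unfolding H_def by measurable
  define \<Phi> where "\<Phi> \<nu> x = (\<integral>\<^sup>+z. H \<nu> x z \<partial>lborel)" for \<nu> x
  have \<Phi>m[measurable]: "\<Phi> \<nu> \<in> borel_measurable borel" for \<nu> unfolding \<Phi>_def by measurable
  \<comment> \<open>The left side does not involve the third point \<open>q\<close>, so integrating
    over a ball of admissible \<open>q\<close> yields exactly the factor \<open>V\<close>. The axis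
    depends on the pair; summing over \<open>T\<close> removes that dependence. Integration over
    pairs later brings out another \<open>V\<close>, which cancels this one.\<close>
  have pt: "V * ennreal (\<bar>w y - w x\<bar> powr p) \<le> ennreal (2 powr p) * (\<Sum>\<nu>\<in>T. \<Phi> \<nu> x + \<Phi> \<nu> y)"
    if xy: "x \<in> \<Omega>" "y \<in> \<Omega>" "y \<in> ball x r" for x y
  proof -
    have "r < s\<^sub>0" using c s by (simp add: r_def) (smt (verit) mult_left_le_one_le)
    then obtain \<nu> where \<nu>: "\<nu> \<in> T" "cone_at \<Omega> c s\<^sub>0 \<nu> x" "cone_at \<Omega> c s\<^sub>0 \<nu> y"
      using uc xy unfolding uniform_cone_def by force
    have "ennreal (\<bar>w y - w x\<bar> powr p) * indicator (ball (x + s *\<^sub>R \<nu>) r) q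
        \<le> ennreal (2 powr p) * (H \<nu> x ((-x) + q) + H \<nu> y ((-y) + q))" for q
    proof (cases "q \<in> ball (x + s *\<^sub>R \<nu>) r")
      case True
      have "dist (y + s *\<^sub>R \<nu>) q \<le> dist (y + s *\<^sub>R \<nu>) (x + s *\<^sub>R \<nu>) + dist (x + s *\<^sub>R \<nu>) q" by (rule dist_triangle)
      then have qx: "q \<in> ball (x + s *\<^sub>R \<nu>) (c * s)" and qy: "q \<in> ball (y + s *\<^sub>R \<nu>) (c * s)"
        using True xy r by (auto simp: dist_commute)
      have seg: "\<forall>i\<in>{..n}. x + (real i / real n) *\<^sub>R (-x + q) \<in> \<Omega>" "\<forall>i\<in>{..n}. y + (real i / real n) *\<^sub>R (-y + q) \<in> \<Omega>"
        using cone_at_segment[OF \<nu>(2) xy(1) s qx] cone_at_segment[OF \<nu>(3) xy(2) s qy] n by auto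
      have Hx: "H \<nu> x (-x + q) = ennreal (\<bar>w q - w x\<bar> powr p)"
        using seg(1) qx r by (simp add: H_def chain_energy_def indicator_def dist_norm algebra_simps)
      have Hy: "H \<nu> y (-y + q) = ennreal (\<bar>w q - w y\<bar> powr p)"
        using seg(2) qy r by (simp add: H_def chain_energy_def indicator_def dist_norm algebra_simps)
      have "\<bar>w y - w x\<bar> powr p \<le> (\<bar>w q - w x\<bar> + \<bar>w q - w y\<bar>) powr p" using p by (intro powr_mono2) auto
      also have "\<dots> \<le> 2 powr p * (\<bar>w q - w x\<bar> powr p + \<bar>w q - w y\<bar> powr p)"
        using p by (intro powr_add_le) auto
      finally have "ennreal (\<bar>w y - w x\<bar> powr p) \<le>
          ennreal (2 powr p) * (ennreal (\<bar>w q - w x\<bar> powr p) + ennreal (\<bar>w q - w y\<bar> powr p))"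
        by (simp add: ennreal_mult'[symmetric] ennreal_plus[symmetric] del: ennreal_plus)
      then show ?thesis using Hx Hy by (simp add: indicator_def)
    qed simp
    then have "(\<integral>\<^sup>+q. ennreal (\<bar>w y - w x\<bar> powr p) * indicator (ball (x + s *\<^sub>R \<nu>) r) q \<partial>lborel) \<le>
        (\<integral>\<^sup>+q. ennreal (2 powr p) * (H \<nu> x ((-x) + q) + H \<nu> y ((-y) + q)) \<partial>lborel)"
      by (rule nn_integral_mono)
    also have "\<dots> = ennreal (2 powr p) * ((\<integral>\<^sup>+q. H \<nu> x ((-x) + q) \<partial>lborel) + (\<integral>\<^sup>+q. H \<nu> y ((-y) + q) \<partial>lborel))"
      by (simp add: nn_integral_cmult nn_integral_add)
    also have "(\<integral>\<^sup>+q. H \<nu> x ((-x) + q) \<partial>lborel) = \<Phi> \<nu> x" unfolding \<Phi>_def by (rule nn_integral_lborel_shift) measurable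
    also have "(\<integral>\<^sup>+q. H \<nu> y ((-y) + q) \<partial>lborel) = \<Phi> \<nu> y" unfolding \<Phi>_def by (rule nn_integral_lborel_shift) measurable
    also have "(\<integral>\<^sup>+q. ennreal (\<bar>w y - w x\<bar> powr p) * indicator (ball (x + s *\<^sub>R \<nu>) r) q \<partial>lborel) = V * ennreal (\<bar>w y - w x\<bar> powr p)"
      by (simp add: nn_integral_cmult_indicator Vx mult.commute)
    also have "\<Phi> \<nu> x + \<Phi> \<nu> y \<le> (\<Sum>\<nu>\<in>T. \<Phi> \<nu> x + \<Phi> \<nu> y)"
      using \<nu>(1) T(1) by (intro member_le_sum) auto
    finally show ?thesis by (simp add: mult_left_mono)
  qed
  have "V * near_energy \<Omega> p w r =
     (\<integral>\<^sup>+x. (\<integral>\<^sup>+y. V * ennreal (\<bar>w y - w x\<bar> powr p) * indicator (ball x r) y * indicator \<Omega> y * indicator \<Omega> x \<partial>lborel) \<partial>lborel)"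
    unfolding near_energy_eq[OF open_\<Omega>]
    by (simp add: nn_integral_cmult[symmetric] nn_integral_multc[symmetric] mult.assoc indicator_def split del: if_split)
  also have "\<dots> \<le> (\<integral>\<^sup>+x. (\<integral>\<^sup>+y. ennreal (2 powr p) * (\<Sum>\<nu>\<in>T. \<Phi> \<nu> x + \<Phi> \<nu> y) * indicator (ball x r) y \<partial>lborel) \<partial>lborel)"
    using pt by (intro nn_integral_mono) (simp split: split_indicator)
  also have "\<dots> = ennreal (2 powr p) * (\<Sum>\<nu>\<in>T. (\<integral>\<^sup>+x. (\<integral>\<^sup>+y. \<Phi> \<nu> x * indicator (ball x r) y \<partial>lborel) \<partial>lborel)
       + (\<integral>\<^sup>+x. (\<integral>\<^sup>+y. \<Phi> \<nu> y * indicator (ball x r) y \<partial>lborel) \<partial>lborel))"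
    by (simp add: nn_integral_cmult nn_integral_sum nn_integral_add sum_distrib_right distrib_right mult.assoc)
  also have "\<dots> = ennreal (2 powr p) * (\<Sum>\<nu>\<in>T. V * (\<integral>\<^sup>+x. \<Phi> \<nu> x \<partial>lborel) + V * (\<integral>\<^sup>+x. \<Phi> \<nu> x \<partial>lborel))"
  proof -
    have 1: "(\<integral>\<^sup>+x. (\<integral>\<^sup>+y. \<Phi> \<nu> x * indicator (ball x r) y \<partial>lborel) \<partial>lborel) = V * (\<integral>\<^sup>+x. \<Phi> \<nu> x \<partial>lborel)" for \<nu>
      by (simp add: nn_integral_cmult_indicator Vx mult.commute[of _ V] nn_integral_cmult)
    have "(\<integral>\<^sup>+x. (\<integral>\<^sup>+y. \<Phi> \<nu> y * indicator (ball x r) y \<partial>lborel) \<partial>lborel) = 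
         (\<integral>\<^sup>+y. (\<integral>\<^sup>+x. \<Phi> \<nu> y * indicator (ball x r) y \<partial>lborel) \<partial>lborel)" for \<nu>
      by (rule lborel_pair.Fubini') measurable
    also have "\<dots> \<nu> = (\<integral>\<^sup>+y. (\<integral>\<^sup>+x. \<Phi> \<nu> y * indicator (ball y r) x \<partial>lborel) \<partial>lborel)" for \<nu>
      by (intro nn_integral_cong) (simp add: indicator_def dist_commute)
    finally have 2: "(\<integral>\<^sup>+x. (\<integral>\<^sup>+y. \<Phi> \<nu> y * indicator (ball x r) y \<partial>lborel) \<partial>lborel) = V * (\<integral>\<^sup>+x. \<Phi> \<nu> x \<partial>lborel)" for \<nu>
      using 1 by simp
    show ?thesis by (simp only: 1 2)
  qed
  also have "\<dots> = V * (ennreal (2 powr p) * (\<Sum>\<nu>\<in>T. 2 * (\<integral>\<^sup>+x. \<Phi> \<nu> x \<partial>lborel)))"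
    by (simp add: sum_distrib_left mult_2 distrib_left ac_simps)
  finally have "near_energy \<Omega> p w r \<le> ennreal (2 powr p) * (\<Sum>\<nu>\<in>T. 2 * (\<integral>\<^sup>+x. \<Phi> \<nu> x \<partial>lborel))"
    using V by (simp add: ennreal_mult_le_mult_iff)
  also have "\<dots> \<le> ennreal (2 powr p) * (\<Sum>\<nu>\<in>T. 2 * (ennreal (real n powr (p + DIM('a))) * near_energy \<Omega> p w (2 * s / n)))"
  proof (intro mult_left_mono sum_mono)
    fix \<nu> assume \<nu>: "\<nu> \<in> T"
    \<comment> \<open>Legs have length below s + c s, at most 2 s, so \<open>n\<close> steps per leg
      have length below 2 s / n.\<close>
    have "ball (s *\<^sub>R \<nu>) (2 * r) \<subseteq> ball 0 (2 * s)"
    proof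
      fix z assume "z \<in> ball (s *\<^sub>R \<nu>) (2 * r)"
      then have "norm (z - s *\<^sub>R \<nu>) < c * s" by (simp add: r dist_norm norm_minus_commute)
      moreover have "c * s \<le> s" using c s by simp
      moreover have "norm z \<le> norm (z - s *\<^sub>R \<nu>) + s" using norm_triangle_sub[of z "s *\<^sub>R \<nu>"] T(2)[OF \<nu>] s by simp
      ultimately show "z \<in> ball 0 (2 * s)" by simp
    qed
    then have "(\<integral>\<^sup>+x. \<Phi> \<nu> x \<partial>lborel) \<le> (\<integral>\<^sup>+x. (\<integral>\<^sup>+z. chain_energy n x z * indicator (ball 0 (2 * s)) z \<partial>lborel) \<partial>lborel)"
      unfolding \<Phi>_def H_def
      by (intro nn_integral_mono mult_left_mono) (auto split: split_indicator)
    also have "\<dots> \<le> ennreal (real n powr (p + DIM('a))) * near_energy \<Omega> p w (2 * s / n)"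
      by (rule nn_integral_chain_energy_ball_le[OF n])
    finally show "(\<integral>\<^sup>+x. \<Phi> \<nu> x \<partial>lborel) \<le> ennreal (real n powr (p + DIM('a))) * near_energy \<Omega> p w (2 * s / n)" .
  qed auto
  also have "\<dots> = ennreal (2 * 2 powr p * card T * real n powr (p + DIM('a))) * near_energy \<Omega> p w (2 * s / n)"
    by (simp add: ennreal_mult' ennreal_of_nat_eq_real_of_nat ac_simps)
  finally show ?thesis by (simp add: r_def)
qed

end

text \<open>Composing \<open>w\<close> with affine maps of two variables and applying Fubini require
  Borel measurability. Changing \<open>w\<close> on a null set leaves \<open>near_energy\<close>
  unaffected.\<close>

lemma borel_representative:
  fixes w :: "'a::euclidean_space \<Rightarrow> real"
  assumes "open \<Omega>" "w \<in> borel_measurable (lebesgue_on \<Omega>)"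
  obtains w' where "w' \<in> borel_measurable borel" "AE x in lebesgue_on \<Omega>. w x = w' x"
proof -
  have "(\<lambda>x. if x \<in> \<Omega> then w x else 0) \<in> borel_measurable lebesgue"
    using assms by (simp add: borel_measurable_if)
  then obtain w' where w': "w' \<in> borel_measurable lborel" "AE x in lborel. (if x \<in> \<Omega> then w x else 0) = w' x"
    using completion_ex_borel_measurable_real by blast
  have "AE x in lebesgue_on \<Omega>. w x = w' x"
    using AE_completion[OF w'(2)] assms(1) by (auto simp: AE_restrict_space_iff)
  with w'(1) that show ?thesis by simp
qed

lemma near_energy_cong_AE:
  assumes "AE x in lebesgue_on \<Omega>. w x = w' x"
  shows "near_energy \<Omega> p w t = near_energy \<Omega> p w' t"
  unfolding near_energy_def
proof (rule nn_integral_cong_AE, use assms in eventually_elim)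
  case (elim x)
  show ?case by (rule nn_integral_cong_AE, use assms in eventually_elim) (simp add: elim)
qed

lemma near_energy_mono: "t \<le> t' \<Longrightarrow> near_energy \<Omega> p w t \<le> near_energy \<Omega> p w t'"
  unfolding near_energy_def
  by (intro nn_integral_mono mult_left_mono) (auto split: split_indicator)

section \<open>Poincare inequality at all scales on a domain with uniform cones\<close>

locale cone_domain =
  fixes \<Omega> :: "'a::euclidean_space set" and c s\<^sub>0 :: real and T :: "'a set"
  assumes open_\<Omega>: "open \<Omega>" and bounded_\<Omega>: "bounded \<Omega>" and nonempty_\<Omega>: "\<Omega> \<noteq> {}"
    and uc: "uniform_cone \<Omega> c s\<^sub>0 T"
begin

lemma c: "0 < c" "c \<le> 1" and s\<^sub>0: "0 < s\<^sub>0" and T: "finite T"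
  using uc by (auto simp: uniform_cone_def)

abbreviation "M \<equiv> lebesgue_on \<Omega>"

lemma \<Omega>_lebesgue[simp, measurable]: "\<Omega> \<in> sets lebesgue" using open_\<Omega> by simp

lemma T_nonempty: "T \<noteq> {}"
proof -
  obtain x where "x \<in> \<Omega>" using nonempty_\<Omega> by blast
  then show ?thesis using uc unfolding uniform_cone_def by force
qed

lemma finite_measure_M: "finite_measure M"
proof (rule finite_measureI)
  have "emeasure lborel \<Omega> < \<infinity>" using bounded_\<Omega> by (rule emeasure_bounded_finite)
  then show "emeasure M (space M) \<noteq> \<infinity>"
    using open_\<Omega> by (simp add: emeasure_restrict_space)
qed

sublocale M: finite_measure M by (rule finite_measure_M)
sublocale MM: pair_sigma_finite M M ..

lemma measurable_ident_M[measurable]: "(\<lambda>x. x) \<in> borel_measurable M"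
  by (rule measurable_restrict_space1) (simp add: measurable_completion)

lemma near_energy_scale:
  assumes w: "w \<in> borel_measurable M" and p: "p > 1" and s: "0 < s" "s \<le> s\<^sub>0" and n: "n > 0"
  shows "near_energy \<Omega> p w (c * s / 2)
     \<le> ennreal (2 * 2 powr p * card T * real n powr (p + DIM('a))) * near_energy \<Omega> p w (2 * s / n)"
proof -
  obtain w' where w': "w' \<in> borel_measurable borel" "AE x in M. w x = w' x"
    using borel_representative[OF open_\<Omega> w] .
  show ?thesis unfolding near_energy_cong_AE[OF w'(2)]
    by (rule near_energy_scale_borel[OF open_\<Omega> borel_open[OF open_\<Omega>] w'(1) p uc s n])
qed

lemma near_energy_comparison:
  assumes p: "p > 1"
  shows "\<exists>K>0. \<forall>\<epsilon> r w. 0 < \<epsilon> \<longrightarrow> \<epsilon> \<le> r \<longrightarrow> r \<le> c * s\<^sub>0 / 2 \<longrightarrow> w \<in> borel_measurable M \<longrightarrow>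
     near_energy \<Omega> p w r \<le> ennreal (K * (r / \<epsilon>) powr (p + DIM('a))) * near_energy \<Omega> p w \<epsilon>"
proof (intro exI conjI allI impI)
  let ?e = "p + DIM('a)"
  let ?K = "2 * 2 powr p * card T * (5 / c) powr ?e"
  show "?K > 0" using T T_nonempty c by (simp add: card_gt_0_iff)
  fix \<epsilon> r :: real and w :: "'a \<Rightarrow> real"
  assume h: "0 < \<epsilon>" "\<epsilon> \<le> r" "r \<le> c * s\<^sub>0 / 2" "w \<in> borel_measurable M"
  \<comment> \<open>The height \<open>s\<close> is chosen to make the radius c s / 2 equal to
    \<open>r\<close>, and \<open>n\<close> to make the step length 2 s / n at most
    \<epsilon>.\<close>
  define s where "s = 2 * r / c"
  define n where "n = nat \<lceil>2 * s / \<epsilon>\<rceil>"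
  have s: "0 < s" "s \<le> s\<^sub>0" "c * s / 2 = r" using h c by (auto simp: s_def field_simps)
  have n: "real n \<ge> 2 * s / \<epsilon>" "real n \<le> 2 * s / \<epsilon> + 1"
  proof -
    have "0 < 2 * s / \<epsilon>" using s h by simp
    then show "real n \<ge> 2 * s / \<epsilon>" "real n \<le> 2 * s / \<epsilon> + 1" unfolding n_def by linarith+
  qed
  then have n0: "n > 0" using s h by (metis divide_pos_pos gr0I mult_pos_pos not_less of_nat_0 zero_less_numeral)
  \<comment> \<open>Rounding up adds at most 1, which is itself at most r / (c \<epsilon>). This is
    how 4 becomes 5 in the bound for \<open>n\<close>.\<close>
  have "1 \<le> r / (c * \<epsilon>)" using h c mult_mono[of c 1 \<epsilon> r] by simp
  moreover have "2 * s / \<epsilon> = 4 * (r / (c * \<epsilon>))" by (simp add: s_def)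
  moreover have "5 / c * (r / \<epsilon>) = 5 * (r / (c * \<epsilon>))" by simp
  ultimately have n5: "real n \<le> 5 / c * (r / \<epsilon>)" using n(2) by linarith
  have sn: "2 * s / n \<le> \<epsilon>" using n(1) n0 h by (simp add: field_simps)
  have "near_energy \<Omega> p w r \<le> ennreal (2 * 2 powr p * card T * real n powr ?e) * near_energy \<Omega> p w (2 * s / n)"
    using near_energy_scale[OF h(4) p s(1,2) n0] s(3) by simp
  also have "\<dots> \<le> ennreal (2 * 2 powr p * card T * (5 / c * (r / \<epsilon>)) powr ?e) * near_energy \<Omega> p w \<epsilon>"
    using n5 p by (intro mult_mono near_energy_mono sn ennreal_leI mult_left_mono powr_mono2) auto
  also have "(5 / c * (r / \<epsilon>)) powr ?e = (5 / c) powr ?e * (r / \<epsilon>) powr ?e"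
    using h c by (intro powr_mult) 
  finally show "near_energy \<Omega> p w r \<le> ennreal (?K * (r / \<epsilon>) powr ?e) * near_energy \<Omega> p w \<epsilon>"
    by (simp add: mult.assoc)
qed

text \<open>\<open>\<kappa> * r ^ DIM('a)\<close> is the volume of the ball of radius c r / 2 that
  the cone contains at height r / 2.\<close>

definition \<kappa> :: real where "\<kappa> = unit_ball_vol (real DIM('a)) * (c / 2) ^ DIM('a)"

lemma \<kappa>_pos: "\<kappa> > 0" using c by (simp add: \<kappa>_def)

lemma measure_density:
  assumes "x \<in> \<Omega>" "0 < r" "r \<le> s\<^sub>0"
  shows "\<kappa> * r ^ DIM('a) \<le> measure M (\<Omega> \<inter> ball x r)"
proof -
  obtain \<nu> where \<nu>: "\<nu> \<in> T" "cone_at \<Omega> c s\<^sub>0 \<nu> x" using uc assms s\<^sub>0 unfolding uniform_cone_def by force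
  then have n1: "norm \<nu> = 1" using uc by (auto simp: uniform_cone_def)
  have sub: "ball (x + (r/2) *\<^sub>R \<nu>) (c * (r/2)) \<subseteq> \<Omega> \<inter> ball x r"
  proof
    fix z assume z: "z \<in> ball (x + (r/2) *\<^sub>R \<nu>) (c * (r/2))"
    have "dist x z \<le> dist x (x + (r/2) *\<^sub>R \<nu>) + dist (x + (r/2) *\<^sub>R \<nu>) z" by (rule dist_triangle)
    also have "\<dots> < r/2 + c * (r/2)" using z n1 assms by (simp add: dist_norm)
    also have "\<dots> \<le> r" using c assms mult_right_mono[of c 1 "r/2"] by linarith
    finally have "z \<in> ball x r" by simp
    moreover have "r/2 \<in> {0<..s\<^sub>0}" using assms by auto
    then have "z \<in> \<Omega>" using z \<nu>(2) unfolding cone_at_def by blast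
    ultimately show "z \<in> \<Omega> \<inter> ball x r" by blast
  qed
  have "\<kappa> * r ^ DIM('a) = measure lborel (ball (x + (r/2) *\<^sub>R \<nu>) (c * (r/2)))"
    using c assms by (simp add: \<kappa>_def content_ball power_mult_distrib power_divide)
  also have "\<dots> \<le> measure lborel (\<Omega> \<inter> ball x r)"
  proof (rule measure_mono_fmeasurable[OF sub])
    have "emeasure lborel (\<Omega> \<inter> ball x r) < \<infinity>"
      by (intro emeasure_bounded_finite bounded_Int) auto
    then show "\<Omega> \<inter> ball x r \<in> fmeasurable lborel"
      using open_\<Omega> by (intro fmeasurableI) auto
  qed simp
  also have "\<dots> = measure M (\<Omega> \<inter> ball x r)"
    using open_\<Omega> by (simp add: measure_restrict_space)
  finally show ?thesis .
qed

text \<open>The threshold \<Lambda> is such that at least half of the guaranteed measure of every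
  ball in \<open>\<Omega>\<close> carries values below \<Lambda>. Where |w x| exceeds 2 \<Lambda>,
  each such value differs from \<open>w x\<close> by at least half of |w x|, so the local energy at
  \<open>x\<close> controls it. Elsewhere the bound is trivial, and \<Lambda> is a multiple of the
  L^1 norm.\<close>

lemma local_poincare:
  assumes w[measurable]: "w \<in> borel_measurable M" and int: "integrable M w" and p: "p > 1"
    and r: "0 < r" "r \<le> s\<^sub>0"
  shows "(\<integral>\<^sup>+x. ennreal (\<bar>w x\<bar> powr p) \<partial>M) \<le>
     ennreal (measure M \<Omega> * (4 * (LINT x|M. \<bar>w x\<bar>) / (\<kappa> * r ^ DIM('a))) powr p)
     + ennreal (2 powr p * 2 / (\<kappa> * r ^ DIM('a))) * near_energy \<Omega> p w r"
proof (cases "(LINT x|M. \<bar>w x\<bar>) = 0")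
  case True
  then have "AE x in M. \<bar>w x\<bar> = 0" using int by (subst (asm) integral_nonneg_eq_0_iff_AE) auto
  then have "(\<integral>\<^sup>+x. ennreal (\<bar>w x\<bar> powr p) \<partial>M) = (\<integral>\<^sup>+x. 0 \<partial>M)"
    by (intro nn_integral_cong_AE) (use p in \<open>auto\<close>)
  then show ?thesis by simp
next
  case False
  define I where "I = (LINT x|M. \<bar>w x\<bar>)"
  define m where "m = \<kappa> * r ^ DIM('a)"
  \<comment> \<open>Markov's inequality at this level gives measure at most m / 2. It needs a
    positive integral; the case of zero integral, where \<open>w\<close> vanishes almost everywhere,
    has been split off.\<close>
  define \<Lambda> where "\<Lambda> = 2 * I / m"
  have I: "I > 0" using False integral_nonneg_AE[where M=M and f="\<lambda>x. \<bar>w x\<bar>"] unfolding I_def by (simp add: less_le)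
  have m: "m > 0" using \<kappa>_pos r by (simp add: m_def)
  have \<Lambda>: "\<Lambda> > 0" using I m by (simp add: \<Lambda>_def)
  define B where "B = {x \<in> space M. \<bar>w x\<bar> \<ge> \<Lambda>}"
  have Bm[measurable]: "B \<in> sets M" unfolding B_def by measurable
  have "measure M B \<le> I / \<Lambda>"
    unfolding B_def I_def by (rule integral_Markov_inequality_measure[where A="{}"]) (use int \<Lambda> in auto)
  also have "\<dots> = m / 2" using I m by (simp add: \<Lambda>_def)
  finally have B: "measure M B \<le> m / 2" .
  have ball_sets[measurable]: "\<Omega> \<inter> ball x r \<in> sets M" for x
    by (subst sets_restrict_space_iff) (auto intro: sets.Int)
  have pt: "ennreal (\<bar>w x\<bar> powr p) \<le> ennreal ((2 * \<Lambda>) powr p) +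
      ennreal (2 powr p * 2 / m) * (\<integral>\<^sup>+y. ennreal (\<bar>w y - w x\<bar> powr p) * indicator (ball x r) y \<partial>M)"
    if x: "x \<in> \<Omega>" for x
  proof (cases "\<bar>w x\<bar> \<le> 2 * \<Lambda>")
    case True
    then have "\<bar>w x\<bar> powr p \<le> (2 * \<Lambda>) powr p" using p by (intro powr_mono2) auto
    then show ?thesis by (intro add_increasing2 ennreal_leI) auto
  next
    case big: False
    define G where "G = \<Omega> \<inter> ball x r - B"
    have Gm[measurable]: "G \<in> sets M" unfolding G_def by measurable
    have "m \<le> measure M (\<Omega> \<inter> ball x r)" unfolding m_def by (rule measure_density[OF x r])
    also have "\<dots> \<le> measure M (G \<union> B)" by (rule M.finite_measure_mono) (auto simp: G_def)
    also have "\<dots> \<le> measure M G + measure M B" by (rule measure_Un_le) auto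
    finally have G: "m / 2 \<le> measure M G" using B by simp
    have "ennreal (\<bar>w x\<bar> powr p) * ennreal (m / 2) \<le> ennreal (\<bar>w x\<bar> powr p) * emeasure M G"
      using G by (intro mult_left_mono) (auto simp: M.emeasure_eq_measure ennreal_leI)
    also have "\<dots> = (\<integral>\<^sup>+y. ennreal (\<bar>w x\<bar> powr p) * indicator G y \<partial>M)"
      by (simp add: nn_integral_cmult_indicator)
    also have "\<dots> \<le> (\<integral>\<^sup>+y. ennreal (2 powr p) * (ennreal (\<bar>w y - w x\<bar> powr p) * indicator (ball x r) y) \<partial>M)"
    proof (rule nn_integral_mono)
      fix y assume "y \<in> space M"
      show "ennreal (\<bar>w x\<bar> powr p) * indicator G y \<le> ennreal (2 powr p) * (ennreal (\<bar>w y - w x\<bar> powr p) * indicator (ball x r) y)"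
      proof (cases "y \<in> G")
        case True
        then have wy: "\<bar>w y\<bar> < \<Lambda>" and y: "y \<in> ball x r" by (auto simp: G_def B_def)
        have "\<bar>w x\<bar> \<le> 2 * \<bar>w y - w x\<bar>"
          using wy big abs_triangle_ineq2[of "w x" "w y"] by (simp add: abs_minus_commute)
        then have "\<bar>w x\<bar> powr p \<le> (2 * \<bar>w y - w x\<bar>) powr p" using p by (intro powr_mono2) auto
        also have "\<dots> = 2 powr p * \<bar>w y - w x\<bar> powr p" by (simp add: powr_mult)
        finally show ?thesis using True y by (simp add: ennreal_mult'[symmetric] ennreal_leI)
      qed simp
    qed
    also have "\<dots> = ennreal (2 powr p) * (\<integral>\<^sup>+y. ennreal (\<bar>w y - w x\<bar> powr p) * indicator (ball x r) y \<partial>M)"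
      by (rule nn_integral_cmult) measurable
    finally have "ennreal (2 / m) * (ennreal (\<bar>w x\<bar> powr p) * ennreal (m / 2)) \<le>
        ennreal (2 / m) * (ennreal (2 powr p) * (\<integral>\<^sup>+y. ennreal (\<bar>w y - w x\<bar> powr p) * indicator (ball x r) y \<partial>M))"
      by (rule mult_left_mono) simp
    moreover have "ennreal (2 / m) * (a * ennreal (m / 2)) = a" for a
    proof -
      have "ennreal (2 / m) * ennreal (m / 2) = ennreal (2 / m * (m / 2))"
        using m by (intro ennreal_mult'[symmetric]) simp
      then show ?thesis using m by (simp add: mult.left_commute)
    qed
    moreover have "ennreal (2 / m) * (ennreal (2 powr p) * X) = ennreal (2 powr p * 2 / m) * X" for X
    proof -
      have "ennreal (2 / m) * ennreal (2 powr p) = ennreal (2 / m * 2 powr p)"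
        using m by (intro ennreal_mult'[symmetric]) simp
      also have "2 / m * 2 powr p = 2 powr p * 2 / m" by simp
      finally show ?thesis unfolding mult.assoc[symmetric] by (rule arg_cong)
    qed
    ultimately have "ennreal (\<bar>w x\<bar> powr p) \<le>
      ennreal (2 powr p * 2 / m) * (\<integral>\<^sup>+y. ennreal (\<bar>w y - w x\<bar> powr p) * indicator (ball x r) y \<partial>M)" by simp
    then show ?thesis by (simp add: add_increasing)
  qed
  have "(\<lambda>(x, y). ennreal (\<bar>w y - w x\<bar> powr p) * indicator (ball x r) y) \<in> borel_measurable (M \<Otimes>\<^sub>M M)"
    by measurable
  then have [measurable]: "(\<lambda>x. \<integral>\<^sup>+y. ennreal (\<bar>w y - w x\<bar> powr p) * indicator (ball x r) y \<partial>M) \<in> borel_measurable M"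
    by measurable
  have "(\<integral>\<^sup>+x. ennreal (\<bar>w x\<bar> powr p) \<partial>M) \<le> (\<integral>\<^sup>+x. ennreal ((2 * \<Lambda>) powr p) +
      ennreal (2 powr p * 2 / m) * (\<integral>\<^sup>+y. ennreal (\<bar>w y - w x\<bar> powr p) * indicator (ball x r) y \<partial>M) \<partial>M)"
    by (intro nn_integral_mono pt) simp
  also have "\<dots> = ennreal ((2 * \<Lambda>) powr p) * emeasure M (space M) + ennreal (2 powr p * 2 / m) * near_energy \<Omega> p w r"
    by (simp add: nn_integral_add nn_integral_cmult near_energy_def)
  also have "ennreal ((2 * \<Lambda>) powr p) * emeasure M (space M) = ennreal (measure M \<Omega> * (4 * I / m) powr p)"
    by (simp add: M.emeasure_eq_measure ennreal_mult'' \<Lambda>_def mult.commute)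
  finally show ?thesis by (simp add: I_def m_def)
qed

text \<open>The local inequality at scale \<open>r\<close> is combined with the comparison of
  energies. Of the factor (r/\<epsilon>)^(p+d), the part r^d is cancelled by the density bound in
  the denominator.\<close>

lemma multiscale_poincare:
  assumes p: "p > 1"
  shows "\<exists>C>0. \<forall>\<epsilon> r w. 0 < \<epsilon> \<longrightarrow> \<epsilon> \<le> r \<longrightarrow> r \<le> c * s\<^sub>0 / 2 \<longrightarrow> integrable M w \<longrightarrow>
     (\<integral>\<^sup>+x. ennreal (\<bar>w x\<bar> powr p) \<partial>M) \<le> ennreal (C * ((LINT x|M. \<bar>w x\<bar>) / r ^ DIM('a)) powr p)
       + ennreal (C * r powr p / \<epsilon> powr (p + DIM('a))) * near_energy \<Omega> p w \<epsilon>"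
proof -
  obtain K where K: "K > 0" "\<And>\<epsilon> r w. \<lbrakk>0 < \<epsilon>; \<epsilon> \<le> r; r \<le> c * s\<^sub>0 / 2; w \<in> borel_measurable M\<rbrakk> \<Longrightarrow>
     near_energy \<Omega> p w r \<le> ennreal (K * (r / \<epsilon>) powr (p + DIM('a))) * near_energy \<Omega> p w \<epsilon>"
    using near_energy_comparison[OF p] by blast
  define C1 where "C1 = measure M \<Omega> * (4 / \<kappa>) powr p"
  define C2 where "C2 = 2 powr p * 2 / \<kappa> * K"
  have C: "C1 \<ge> 0" "C2 > 0" using K \<kappa>_pos by (auto simp: C1_def C2_def)
  show ?thesis
  proof (intro exI[of _ "C1 + C2"] conjI allI impI)
    fix \<epsilon> r :: real and w :: "'a \<Rightarrow> real"
    assume h: "0 < \<epsilon>" "\<epsilon> \<le> r" "r \<le> c * s\<^sub>0 / 2" "integrable M w"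
    have w: "w \<in> borel_measurable M" using h(4) by simp
    have r: "0 < r" "r \<le> s\<^sub>0" using h s\<^sub>0 mult_right_mono[OF c(2), of s\<^sub>0] by linarith+
    let ?I = "(LINT x|M. \<bar>w x\<bar>)"
    have I: "?I \<ge> 0" by simp
    have "measure M \<Omega> * (4 * ?I / (\<kappa> * r ^ DIM('a))) powr p = measure M \<Omega> * ((4 / \<kappa>) * (?I / r ^ DIM('a))) powr p"
      by simp
    also have "\<dots> = C1 * (?I / r ^ DIM('a)) powr p"
      using I \<kappa>_pos r by (simp only: C1_def powr_mult mult.assoc)
    also have "\<dots> \<le> (C1 + C2) * (?I / r ^ DIM('a)) powr p" using C by (intro mult_right_mono) auto
    finally have 1: "ennreal (measure M \<Omega> * (4 * ?I / (\<kappa> * r ^ DIM('a))) powr p) \<le> ennreal ((C1 + C2) * (?I / r ^ DIM('a)) powr p)"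
      by (rule ennreal_leI)
    have "ennreal (2 powr p * 2 / (\<kappa> * r ^ DIM('a))) * near_energy \<Omega> p w r \<le>
        ennreal (2 powr p * 2 / (\<kappa> * r ^ DIM('a))) * (ennreal (K * (r / \<epsilon>) powr (p + DIM('a))) * near_energy \<Omega> p w \<epsilon>)"
      by (intro mult_left_mono K(2) h w) simp
    also have "\<dots> = ennreal (2 powr p * 2 / (\<kappa> * r ^ DIM('a)) * (K * (r / \<epsilon>) powr (p + DIM('a)))) * near_energy \<Omega> p w \<epsilon>"
      using K r \<kappa>_pos by (simp add: ennreal_mult'[symmetric] mult.assoc[symmetric])
    also have "2 powr p * 2 / (\<kappa> * r ^ DIM('a)) * (K * (r / \<epsilon>) powr (p + DIM('a))) = C2 * r powr p / \<epsilon> powr (p + DIM('a))"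
      using r h(1) by (simp add: C2_def powr_divide powr_add powr_realpow)
    also have "ennreal (C2 * r powr p / \<epsilon> powr (p + DIM('a))) \<le> ennreal ((C1 + C2) * r powr p / \<epsilon> powr (p + DIM('a)))"
      using C by (intro ennreal_leI divide_right_mono mult_right_mono) auto
    finally have 2: "ennreal (2 powr p * 2 / (\<kappa> * r ^ DIM('a))) * near_energy \<Omega> p w r \<le>
        ennreal ((C1 + C2) * r powr p / \<epsilon> powr (p + DIM('a))) * near_energy \<Omega> p w \<epsilon>"
      by (simp add: mult_right_mono)
    show "(\<integral>\<^sup>+x. ennreal (\<bar>w x\<bar> powr p) \<partial>M) \<le> ennreal ((C1 + C2) * (?I / r ^ DIM('a)) powr p)
       + ennreal ((C1 + C2) * r powr p / \<epsilon> powr (p + DIM('a))) * near_energy \<Omega> p w \<epsilon>"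
      by (rule order_trans[OF local_poincare[OF w h(4) p r] add_mono[OF 1 2]])
  qed (use C in simp)
qed

end

section \<open>The kernel\<close>

locale nonlocal_domain = cone_domain \<Omega> c s\<^sub>0 T
  for \<Omega> :: "'a::euclidean_space set" and c s\<^sub>0 T +
  fixes \<eta> :: "real \<Rightarrow> real" and \<rho> :: "'a \<Rightarrow> real" and \<rho>\<^sub>0 \<rho>\<^sub>1 :: real
  assumes \<eta>: "kernel_profile \<eta>" and \<rho>_meas[measurable]: "\<rho> \<in> borel_measurable (lebesgue_on \<Omega>)"
    and \<rho>\<^sub>0: "0 < \<rho>\<^sub>0" and \<rho>_bounds: "\<And>x. x \<in> \<Omega> \<Longrightarrow> \<rho>\<^sub>0 \<le> \<rho> x \<and> \<rho> x \<le> \<rho>\<^sub>1"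
begin

definition k :: "real \<Rightarrow> 'a \<Rightarrow> 'a \<Rightarrow> real" where
  "k \<epsilon> x y = rescaled_kernel DIM('a) \<eta> \<epsilon> (norm (x - y))"

lemma \<eta>_nonneg: "0 \<le> s \<Longrightarrow> 0 \<le> \<eta> s" using \<eta> by (simp add: kernel_profile_def)

lemma \<eta>_antimono: "0 \<le> s \<Longrightarrow> s \<le> t \<Longrightarrow> \<eta> t \<le> \<eta> s"
  using \<eta> unfolding kernel_profile_def monotone_on_def by auto

lemma \<eta>_ge1: "0 \<le> s \<Longrightarrow> s \<le> 1 \<Longrightarrow> 1 \<le> \<eta> s"
  using \<eta>_antimono[of s 1] \<eta> by (simp add: kernel_profile_def)

lemma \<eta>_eq0: "2 \<le> s \<Longrightarrow> \<eta> s = 0"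
  using \<eta>_antimono[of 2 s] \<eta>_nonneg[of s] \<eta> by (simp add: kernel_profile_def)

lemma \<eta>0: "1 \<le> \<eta> 0" using \<eta>_ge1 by simp

lemma \<rho>\<^sub>1: "0 < \<rho>\<^sub>1" using \<rho>_bounds \<rho>\<^sub>0 nonempty_\<Omega> by fastforce

lemma k_sym: "k \<epsilon> x y = k \<epsilon> y x" by (simp add: k_def norm_minus_commute)

lemma k_nonneg: "\<epsilon> > 0 \<Longrightarrow> 0 \<le> k \<epsilon> x y"
  by (simp add: k_def rescaled_kernel_def \<eta>_nonneg)

lemma k_le: "\<epsilon> > 0 \<Longrightarrow> k \<epsilon> x y \<le> \<eta> 0 / \<epsilon> ^ DIM('a)"
  by (simp add: k_def rescaled_kernel_def \<eta>_antimono divide_right_mono)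

lemma k_ge: "\<epsilon> > 0 \<Longrightarrow> y \<in> ball x \<epsilon> \<Longrightarrow> 1 / \<epsilon> ^ DIM('a) \<le> k \<epsilon> x y"
  by (simp add: k_def rescaled_kernel_def dist_norm \<eta>_ge1 divide_right_mono)

lemma k_eq0: "\<epsilon> > 0 \<Longrightarrow> y \<notin> ball x (2 * \<epsilon>) \<Longrightarrow> k \<epsilon> x y = 0"
  by (simp add: k_def rescaled_kernel_def dist_norm \<eta>_eq0 field_simps)

text \<open>Only the values of the profile on \<open>[0, \<infinity>)\<close> are controlled.\<close>

lemma k_measurable[measurable]: "(\<lambda>(x, y). k \<epsilon> x y) \<in> borel_measurable (borel \<Otimes>\<^sub>M borel)" if "\<epsilon> > 0"
proof -
  have "mono (\<lambda>s. - \<eta> (max 0 s))" by (auto intro!: monoI \<eta>_antimono)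
  then have "(\<lambda>s. - \<eta> (max 0 s)) \<in> borel_measurable borel" by (rule borel_measurable_mono)
  then have [measurable]: "(\<lambda>s. \<eta> (max 0 s)) \<in> borel_measurable borel"
    using borel_measurable_uminus_eq by blast
  have "(\<lambda>(x, y). \<eta> (max 0 (norm (x - y) / \<epsilon>)) / \<epsilon> ^ DIM('a)) \<in> borel_measurable (borel \<Otimes>\<^sub>M (borel :: 'a measure))"
    by measurable
  moreover have "k \<epsilon> x y = \<eta> (max 0 (norm (x - y) / \<epsilon>)) / \<epsilon> ^ DIM('a)" for x y
    using that by (simp add: k_def rescaled_kernel_def max_absorb2)
  ultimately show ?thesis by (simp add: case_prod_beta)
qed

lemma nonlocal_energy_eq:
  "nonlocal_energy \<Omega> \<eta> \<epsilon> p w = (\<integral>\<^sup>+x. (\<integral>\<^sup>+y. ennreal (k \<epsilon> x y * \<bar>(w y - w x) / \<epsilon>\<bar> powr p) \<partial>M) \<partial>M)"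
  by (simp add: nonlocal_energy_def k_def)

text \<open>Within distance \<epsilon> the profile is at least 1, so the kernel is at least
  \<epsilon>^(-d). The difference quotient accounts for the remaining \<epsilon>^p.\<close>

lemma near_energy_le:
  assumes \<epsilon>: "\<epsilon> > 0" and w[measurable]: "w \<in> borel_measurable M"
  shows "near_energy \<Omega> p w \<epsilon> \<le> ennreal (\<epsilon> powr (p + DIM('a))) * nonlocal_energy \<Omega> \<eta> \<epsilon> p w"
proof -
  note [measurable] = k_measurable[OF \<epsilon>]
  have [measurable]: "(\<lambda>(x, y). ennreal (k \<epsilon> x y * \<bar>(w y - w x) / \<epsilon>\<bar> powr p)) \<in> borel_measurable (M \<Otimes>\<^sub>M M)"
    by measurable
  have "near_energy \<Omega> p w \<epsilon> \<le>
     (\<integral>\<^sup>+x. (\<integral>\<^sup>+y. ennreal (\<epsilon> powr (p + DIM('a))) * ennreal (k \<epsilon> x y * \<bar>(w y - w x) / \<epsilon>\<bar> powr p) \<partial>M) \<partial>M)"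
    unfolding near_energy_def
  proof (intro nn_integral_mono)
    fix x y
    show "ennreal (\<bar>w y - w x\<bar> powr p) * indicator (ball x \<epsilon>) y \<le>
       ennreal (\<epsilon> powr (p + DIM('a))) * ennreal (k \<epsilon> x y * \<bar>(w y - w x) / \<epsilon>\<bar> powr p)"
    proof (cases "y \<in> ball x \<epsilon>")
      case True
      have "\<bar>w y - w x\<bar> powr p = \<epsilon> powr (p + DIM('a)) * (1 / \<epsilon> ^ DIM('a) * \<bar>(w y - w x) / \<epsilon>\<bar> powr p)"
        using \<epsilon> by (simp add: powr_divide abs_divide powr_add powr_realpow)
      also have "\<dots> \<le> \<epsilon> powr (p + DIM('a)) * (k \<epsilon> x y * \<bar>(w y - w x) / \<epsilon>\<bar> powr p)"
        using k_ge[OF \<epsilon> True] by (intro mult_left_mono mult_right_mono) auto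
      finally show ?thesis using True k_nonneg[OF \<epsilon>] by (simp add: ennreal_mult'[symmetric] ennreal_leI)
    qed simp
  qed
  also have "\<dots> = ennreal (\<epsilon> powr (p + DIM('a))) * nonlocal_energy \<Omega> \<eta> \<epsilon> p w"
    by (simp add: nonlocal_energy_eq nn_integral_cmult)
  finally show ?thesis .
qed

lemma kernel_poincare:
  assumes p: "p > 1"
  shows "\<exists>C>0. \<forall>\<epsilon> r w. 0 < \<epsilon> \<longrightarrow> \<epsilon> \<le> r \<longrightarrow> r \<le> c * s\<^sub>0 / 2 \<longrightarrow> integrable M w \<longrightarrow>
     (\<integral>\<^sup>+x. ennreal (\<bar>w x\<bar> powr p) \<partial>M) \<le> ennreal (C * ((LINT x|M. \<bar>w x\<bar>) / r ^ DIM('a)) powr p)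
       + ennreal (C * r powr p) * nonlocal_energy \<Omega> \<eta> \<epsilon> p w"
proof -
  obtain C where C: "C > 0" "\<And>\<epsilon> r w. \<lbrakk>0 < \<epsilon>; \<epsilon> \<le> r; r \<le> c * s\<^sub>0 / 2; integrable M w\<rbrakk> \<Longrightarrow>
     (\<integral>\<^sup>+x. ennreal (\<bar>w x\<bar> powr p) \<partial>M) \<le> ennreal (C * ((LINT x|M. \<bar>w x\<bar>) / r ^ DIM('a)) powr p)
       + ennreal (C * r powr p / \<epsilon> powr (p + DIM('a))) * near_energy \<Omega> p w \<epsilon>"
    using multiscale_poincare[OF p] by blast
  show ?thesis
  proof (intro exI[of _ C] conjI allI impI)
    fix \<epsilon> r :: real and w :: "'a \<Rightarrow> real"
    assume h: "0 < \<epsilon>" "\<epsilon> \<le> r" "r \<le> c * s\<^sub>0 / 2" "integrable M w"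
    have "ennreal (C * r powr p / \<epsilon> powr (p + DIM('a))) * near_energy \<Omega> p w \<epsilon> \<le>
      ennreal (C * r powr p / \<epsilon> powr (p + DIM('a))) * (ennreal (\<epsilon> powr (p + DIM('a))) * nonlocal_energy \<Omega> \<eta> \<epsilon> p w)"
      using h by (intro mult_left_mono near_energy_le) auto
    also have "\<dots> = ennreal (C * r powr p) * nonlocal_energy \<Omega> \<eta> \<epsilon> p w"
      using h(1) C(1) by (simp add: ennreal_mult'[symmetric] mult.assoc[symmetric])
    finally show "(\<integral>\<^sup>+x. ennreal (\<bar>w x\<bar> powr p) \<partial>M) \<le> ennreal (C * ((LINT x|M. \<bar>w x\<bar>) / r ^ DIM('a)) powr p)
       + ennreal (C * r powr p) * nonlocal_energy \<Omega> \<eta> \<epsilon> p w"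
      by (intro order_trans[OF C(2)[OF h]] add_left_mono)
  qed (rule C)
qed

text \<open>The scale is frozen at r = c s0 / 2. If \<epsilon> is at most \<open>r\<close>, the
  comparison of scales applies. Otherwise pairs closer than \<open>r\<close> are among those closer
  than \<epsilon>, and the bound \<open>\<epsilon>\<^sub>0\<close> controls the factor
  \<epsilon>^(p+d).\<close>

lemma uniform_poincare:
  assumes p: "p > 1" and \<epsilon>0: "\<epsilon>\<^sub>0 > 0"
  shows "\<exists>C>0. \<forall>\<epsilon>\<in>{0<..\<epsilon>\<^sub>0}. \<forall>w. integrable M w \<longrightarrow>
     (\<integral>\<^sup>+x. ennreal (\<bar>w x\<bar> powr p) \<partial>M) \<le> ennreal (C * (LINT x|M. \<bar>w x\<bar>) powr p)
       + ennreal C * nonlocal_energy \<Omega> \<eta> \<epsilon> p w"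
proof -
  define r where "r = c * s\<^sub>0 / 2"
  have r: "0 < r" "r \<le> s\<^sub>0" using c s\<^sub>0 mult_right_mono[OF c(2), of s\<^sub>0] unfolding r_def by (simp, linarith)
  obtain C1 where C1: "C1 > 0" "\<And>\<epsilon> w. \<lbrakk>0 < \<epsilon>; \<epsilon> \<le> r; integrable M w\<rbrakk> \<Longrightarrow>
     (\<integral>\<^sup>+x. ennreal (\<bar>w x\<bar> powr p) \<partial>M) \<le> ennreal (C1 * ((LINT x|M. \<bar>w x\<bar>) / r ^ DIM('a)) powr p)
       + ennreal (C1 * r powr p) * nonlocal_energy \<Omega> \<eta> \<epsilon> p w"
    using kernel_poincare[OF p] unfolding r_def by blast
  define A where "A = C1 / (r ^ DIM('a)) powr p"
  define A' where "A' = measure M \<Omega> * (4 / (\<kappa> * r ^ DIM('a))) powr p"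
  define B where "B = C1 * r powr p"
  define B' where "B' = 2 powr p * 2 / (\<kappa> * r ^ DIM('a)) * \<epsilon>\<^sub>0 powr (p + DIM('a))"
  define C where "C = A + A' + B + B'"
  have pos: "A > 0" "A' \<ge> 0" "B > 0" "B' > 0"
    using C1(1) r \<kappa>_pos \<epsilon>0 by (auto simp: A_def A'_def B_def B'_def)
  show ?thesis
  proof (intro exI[of _ C] conjI ballI allI impI)
    fix \<epsilon> and w :: "'a \<Rightarrow> real" assume \<epsilon>: "\<epsilon> \<in> {0<..\<epsilon>\<^sub>0}" and w: "integrable M w"
    have wm: "w \<in> borel_measurable M" using w by simp
    let ?I = "(LINT x|M. \<bar>w x\<bar>)" and ?E = "nonlocal_energy \<Omega> \<eta> \<epsilon> p w"
    have I: "?I \<ge> 0" by simp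
    show "(\<integral>\<^sup>+x. ennreal (\<bar>w x\<bar> powr p) \<partial>M) \<le> ennreal (C * ?I powr p) + ennreal C * ?E"
    proof (cases "\<epsilon> \<le> r")
      case True
      have "C1 * (?I / r ^ DIM('a)) powr p = A * ?I powr p"
        using I r by (simp add: A_def powr_divide)
      also have "\<dots> \<le> C * ?I powr p" using pos by (intro mult_right_mono) (auto simp: C_def)
      finally have 1: "ennreal (C1 * (?I / r ^ DIM('a)) powr p) \<le> ennreal (C * ?I powr p)" by (rule ennreal_leI)
      have 2: "ennreal (C1 * r powr p) * ?E \<le> ennreal C * ?E"
        using pos unfolding B_def[symmetric] by (intro mult_right_mono ennreal_leI) (auto simp: C_def)
      show ?thesis using C1(2)[of \<epsilon> w] \<epsilon> True w add_mono[OF 1 2] by (auto intro: order_trans)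
    next
      case False
      have "measure M \<Omega> * (4 * ?I / (\<kappa> * r ^ DIM('a))) powr p = measure M \<Omega> * (4 / (\<kappa> * r ^ DIM('a)) * ?I) powr p"
        by simp
      also have "\<dots> = A' * ?I powr p"
        using I r \<kappa>_pos by (simp only: A'_def powr_mult mult.assoc)
      also have "\<dots> \<le> C * ?I powr p" using pos by (intro mult_right_mono) (auto simp: C_def)
      finally have 1: "ennreal (measure M \<Omega> * (4 * ?I / (\<kappa> * r ^ DIM('a))) powr p) \<le> ennreal (C * ?I powr p)" by (rule ennreal_leI)
      have "near_energy \<Omega> p w r \<le> near_energy \<Omega> p w \<epsilon>" using False by (intro near_energy_mono) simp
      also have "\<dots> \<le> ennreal (\<epsilon> powr (p + DIM('a))) * ?E" using \<epsilon> wm by (intro near_energy_le) auto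
      also have "\<dots> \<le> ennreal (\<epsilon>\<^sub>0 powr (p + DIM('a))) * ?E"
        using \<epsilon> p by (intro mult_right_mono ennreal_leI powr_mono2) auto
      finally have "ennreal (2 powr p * 2 / (\<kappa> * r ^ DIM('a))) * near_energy \<Omega> p w r \<le>
         ennreal (2 powr p * 2 / (\<kappa> * r ^ DIM('a))) * (ennreal (\<epsilon>\<^sub>0 powr (p + DIM('a))) * ?E)"
        by (rule mult_left_mono) simp
      also have "\<dots> = ennreal B' * ?E" using r \<kappa>_pos by (simp add: B'_def ennreal_mult'[symmetric] mult.assoc[symmetric])
      also have "\<dots> \<le> ennreal C * ?E" using pos by (intro mult_right_mono ennreal_leI) (auto simp: C_def)
      finally have 2: "ennreal (2 powr p * 2 / (\<kappa> * r ^ DIM('a))) * near_energy \<Omega> p w r \<le> ennreal C * ?E" .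
      show ?thesis by (rule order_trans[OF local_poincare[OF wm w p r] add_mono[OF 1 2]])
    qed
  qed (use pos in \<open>simp add: C_def\<close>)
qed

section \<open>Total mass and integrability of the kernel\<close>

definition mass :: "real \<Rightarrow> 'a \<Rightarrow> real" where
  "mass \<epsilon> x = (LINT y|M. k \<epsilon> x y * \<rho> y)"

lemma k_section_measurable: "\<epsilon> > 0 \<Longrightarrow> (\<lambda>y. k \<epsilon> x y) \<in> borel_measurable M"
proof -
  assume "\<epsilon> > 0"
  note [measurable] = k_measurable[OF this]
  show ?thesis by measurable
qed

lemma integrable_k_mult:
  assumes \<epsilon>: "\<epsilon> > 0" and f: "integrable M f"
  shows "integrable M (\<lambda>y. k \<epsilon> x y * (f y * \<rho> y))" and "integrable M (\<lambda>y. f y * \<rho> y)"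
proof -
  note [measurable] = k_section_measurable[OF \<epsilon>] 
  have [measurable]: "f \<in> borel_measurable M" using f by simp
  have \<rho>: "\<bar>\<rho> y\<bar> \<le> \<rho>\<^sub>1" if "y \<in> \<Omega>" for y using \<rho>_bounds[OF that] \<rho>\<^sub>0 by simp
  show *: "integrable M (\<lambda>y. f y * \<rho> y)"
  proof (rule Bochner_Integration.integrable_bound[where f="\<lambda>y. \<rho>\<^sub>1 * f y"])
    show "AE y in M. norm (f y * \<rho> y) \<le> norm (\<rho>\<^sub>1 * f y)"
      using \<rho> \<rho>\<^sub>1 by (intro AE_I2) (simp add: abs_mult mult.commute mult_right_mono)
  qed (use f in auto)
  show "integrable M (\<lambda>y. k \<epsilon> x y * (f y * \<rho> y))"
  proof (rule Bochner_Integration.integrable_bound[where f="\<lambda>y. \<eta> 0 / \<epsilon> ^ DIM('a) * (f y * \<rho> y)"])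
    show "AE y in M. norm (k \<epsilon> x y * (f y * \<rho> y)) \<le> norm (\<eta> 0 / \<epsilon> ^ DIM('a) * (f y * \<rho> y))"
    proof (rule AE_I2)
      fix y
      have "\<bar>k \<epsilon> x y\<bar> \<le> \<bar>\<eta> 0 / \<epsilon> ^ DIM('a)\<bar>" using k_nonneg[OF \<epsilon>, of x y] k_le[OF \<epsilon>, of x y] by linarith
      then show "norm (k \<epsilon> x y * (f y * \<rho> y)) \<le> norm (\<eta> 0 / \<epsilon> ^ DIM('a) * (f y * \<rho> y))"
        unfolding real_norm_def abs_mult[of "k \<epsilon> x y"] abs_mult[of "\<eta> 0 / \<epsilon> ^ DIM('a)"]
        by (rule mult_right_mono) simp
    qed
  qed (use * in auto)
qed

lemma integrable_k: "\<epsilon> > 0 \<Longrightarrow> integrable M (\<lambda>y. k \<epsilon> x y * \<rho> y)"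
  using integrable_k_mult(1)[of \<epsilon> "\<lambda>_. 1"] by simp

lemma mass_lower_bound:
  assumes "\<epsilon>\<^sub>0 > 0"
  shows "\<exists>m>0. \<forall>\<epsilon>\<in>{0<..\<epsilon>\<^sub>0}. \<forall>x\<in>\<Omega>. m \<le> mass \<epsilon> x"
proof (intro exI conjI ballI)
  \<comment> \<open>The density bound holds only up to radius \<open>s\<^sub>0\<close>. Shrinking
    the radius from \<epsilon> to t \<epsilon> stays in that range for all admissible \<epsilon>, at
    the price of the constant factor t^d.\<close>
  define t where "t = min 1 (s\<^sub>0 / \<epsilon>\<^sub>0)"
  have t: "0 < t" "t \<le> 1" using s\<^sub>0 assms by (auto simp: t_def)
  show "\<rho>\<^sub>0 * \<kappa> * t ^ DIM('a) > 0" using \<rho>\<^sub>0 \<kappa>_pos t by simp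
  fix \<epsilon> x assume \<epsilon>: "\<epsilon> \<in> {0<..\<epsilon>\<^sub>0}" and x: "x \<in> \<Omega>"
  have "t * \<epsilon> \<le> s\<^sub>0 / \<epsilon>\<^sub>0 * \<epsilon>\<^sub>0" using \<epsilon> t s\<^sub>0 by (intro mult_mono) (auto simp: t_def)
  then have ts: "0 < t * \<epsilon>" "t * \<epsilon> \<le> s\<^sub>0" "t * \<epsilon> \<le> \<epsilon>" using \<epsilon> t assms by auto
  have bm[measurable]: "\<Omega> \<inter> ball x \<epsilon> \<in> sets M"
    by (subst sets_restrict_space_iff) (auto intro: sets.Int)
  have "\<rho>\<^sub>0 * \<kappa> * t ^ DIM('a) = \<rho>\<^sub>0 / \<epsilon> ^ DIM('a) * (\<kappa> * (t * \<epsilon>) ^ DIM('a))"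
    using \<epsilon> by (simp add: power_mult_distrib)
  also have "\<dots> \<le> \<rho>\<^sub>0 / \<epsilon> ^ DIM('a) * measure M (\<Omega> \<inter> ball x (t * \<epsilon>))"
    using measure_density[OF x ts(1,2)] \<rho>\<^sub>0 \<epsilon> by (intro mult_left_mono) auto
  also have "\<dots> \<le> \<rho>\<^sub>0 / \<epsilon> ^ DIM('a) * measure M (\<Omega> \<inter> ball x \<epsilon>)"
    using ts \<rho>\<^sub>0 \<epsilon> by (intro mult_left_mono M.finite_measure_mono Int_mono subset_ball) auto
  also have "\<dots> = (LINT y|M. \<rho>\<^sub>0 / \<epsilon> ^ DIM('a) * indicator (\<Omega> \<inter> ball x \<epsilon>) y)"
    by (simp add: Int_ac)
  also have "\<dots> \<le> mass \<epsilon> x"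
    unfolding mass_def
  proof (rule integral_mono)
    show "integrable M (\<lambda>y. \<rho>\<^sub>0 / \<epsilon> ^ DIM('a) * indicator (\<Omega> \<inter> ball x \<epsilon>) y)"
      by (intro integrable_mult_right integrable_real_indicator) (auto simp: less_top[symmetric])
    show "integrable M (\<lambda>y. k \<epsilon> x y * \<rho> y)" using \<epsilon> by (intro integrable_k) auto
    fix y assume "y \<in> space M"
    then have y: "y \<in> \<Omega>" by simp
    show "\<rho>\<^sub>0 / \<epsilon> ^ DIM('a) * indicator (\<Omega> \<inter> ball x \<epsilon>) y \<le> k \<epsilon> x y * \<rho> y"
    proof (cases "y \<in> ball x \<epsilon>")
      case True
      have "1 / \<epsilon> ^ DIM('a) * \<rho>\<^sub>0 \<le> k \<epsilon> x y * \<rho> y"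
        using k_ge[OF _ True] \<epsilon> \<rho>_bounds[OF y] \<rho>\<^sub>0 k_nonneg[of \<epsilon>] by (intro mult_mono) auto
      then show ?thesis using True y by simp
    qed (use k_nonneg[of \<epsilon>] \<epsilon> \<rho>_bounds[OF y] \<rho>\<^sub>0 in auto)
  qed
  finally show "\<rho>\<^sub>0 * \<kappa> * t ^ DIM('a) \<le> mass \<epsilon> x" .
qed

lemma nn_integral_k_le:
  assumes \<epsilon>: "\<epsilon> > 0"
  shows "(\<integral>\<^sup>+y. ennreal (k \<epsilon> x y) \<partial>M) \<le> ennreal (\<eta> 0 * unit_ball_vol (real DIM('a)) * 2 ^ DIM('a))"
proof -
  have "(\<integral>\<^sup>+y. ennreal (k \<epsilon> x y) \<partial>M) = (\<integral>\<^sup>+y. ennreal (k \<epsilon> x y) * indicator \<Omega> y \<partial>lborel)"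
    by (rule nn_integral_lebesgue_on_eq) simp
  also have "\<dots> \<le> (\<integral>\<^sup>+y. ennreal (\<eta> 0 / \<epsilon> ^ DIM('a)) * indicator (ball x (2 * \<epsilon>)) y \<partial>lborel)"
  proof (rule nn_integral_mono)
    fix y
    show "ennreal (k \<epsilon> x y) * indicator \<Omega> y \<le> ennreal (\<eta> 0 / \<epsilon> ^ DIM('a)) * indicator (ball x (2 * \<epsilon>)) y"
    proof (cases "y \<in> ball x (2 * \<epsilon>)")
      case True
      then show ?thesis using k_le[OF \<epsilon>, of x y] by (auto intro!: ennreal_leI split: split_indicator)
    qed (simp add: k_eq0[OF \<epsilon>])
  qed
  also have "\<dots> = ennreal (\<eta> 0 / \<epsilon> ^ DIM('a)) * ennreal (unit_ball_vol (real DIM('a)) * (2 * \<epsilon>) ^ DIM('a))"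
    using \<epsilon> by (subst nn_integral_cmult_indicator) (auto simp: emeasure_ball)
  also have "\<dots> = ennreal (\<eta> 0 / \<epsilon> ^ DIM('a) * (unit_ball_vol (real DIM('a)) * (2 * \<epsilon>) ^ DIM('a)))"
    using \<eta>0 \<epsilon> by (intro ennreal_mult'[symmetric]) auto
  also have "\<eta> 0 / \<epsilon> ^ DIM('a) * (unit_ball_vol (real DIM('a)) * (2 * \<epsilon>) ^ DIM('a)) = \<eta> 0 * unit_ball_vol (real DIM('a)) * 2 ^ DIM('a)"
    using \<epsilon> by (simp add: power_mult_distrib)
  finally show ?thesis .
qed

end

section \<open>The equation and its energy estimate\<close>

lemma (in pair_sigma_finite) integrable_pair_mult:
  fixes a b :: "_ \<Rightarrow> real"
  assumes a: "integrable M1 a" and b: "integrable M2 b"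
  shows "integrable (M1 \<Otimes>\<^sub>M M2) (\<lambda>(x, y). a x * b y)"
proof (rule Fubini_integrable)
  have [measurable]: "a \<in> borel_measurable M1" "b \<in> borel_measurable M2" using a b by auto
  show "(\<lambda>(x, y). a x * b y) \<in> borel_measurable (M1 \<Otimes>\<^sub>M M2)" by measurable
  show "integrable M1 (\<lambda>x. \<integral>y. norm (case (x, y) of (x, y) \<Rightarrow> a x * b y) \<partial>M2)"
    using a by (simp add: abs_mult)
  show "AE x in M1. integrable M2 (\<lambda>y. case (x, y) of (x, y) \<Rightarrow> a x * b y)"
    using b by simp
qed

context nonlocal_domain
begin

text \<open>Integrability of \<open>u\<close> allows the integral to be split, which turns the
  equation into a formula for \<open>u\<close> itself: mass times u equals an average of
  \<open>u\<close> plus \<epsilon>^2 h.\<close>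

lemma laplacian_eq:
  assumes \<epsilon>: "\<epsilon> > 0" and u: "integrable M u"
  shows "\<epsilon>\<^sup>2 * nonlocal_laplacian \<Omega> \<eta> \<rho> \<epsilon> u x = (LINT y|M. k \<epsilon> x y * (u y * \<rho> y)) - mass \<epsilon> x * u x"
proof -
  have "\<epsilon>\<^sup>2 * nonlocal_laplacian \<Omega> \<eta> \<rho> \<epsilon> u x = (LINT y|M. k \<epsilon> x y * (u y - u x) * \<rho> y)"
    using \<epsilon> by (simp add: nonlocal_laplacian_def k_def)
  also have "\<dots> = (LINT y|M. k \<epsilon> x y * (u y * \<rho> y) - u x * (k \<epsilon> x y * \<rho> y))"
    by (simp add: algebra_simps)
  also have "\<dots> = (LINT y|M. k \<epsilon> x y * (u y * \<rho> y)) - u x * mass \<epsilon> x"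
    unfolding mass_def
    by (subst Bochner_Integration.integral_diff) (use integrable_k_mult(1)[OF \<epsilon> u] integrable_k[OF \<epsilon>] in simp_all)
  finally show ?thesis by (simp add: mult.commute)
qed

lemma poisson_AE:
  assumes \<epsilon>: "\<epsilon> > 0" and u: "integrable M u" and sol: "solves_nonlocal_poisson \<Omega> \<eta> \<rho> \<epsilon> h u"
  shows "AE x in M. mass \<epsilon> x * u x - (LINT y|M. k \<epsilon> x y * (u y * \<rho> y)) = \<epsilon>\<^sup>2 * h x"
  using sol unfolding solves_nonlocal_poisson_def
proof eventually_elim
  case (elim x)
  then show ?case using laplacian_eq[OF \<epsilon> u, of x] by (simp flip: elim)
qed

lemma average_le:
  assumes \<epsilon>: "\<epsilon> > 0" and v: "integrable M v" and nn: "\<And>y. 0 \<le> v y"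
  shows "(LINT y|M. k \<epsilon> x y * (v y * \<rho> y)) \<le> \<eta> 0 / \<epsilon> ^ DIM('a) * \<rho>\<^sub>1 * (LINT y|M. v y)"
proof -
  have "(LINT y|M. k \<epsilon> x y * (v y * \<rho> y)) \<le> (LINT y|M. \<eta> 0 / \<epsilon> ^ DIM('a) * (\<rho>\<^sub>1 * v y))"
  proof (rule integral_mono)
    fix y assume "y \<in> space M"
    then have "\<rho> y * v y \<le> \<rho>\<^sub>1 * v y" "0 \<le> \<rho> y * v y"
      using \<rho>_bounds[of y] \<rho>\<^sub>0 nn[of y] by (auto intro: mult_right_mono)
    then have "v y * \<rho> y \<le> \<rho>\<^sub>1 * v y" "0 \<le> v y * \<rho> y" by (simp_all add: mult.commute)
    then show "k \<epsilon> x y * (v y * \<rho> y) \<le> \<eta> 0 / \<epsilon> ^ DIM('a) * (\<rho>\<^sub>1 * v y)"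
      using \<eta>0 \<epsilon> by (intro mult_mono[OF k_le[OF \<epsilon>]]) auto
  qed (use integrable_k_mult(1)[OF \<epsilon> v] v in auto)
  then show ?thesis by simp
qed

text \<open>The average of \<open>u\<close> is at most a multiple of its L^1 norm, because the
  kernel is bounded for fixed \<epsilon>. The factor \<epsilon>^(-d) makes this useless for small
  \<epsilon>, yet it proves integrability and treats \<epsilon> bounded below.\<close>

lemma pointwise_bound:
  assumes \<epsilon>: "\<epsilon> > 0" and u: "integrable M u" and sol: "solves_nonlocal_poisson \<Omega> \<eta> \<rho> \<epsilon> h u"
    and m: "\<And>x. x \<in> \<Omega> \<Longrightarrow> m \<le> mass \<epsilon> x"
  shows "AE x in M. m * \<bar>u x\<bar> \<le> \<eta> 0 / \<epsilon> ^ DIM('a) * \<rho>\<^sub>1 * (LINT y|M. \<bar>u y\<bar>) + \<epsilon>\<^sup>2 * \<bar>h x\<bar>"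
  using poisson_AE[OF \<epsilon> u sol] AE_space
proof eventually_elim
  case (elim x)
  have mx: "0 \<le> mass \<epsilon> x"
    unfolding mass_def using k_nonneg[OF \<epsilon>] \<rho>_bounds \<rho>\<^sub>0 by (intro integral_nonneg_AE AE_I2) force
  have "\<bar>LINT y|M. k \<epsilon> x y * (u y * \<rho> y)\<bar> \<le> (LINT y|M. \<bar>k \<epsilon> x y * (u y * \<rho> y)\<bar>)"
    by (rule integral_abs_bound)
  also have "\<dots> = (LINT y|M. k \<epsilon> x y * (\<bar>u y\<bar> * \<rho> y))"
    using k_nonneg[OF \<epsilon>] \<rho>_bounds \<rho>\<^sub>0 by (intro Bochner_Integration.integral_cong) (force simp: abs_mult)+
  also have "\<dots> \<le> \<eta> 0 / \<epsilon> ^ DIM('a) * \<rho>\<^sub>1 * (LINT y|M. \<bar>u y\<bar>)"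
    using u by (intro average_le \<epsilon>) auto
  finally have 1: "\<bar>LINT y|M. k \<epsilon> x y * (u y * \<rho> y)\<bar> \<le> \<eta> 0 / \<epsilon> ^ DIM('a) * \<rho>\<^sub>1 * (LINT y|M. \<bar>u y\<bar>)" .
  have "m * \<bar>u x\<bar> \<le> \<bar>mass \<epsilon> x * u x\<bar>"
    using m[of x] elim(2) mx by (simp add: abs_mult mult_right_mono)
  also have "mass \<epsilon> x * u x = (LINT y|M. k \<epsilon> x y * (u y * \<rho> y)) + \<epsilon>\<^sup>2 * h x" using elim(1) by simp
  also have "\<bar>\<dots>\<bar> \<le> \<bar>LINT y|M. k \<epsilon> x y * (u y * \<rho> y)\<bar> + \<epsilon>\<^sup>2 * \<bar>h x\<bar>"
    using abs_triangle_ineq[of "LINT y|M. k \<epsilon> x y * (u y * \<rho> y)" "\<epsilon>\<^sup>2 * h x"] by (simp add: abs_mult)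
  finally show ?case using 1 by linarith
qed

text \<open>Multiplying the equation by \<rho> as well as by \<open>\<phi> (u x)\<close> makes the
  total weight symmetric in \<open>x\<close> and \<open>y\<close>. Adding the exchanged integrand
  produces the product of increments, nonnegative by monotonicity. Integrability of
  \<open>\<phi> (u x)\<close> and \<open>u x * \<phi> (u x)\<close> makes the double integral
  absolutely convergent, as Fubini and the exchange demand.\<close>

lemma energy_estimate:
  assumes \<epsilon>: "\<epsilon> > 0" and u: "integrable M u" and sol: "solves_nonlocal_poisson \<Omega> \<eta> \<rho> \<epsilon> h u"
    and h[measurable]: "h \<in> borel_measurable M" and \<phi>: "mono \<phi>" and g: "integrable M (\<lambda>x. \<phi> (u x))" and ug: "integrable M (\<lambda>x. u x * \<phi> (u x))"
    and hg: "integrable M (\<lambda>x. \<bar>h x\<bar> * \<bar>\<phi> (u x)\<bar>)"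
  shows "(\<integral>\<^sup>+x. (\<integral>\<^sup>+y. ennreal (k \<epsilon> x y * ((u x - u y) * (\<phi> (u x) - \<phi> (u y)))) \<partial>M) \<partial>M)
     \<le> ennreal (2 * \<rho>\<^sub>1 / \<rho>\<^sub>0\<^sup>2 * \<epsilon>\<^sup>2 * (LINT x|M. \<bar>h x\<bar> * \<bar>\<phi> (u x)\<bar>))"
proof -
  define g where "g x = \<phi> (u x)" for x
  have gi: "integrable M g" and ugi: "integrable M (\<lambda>x. u x * g x)" and hgi: "integrable M (\<lambda>x. \<bar>h x\<bar> * \<bar>g x\<bar>)"
    using g ug hg unfolding g_def by auto
  have [measurable]: "u \<in> borel_measurable M" "g \<in> borel_measurable M" using u gi by auto
  note [measurable] = k_measurable[OF \<epsilon>]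
  have sp: "space (M \<Otimes>\<^sub>M M) = \<Omega> \<times> \<Omega>" by (simp add: space_pair_measure)
  \<comment> \<open>The unsymmetrised integrand. Its integral in \<open>y\<close> is the left side
    of the equation times \<open>g x * \<rho> x\<close>.\<close>
  define F where "F = (\<lambda>(x, y). k \<epsilon> x y * (u x - u y) * g x * \<rho> x * \<rho> y)"
  have Fm[measurable]: "F \<in> borel_measurable (M \<Otimes>\<^sub>M M)" unfolding F_def by measurable
  define B where "B = \<eta> 0 / \<epsilon> ^ DIM('a) * \<rho>\<^sub>1 * \<rho>\<^sub>1"
  have B: "B \<ge> 0" using \<eta>0 \<epsilon> \<rho>\<^sub>1 by (simp add: B_def)
  have abs\<rho>: "\<bar>\<rho> x\<bar> \<le> \<rho>\<^sub>1" if "x \<in> \<Omega>" for x using \<rho>_bounds[OF that] \<rho>\<^sub>0 by simp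
  have Fi: "integrable (M \<Otimes>\<^sub>M M) F"
  proof (rule Bochner_Integration.integrable_bound)
    have "integrable (M \<Otimes>\<^sub>M M) (\<lambda>(x, y). \<bar>u x * g x\<bar> * 1)"
      by (rule MM.integrable_pair_mult) (use ugi in auto)
    moreover have "integrable (M \<Otimes>\<^sub>M M) (\<lambda>(x, y). \<bar>g x\<bar> * \<bar>u y\<bar>)"
      by (rule MM.integrable_pair_mult) (use gi u in auto)
    ultimately show "integrable (M \<Otimes>\<^sub>M M) (\<lambda>z. B * ((\<lambda>(x, y). \<bar>u x * g x\<bar> * 1) z + (\<lambda>(x, y). \<bar>g x\<bar> * \<bar>u y\<bar>) z))"
      by (intro integrable_mult_right Bochner_Integration.integrable_add)
    show "AE z in M \<Otimes>\<^sub>M M. norm (F z) \<le> norm (B * ((\<lambda>(x, y). \<bar>u x * g x\<bar> * 1) z + (\<lambda>(x, y). \<bar>g x\<bar> * \<bar>u y\<bar>) z))"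
    proof (rule AE_I2)
      fix z assume "z \<in> space (M \<Otimes>\<^sub>M M)"
      then obtain x y where z: "z = (x, y)" "x \<in> \<Omega>" "y \<in> \<Omega>" by (auto simp: sp)
      have "norm (F z) = (k \<epsilon> x y * \<bar>\<rho> x\<bar> * \<bar>\<rho> y\<bar>) * (\<bar>u x - u y\<bar> * \<bar>g x\<bar>)"
        using k_nonneg[OF \<epsilon>, of x y] by (simp add: z F_def abs_mult ac_simps)
      also have "\<dots> \<le> B * ((\<bar>u x\<bar> + \<bar>u y\<bar>) * \<bar>g x\<bar>)"
        unfolding B_def using k_nonneg[OF \<epsilon>, of x y] k_le[OF \<epsilon>, of x y] abs\<rho>[OF z(2)] abs\<rho>[OF z(3)] \<rho>\<^sub>1 \<eta>0 \<epsilon>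
        by (intro mult_mono) (auto intro!: mult_nonneg_nonneg)
      also have "\<dots> = norm (B * ((\<lambda>(x, y). \<bar>u x * g x\<bar> * 1) z + (\<lambda>(x, y). \<bar>g x\<bar> * \<bar>u y\<bar>) z))"
        using B by (simp add: z abs_mult algebra_simps)
      finally show "norm (F z) \<le> norm (B * ((\<lambda>(x, y). \<bar>u x * g x\<bar> * 1) z + (\<lambda>(x, y). \<bar>g x\<bar> * \<bar>u y\<bar>) z))" .
    qed
  qed measurable
  have F'i: "integrable (M \<Otimes>\<^sub>M M) (\<lambda>(x, y). F (y, x))" by (rule MM.integrable_product_swap[OF Fi])
  have "integral\<^sup>L (M \<Otimes>\<^sub>M M) F = (LINT x|M. (LINT y|M. F (x, y)))"
    using MM.integral_fst'[OF Fi] by simp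
  also have "\<dots> = (LINT x|M. \<epsilon>\<^sup>2 * (h x * g x * \<rho> x))"
  proof (rule integral_cong_AE)
    have eq: "(LINT y|M. F (x, y)) = g x * \<rho> x * (mass \<epsilon> x * u x - (LINT y|M. k \<epsilon> x y * (u y * \<rho> y)))" for x
    proof -
      have "(LINT y|M. F (x, y)) = (LINT y|M. g x * \<rho> x * (u x * (k \<epsilon> x y * \<rho> y) - k \<epsilon> x y * (u y * \<rho> y)))"
        by (simp add: F_def algebra_simps)
      also have "\<dots> = g x * \<rho> x * (u x * mass \<epsilon> x - (LINT y|M. k \<epsilon> x y * (u y * \<rho> y)))"
        unfolding mass_def
        by (subst integral_mult_right_zero, subst Bochner_Integration.integral_diff)
          (use integrable_k_mult(1)[OF \<epsilon> u] integrable_k[OF \<epsilon>] in simp_all)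
      finally show ?thesis by (simp add: mult.commute)
    qed
    show ae: "AE x in M. (LINT y|M. F (x, y)) = \<epsilon>\<^sup>2 * (h x * g x * \<rho> x)"
      using poisson_AE[OF \<epsilon> u sol] unfolding eq by eventually_elim simp
    show meas: "(\<lambda>x. LINT y|M. F (x, y)) \<in> borel_measurable M"
      using Fi by (intro borel_measurable_integrable MM.integrable_fst')
    show "(\<lambda>x. \<epsilon>\<^sup>2 * (h x * g x * \<rho> x)) \<in> borel_measurable M"
      by measurable
  qed
  also have "\<dots> \<le> (LINT x|M. \<epsilon>\<^sup>2 * (\<rho>\<^sub>1 * (\<bar>h x\<bar> * \<bar>g x\<bar>)))"
  proof (rule integral_mono)
    have "integrable M (\<lambda>x. h x * g x)"
      using hgi by (subst integrable_abs_iff[symmetric]) (simp_all add: abs_mult)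
    then show "integrable M (\<lambda>x. \<epsilon>\<^sup>2 * (h x * g x * \<rho> x))"
      by (intro integrable_mult_right integrable_k_mult(2)[OF \<epsilon>])
    show "integrable M (\<lambda>x. \<epsilon>\<^sup>2 * (\<rho>\<^sub>1 * (\<bar>h x\<bar> * \<bar>g x\<bar>)))"
      by (intro integrable_mult_right hgi)
    fix x assume "x \<in> space M"
    then have "h x * g x * \<rho> x \<le> \<bar>h x * g x\<bar> * \<rho>\<^sub>1"
      using \<rho>_bounds[of x] \<rho>\<^sub>0 by (intro mult_mono) auto
    then show "\<epsilon>\<^sup>2 * (h x * g x * \<rho> x) \<le> \<epsilon>\<^sup>2 * (\<rho>\<^sub>1 * (\<bar>h x\<bar> * \<bar>g x\<bar>))"
      by (intro mult_left_mono) (simp_all add: abs_mult mult.commute)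
  qed
  finally have IF: "integral\<^sup>L (M \<Otimes>\<^sub>M M) F \<le> \<epsilon>\<^sup>2 * \<rho>\<^sub>1 * (LINT x|M. \<bar>h x\<bar> * \<bar>g x\<bar>)" by simp
  \<comment> \<open>The exchange costs the factor 2 in the final constant, and removing the weight
    \<rho> from \<open>S\<close> costs the inverse square of \<open>\<rho>\<^sub>0\<close>.\<close>
  define S where "S z = F z + (\<lambda>(x, y). F (y, x)) z" for z
  have S: "S (x, y) = (k \<epsilon> x y * ((u x - u y) * (g x - g y))) * (\<rho> x * \<rho> y)" for x y
    by (simp add: S_def F_def k_sym[of \<epsilon> y x] algebra_simps)
  have mon: "0 \<le> (u x - u y) * (g x - g y)" for x y
    using monoD[OF \<phi>, of "u x" "u y"] monoD[OF \<phi>, of "u y" "u x"] unfolding g_def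
    by (cases "u x \<le> u y") (auto intro: mult_nonneg_nonneg mult_nonpos_nonpos)
  have Si: "integrable (M \<Otimes>\<^sub>M M) S" unfolding S_def using Fi F'i by (rule Bochner_Integration.integrable_add)
  have Sm[measurable]: "S \<in> borel_measurable (M \<Otimes>\<^sub>M M)" using Si by simp
  have "integral\<^sup>L (M \<Otimes>\<^sub>M M) S = 2 * integral\<^sup>L (M \<Otimes>\<^sub>M M) F"
    unfolding S_def using Fi F'i MM.integral_product_swap[OF Fm] by (subst Bochner_Integration.integral_add) auto
  then have IS: "integral\<^sup>L (M \<Otimes>\<^sub>M M) S \<le> 2 * (\<epsilon>\<^sup>2 * \<rho>\<^sub>1 * (LINT x|M. \<bar>h x\<bar> * \<bar>g x\<bar>))" using IF by simp
  have S_ge: "k \<epsilon> x y * ((u x - u y) * (g x - g y)) \<le> 1 / \<rho>\<^sub>0\<^sup>2 * S (x, y)" "0 \<le> S (x, y)" if "x \<in> \<Omega>" "y \<in> \<Omega>" for x y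
  proof -
    have "\<rho>\<^sub>0 * \<rho>\<^sub>0 \<le> \<rho> x * \<rho> y" using \<rho>_bounds that \<rho>\<^sub>0 by (intro mult_mono) (auto intro: order_trans less_imp_le)
    moreover have kk: "0 \<le> k \<epsilon> x y * ((u x - u y) * (g x - g y))" using k_nonneg[OF \<epsilon>] mon by simp
    ultimately have "(k \<epsilon> x y * ((u x - u y) * (g x - g y))) * (\<rho>\<^sub>0 * \<rho>\<^sub>0) \<le> S (x, y)"
      unfolding S by (intro mult_left_mono)
    then show "k \<epsilon> x y * ((u x - u y) * (g x - g y)) \<le> 1 / \<rho>\<^sub>0\<^sup>2 * S (x, y)"
      using \<rho>\<^sub>0 by (simp add: field_simps power2_eq_square)
    show "0 \<le> S (x, y)" unfolding S using kk \<open>\<rho>\<^sub>0 * \<rho>\<^sub>0 \<le> \<rho> x * \<rho> y\<close> \<rho>\<^sub>0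
      by (intro mult_nonneg_nonneg[OF kk]) (auto intro: order_trans[rotated])
  qed
  have "(\<integral>\<^sup>+x. (\<integral>\<^sup>+y. ennreal (k \<epsilon> x y * ((u x - u y) * (\<phi> (u x) - \<phi> (u y)))) \<partial>M) \<partial>M)
      \<le> (\<integral>\<^sup>+x. (\<integral>\<^sup>+y. ennreal (1 / \<rho>\<^sub>0\<^sup>2 * S (x, y)) \<partial>M) \<partial>M)"
    using S_ge(1) unfolding g_def by (intro nn_integral_mono ennreal_leI) simp
  also have "\<dots> = (\<integral>\<^sup>+z. ennreal (1 / \<rho>\<^sub>0\<^sup>2 * S z) \<partial>(M \<Otimes>\<^sub>M M))"
    by (rule M.nn_integral_fst) measurable
  also have "\<dots> = ennreal (LINT z|(M \<Otimes>\<^sub>M M). 1 / \<rho>\<^sub>0\<^sup>2 * S z)"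
    using S_ge(2) by (intro nn_integral_eq_integral integrable_mult_right Si AE_I2) (auto simp: sp)
  also have "(LINT z|(M \<Otimes>\<^sub>M M). 1 / \<rho>\<^sub>0\<^sup>2 * S z) = 1 / \<rho>\<^sub>0\<^sup>2 * integral\<^sup>L (M \<Otimes>\<^sub>M M) S" by simp
  also have "ennreal \<dots> \<le> ennreal (1 / \<rho>\<^sub>0\<^sup>2 * (2 * (\<epsilon>\<^sup>2 * \<rho>\<^sub>1 * (LINT x|M. \<bar>h x\<bar> * \<bar>g x\<bar>))))"
    by (intro ennreal_leI mult_left_mono IS) simp
  finally show ?thesis by (simp add: g_def mult_ac)
qed

end

section \<open>Signed powers\<close>

text \<open>Concavity of the power: the graph lies below its tangent at \<open>a\<close>. It is the
  weighted arithmetic-geometric mean inequality for b / a and 1.\<close>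

lemma powr_tangent_le:
  fixes a b s :: real
  assumes "0 < s" "s \<le> 1" "0 < a" "0 \<le> b"
  shows "b powr s \<le> a powr s + s * a powr (s - 1) * (b - a)"
proof (cases "b = 0")
  case True
  have "s * (a powr (s - 1) * a) \<le> 1 * (a powr (s - 1) * a)" using assms by (intro mult_right_mono) auto
  moreover have "a powr (s - 1) * a = a powr s" using assms by (simp add: powr_diff)
  ultimately show ?thesis using True by (simp add: mult.assoc)
next
  case False
  have "(b / a) powr s * 1 powr (1 - s) \<le> s * (b / a) + (1 - s) * 1"
    using assms False by (intro Youngs_inequality_0) auto
  then have "a powr s * (b / a) powr s \<le> a powr s * (s * (b / a) + (1 - s))"
    by (intro mult_left_mono) auto
  moreover have "a powr s * (b / a) powr s = b powr s" using assms by (simp add: powr_divide)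
  moreover have "a powr s * (s * (b / a) + (1 - s)) = a powr s + s * a powr (s - 1) * (b - a)"
    using assms by (simp add: powr_diff field_simps)
  ultimately show ?thesis by simp
qed

text \<open>The concave case with exponent 1/s, applied to the s-th powers of \<open>a\<close> and
  \<open>b\<close> and solved for \<open>b powr s\<close>.\<close>

lemma powr_tangent_ge:
  fixes a b s :: real
  assumes "1 \<le> s" "0 < a" "0 \<le> b"
  shows "a powr s + s * a powr (s - 1) * (b - a) \<le> b powr s"
proof -
  have "(b powr s) powr (1/s) \<le> (a powr s) powr (1/s) + 1/s * (a powr s) powr (1/s - 1) * (b powr s - a powr s)"
    using assms by (intro powr_tangent_le) auto
  then have "b \<le> a + 1/s * a powr (1 - s) * (b powr s - a powr s)"
    using assms by (simp add: powr_powr algebra_simps)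
  then have "s * a powr (s - 1) * b \<le> s * a powr (s - 1) * (a + 1/s * a powr (1 - s) * (b powr s - a powr s))"
    using assms by (intro mult_left_mono) auto
  also have "\<dots> = s * a powr (s - 1) * a + (s * (1/s)) * (a powr (s - 1) * a powr (1 - s)) * (b powr s - a powr s)"
    by (simp only: distrib_left mult_ac)
  also have "a powr (s - 1) * a powr (1 - s) = 1" using assms by (simp flip: powr_add)
  finally show ?thesis using assms by (simp add: algebra_simps)
qed

lemma powr_add_subadditive:
  fixes a b s :: real
  assumes "0 < s" "s \<le> 1" "0 \<le> a" "0 \<le> b"
  shows "(a + b) powr s \<le> a powr s + b powr s"
proof (cases "a + b = 0")
  case False
  define S where "S = a + b"
  have S: "S > 0" using False assms by (simp add: S_def)
  have *: "S powr s * (x / S) \<le> x powr s" if "0 \<le> x" "x \<le> S" for x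
  proof -
    have "(x / S) powr 1 \<le> (x / S) powr s" using assms that S by (intro powr_mono') auto
    then have "S powr s * (x / S) \<le> S powr s * (x / S) powr s" using that S by (intro mult_left_mono) auto
    then show ?thesis using that S by (simp add: powr_divide)
  qed
  have "a / S + b / S = 1" using S by (simp add: S_def flip: add_divide_distrib)
  then have "S powr s = S powr s * (a / S) + S powr s * (b / S)"
    by (simp only: distrib_left[symmetric] mult_1_right)
  also have "\<dots> \<le> a powr s + b powr s" using assms by (intro add_mono *) (auto simp: S_def)
  finally show ?thesis by (simp add: S_def)
qed (use assms in auto)

text \<open>Away from zero this is |t|^(s-1) t, the odd extension of the power; odd and monotone, so
  admissible as a test function.\<close>

definition spow :: "real \<Rightarrow> real \<Rightarrow> real" where
  "spow s t = sgn t * \<bar>t\<bar> powr s"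

lemma spow_nonneg: "0 \<le> t \<Longrightarrow> spow s t = t powr s"
  by (auto simp: spow_def sgn_if)

lemma spow_minus: "spow s (- t) = - spow s t"
  by (simp add: spow_def sgn_minus)

lemma abs_spow: "\<bar>spow s t\<bar> = \<bar>t\<bar> powr s"
  by (auto simp: spow_def abs_mult sgn_if)

lemma spow_measurable[measurable]: "spow s \<in> borel_measurable borel"
  unfolding spow_def by measurable

lemma spow_mono:
  assumes "0 \<le> s"
  shows "mono (spow s)"
proof (rule monoI)
  fix a b :: real assume ab: "a \<le> b"
  consider "0 \<le> a" | "a \<le> 0" "0 \<le> b" | "b \<le> 0" by linarith
  then show "spow s a \<le> spow s b"
  proof cases
    case 1
    then show ?thesis using ab assms by (simp add: spow_nonneg powr_mono2)
  next
    case 2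
    then have "spow s a = - ((- a) powr s)" using spow_nonneg[of "- a" s] by (simp add: spow_minus)
    moreover have "0 \<le> spow s b" using 2 by (simp add: spow_nonneg)
    ultimately show ?thesis by (smt (verit) powr_ge_zero)
  next
    case 3
    then have "spow s (- b) \<le> spow s (- a)" using ab assms by (simp add: spow_nonneg powr_mono2)
    then show ?thesis by (simp add: spow_minus)
  qed
qed

text \<open>Inequalities in two reals that are invariant under exchange and under a common change of
  sign only have to be checked for ordered nonnegative numbers and for opposite signs.\<close>

lemma sign_cases [case_names same opposite swap minus]:
  fixes a b :: real
  assumes "\<And>a b. 0 \<le> b \<Longrightarrow> b \<le> a \<Longrightarrow> P a b" "\<And>a b. 0 \<le> a \<Longrightarrow> 0 \<le> b \<Longrightarrow> P a (- b)"
    and "\<And>a b. P a b \<Longrightarrow> P b a" "\<And>a b. P a b \<Longrightarrow> P (- a) (- b)"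
  shows "P a b"
proof -
  have *: "P a b" if "b \<le> a" for a b
  proof -
    consider "0 \<le> b" | "a \<le> 0" | "0 \<le> a" "0 \<le> - b" using that by linarith
    then show ?thesis
    proof cases
      case 2
      then have "P (- b) (- a)" using that by (intro assms(1)) auto
      then have "P b a" using assms(4)[of "- b" "- a"] by simp
      then show ?thesis by (rule assms(3))
    next
      case 3
      then show ?thesis using assms(2)[of a "- b"] by simp
    qed (rule assms(1)[OF _ that])
  qed
  show ?thesis
  proof (cases "b \<le> a")
    case False
    then have "P b a" by (intro *) simp
    then show ?thesis by (rule assms(3))
  qed (rule *)
qed

text \<open>An inequality of Stroock-Varopoulos type. For equal signs the tangent at the larger
  number \<open>a\<close> bounds one factor of the square by (q/2) a^(q/2-1) (a - b), and a^(q/2-1)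
  is then moved into the other factor, where it yields the increment of the power q - 1.\<close>

lemma spow_half_diff_le:
  fixes a b q :: real
  assumes q: "2 \<le> q"
  shows "(spow (q/2) a - spow (q/2) b)\<^sup>2 \<le> q * ((a - b) * (spow (q - 1) a - spow (q - 1) b))"
proof (induction a b rule: sign_cases)
  case (same a b)
  show ?case
  proof (cases "a = 0")
    case False
    then have a: "a > 0" using same by simp
    let ?A = "a powr (q/2)" and ?B = "b powr (q/2)"
    have AB: "?B \<le> ?A" using same q by (intro powr_mono2) auto
    have "?A + (q/2) * a powr (q/2 - 1) * (b - a) \<le> ?B"
      using q a same by (intro powr_tangent_ge) auto
    moreover have "(q/2) * a powr (q/2 - 1) * (b - a) = - ((q/2) * a powr (q/2 - 1) * (a - b))"
      by (simp only: mult_minus_right[symmetric] minus_diff_eq)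
    ultimately have 1: "?A - ?B \<le> (q/2) * a powr (q/2 - 1) * (a - b)" by linarith
    have "b powr (q/2 - 1) * b powr (q/2) \<le> a powr (q/2 - 1) * b powr (q/2)"
      using q a same by (intro mult_right_mono powr_mono2) auto
    moreover have "b powr (q/2 - 1) * b powr (q/2) = b powr (q - 1)" "a powr (q/2 - 1) * a powr (q/2) = a powr (q - 1)"
      by (simp_all flip: powr_add)
    ultimately have 2: "a powr (q/2 - 1) * (?A - ?B) \<le> a powr (q - 1) - b powr (q - 1)"
      by (simp add: right_diff_distrib)
    have "(?A - ?B)\<^sup>2 \<le> (q/2) * a powr (q/2 - 1) * (a - b) * (?A - ?B)"
      unfolding power2_eq_square using AB by (intro mult_right_mono 1) auto
    also have "\<dots> = (q/2) * (a - b) * (a powr (q/2 - 1) * (?A - ?B))" by (simp add: mult_ac)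
    \<comment> \<open>Equal signs would allow q/2; the constant \<open>q\<close> is what the cruder
      estimate for opposite signs delivers.\<close>
    also have "\<dots> \<le> q * (a - b) * (a powr (q - 1) - b powr (q - 1))"
      using q same AB 2 by (intro mult_mono) auto
    finally show ?thesis using same by (simp add: spow_nonneg mult.assoc)
  qed (use same in simp)
next
  case (opposite a b)
  let ?A = "a powr (q/2)" and ?B = "b powr (q/2)"
  have sq: "x powr (q/2) * x powr (q/2) = x powr q" "x * x powr (q - 1) = x powr q" if "x \<ge> 0" for x :: real
    using that q by (simp_all add: powr_diff flip: powr_add) 
  have "(?A + ?B)\<^sup>2 \<le> 2 * (a powr q + b powr q)"
    using sum_squares_bound[of ?A ?B] sq(1)[of a] sq(1)[of b] opposite by (simp add: power2_eq_square algebra_simps)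
  also have "\<dots> \<le> q * (a powr q + b powr q)" using q by (intro mult_right_mono) auto
  also have "\<dots> \<le> q * ((a + b) * (a powr (q - 1) + b powr (q - 1)))"
    using q opposite sq(2)[of a] sq(2)[of b] by (intro mult_left_mono) (auto simp: algebra_simps)
  finally show ?case using opposite by (simp add: spow_minus spow_nonneg)
next
  case (swap a b)
  then show ?case by (simp add: power2_commute algebra_simps)
next
  case (minus a b)
  then show ?case by (simp add: spow_minus power2_commute algebra_simps)
qed

text \<open>Concavity of t^(q-1) gives the same-sign case, its subadditivity the opposite-sign case.
  The weight to the negative power q - 2 degenerates for large values, which is why the case q < 2
  needs an interpolation. When both numbers vanish, the convention \<open>0 powr x = 0\<close> is
  harmless since the increment is zero too.\<close>

lemma spow_diff_ge:
  fixes a b q :: real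
  assumes q: "1 < q" "q < 2"
  shows "(q - 1) * ((a - b)\<^sup>2 * (\<bar>a\<bar> + \<bar>b\<bar>) powr (q - 2)) \<le> (a - b) * (spow (q - 1) a - spow (q - 1) b)"
proof (induction a b rule: sign_cases)
  case (same a b)
  show ?case
  proof (cases "a = 0")
    case False
    then have a: "a > 0" using same by simp
    have "b powr (q - 1) \<le> a powr (q - 1) + (q - 1) * a powr (q - 1 - 1) * (b - a)"
      using q a same by (intro powr_tangent_le) auto
    then have "(q - 1) * a powr (q - 2) * (a - b) \<le> a powr (q - 1) - b powr (q - 1)"
      by (simp add: algebra_simps)
    moreover have "(q - 1) * (a + b) powr (q - 2) * (a - b) \<le> (q - 1) * a powr (q - 2) * (a - b)"
      using q a same by (intro mult_right_mono mult_left_mono powr_mono2') auto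
    ultimately have "(a - b) * ((q - 1) * (a + b) powr (q - 2) * (a - b)) \<le> (a - b) * (a powr (q - 1) - b powr (q - 1))"
      using same by (intro mult_left_mono) auto
    then show ?thesis using same by (simp add: spow_nonneg power2_eq_square mult_ac)
  qed (use same in simp)
next
  case (opposite a b)
  show ?case
  proof (cases "a + b = 0")
    case False
    then have S: "a + b > 0" using opposite by simp
    have "(q - 1) * ((a + b)\<^sup>2 * (a + b) powr (q - 2)) \<le> 1 * ((a + b)\<^sup>2 * (a + b) powr (q - 2))"
      using q by (intro mult_right_mono) auto
    also have "\<dots> = (a + b) * (a + b) powr (q - 1)"
      using S by (simp add: powr_diff power2_eq_square)
    also have "\<dots> \<le> (a + b) * (a powr (q - 1) + b powr (q - 1))"
      using q opposite by (intro mult_left_mono powr_add_subadditive) auto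
    finally show ?thesis using opposite by (simp add: spow_minus spow_nonneg)
  qed (use opposite in auto)
next
  case (swap a b)
  then show ?case by (simp add: power2_commute algebra_simps)
next
  case (minus a b)
  then show ?case by (simp add: spow_minus power2_commute algebra_simps)
qed

text \<open>Either \<open>h\<close> is at most \<delta> v and the first term suffices, or
  \<open>v\<close> is below h / \<delta> and the second does. The small coefficient falls on the
  power of the solution, which has to be absorbed.\<close>

lemma young_powr:
  fixes h v \<delta> q :: real
  assumes "0 \<le> h" "0 \<le> v" "0 < \<delta>" "1 < q"
  shows "h * v powr (q - 1) \<le> \<delta> * v powr q + \<delta> powr (1 - q) * h powr q"
proof (cases "h \<le> \<delta> * v")
  case True
  have "h * v powr (q - 1) \<le> \<delta> * v * v powr (q - 1)" using True by (intro mult_right_mono) auto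
  also have "\<dots> = \<delta> * v powr q" using assms by (cases "v = 0") (auto simp: powr_diff)
  finally show ?thesis by (simp add: add_increasing2)
next
  case False
  then have hv: "v \<le> h / \<delta>" "h > 0" using assms mult_nonneg_nonneg[of \<delta> v] by (auto simp: field_simps simp del: mult_nonneg_nonneg)
  have "h * v powr (q - 1) \<le> h * (h / \<delta>) powr (q - 1)"
    using assms hv by (intro mult_left_mono powr_mono2) auto
  also have "\<dots> = \<delta> powr (1 - q) * h powr q"
    using assms hv by (simp add: powr_divide powr_diff)
  finally show ?thesis using assms by (simp add: add_increasing)
qed

text \<open>An increment is either small compared with \<open>S\<close>, or large enough for the
  degenerate quadratic expression to dominate its q-th power. The last assumption covers
  \<open>S = 0\<close>, where \<open>powr\<close> returns 0 in place of an infinite weight.\<close>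

lemma powr_interpolation:
  fixes D S \<delta> q :: real
  assumes "0 \<le> D" "0 \<le> S" "0 < \<delta>" "0 < q" "q < 2" "S = 0 \<Longrightarrow> D = 0"
  shows "D powr q \<le> \<delta> powr q * S powr q + \<delta> powr (q - 2) * (D\<^sup>2 * S powr (q - 2))"
proof (cases "D \<le> \<delta> * S")
  case True
  then have "D powr q \<le> (\<delta> * S) powr q" using assms by (intro powr_mono2) auto
  then show ?thesis using assms by (simp add: powr_mult add_increasing2)
next
  case False
  then have D: "D > 0" using assms by (smt (verit) mult_nonneg_nonneg)
  then have S: "S > 0" using assms by (simp add: less_le) (metis less_irrefl)
  have "D powr q = D\<^sup>2 * D powr (q - 2)" using D by (simp add: powr_diff)
  also have "\<dots> \<le> D\<^sup>2 * (\<delta> * S) powr (q - 2)"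
    using False assms S by (intro mult_left_mono powr_mono2') auto
  also have "\<dots> = \<delta> powr (q - 2) * (D\<^sup>2 * S powr (q - 2))" using assms by (simp add: powr_mult)
  finally show ?thesis using assms by (simp add: add_increasing)
qed

section \<open>Finite exponents\<close>

lemma (in finite_measure) integrable_powr_le:
  fixes f :: "_ \<Rightarrow> real"
  assumes f[measurable]: "f \<in> borel_measurable M" and i: "integrable M (\<lambda>x. \<bar>f x\<bar> powr q)" and r: "0 \<le> r" "r \<le> q"
  shows "integrable M (\<lambda>x. \<bar>f x\<bar> powr r)"
proof (rule Bochner_Integration.integrable_bound)
  show "integrable M (\<lambda>x. 1 + \<bar>f x\<bar> powr q)" using i by simp
  have "t powr r \<le> 1 + t powr q" if "0 \<le> t" for t :: real
  proof (cases "t \<le> 1")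
    case True
    then have "t powr r \<le> 1 powr r" using r that by (intro powr_mono2) auto
    then show ?thesis by (simp add: add_increasing2)
  next
    case False
    then have "t powr r \<le> t powr q" using r by (intro powr_mono) auto
    then show ?thesis by simp
  qed
  then show "AE x in M. norm (\<bar>f x\<bar> powr r) \<le> norm (1 + \<bar>f x\<bar> powr q)" by (intro AE_I2) simp
qed simp

text \<open>Here \<open>X\<close> is the norm, \<open>e\<close> the energy and \<open>N\<close> the
  norm of the data. Inserting the bound for \<open>e\<close> into X + e produces (A + 1) \<theta> X,
  at most half of X, which moves to the left because X is a finite real number.\<close>

lemma absorb:
  fixes X e N w A K \<theta> :: real
  assumes "X \<le> A * w + A * e" "e \<le> \<theta> * X + K * N" "(A + 1) * \<theta> \<le> 1/2" "0 \<le> A" "0 \<le> X" "0 \<le> e" "0 \<le> K" "0 \<le> N" "0 \<le> w"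
  shows "X + e \<le> (2 * A + 2 * (A + 1) * K) * w + (2 * A + 2 * (A + 1) * K) * N"
proof -
  have "X + e \<le> A * w + (A + 1) * e" using assms(1) by (simp add: algebra_simps)
  also have "(A + 1) * e \<le> (A + 1) * (\<theta> * X + K * N)" using assms by (intro mult_left_mono) auto
  also have "\<dots> = ((A + 1) * \<theta>) * X + (A + 1) * K * N" by (simp add: algebra_simps)
  also have "((A + 1) * \<theta>) * X \<le> 1/2 * X" using assms by (intro mult_right_mono) auto
  finally have "X + e \<le> A * w + (1/2 * X + (A + 1) * K * N)" by simp
  then have "X + e \<le> 2 * (A * w) + 2 * ((A + 1) * K * N)" using assms(6) by linarith
  also have "\<dots> = 2 * A * w + 2 * (A + 1) * K * N" by simp
  also have "\<dots> \<le> (2 * A + 2 * (A + 1) * K) * w + (2 * A + 2 * (A + 1) * K) * N"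
    using assms by (intro add_mono mult_right_mono) auto
  finally show ?thesis .
qed

context nonlocal_domain
begin

text \<open>The constant of \<open>energy_estimate\<close>: 2 from symmetrisation,
  \<open>\<rho>\<^sub>1\<close> from the right-hand side, \<open>\<rho>\<^sub>0\<close> from
  removing the two weights.\<close>

definition C\<^sub>E :: real where "C\<^sub>E = 2 * \<rho>\<^sub>1 / \<rho>\<^sub>0\<^sup>2"

lemma C\<^sub>E_pos: "C\<^sub>E > 0" using \<rho>\<^sub>1 \<rho>\<^sub>0 by (simp add: C\<^sub>E_def)

text \<open>The pointwise bound dominates |u| by a constant plus a multiple of |h|. Both depend on
  \<epsilon>, but the result supplies exactly the finiteness without which nothing could be
  absorbed.\<close>

lemma solution_in_Lq:
  assumes \<epsilon>: "\<epsilon> > 0" and u: "integrable M u" and sol: "solves_nonlocal_poisson \<Omega> \<eta> \<rho> \<epsilon> h u"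
    and h[measurable]: "h \<in> borel_measurable M" and q: "q > 1" and hq: "integrable M (\<lambda>x. \<bar>h x\<bar> powr q)"
  shows "integrable M (\<lambda>x. \<bar>u x\<bar> powr q)"
proof -
  have [measurable]: "u \<in> borel_measurable M" using u by simp
  obtain m where m: "m > 0" "\<And>x. x \<in> \<Omega> \<Longrightarrow> m \<le> mass \<epsilon> x" using mass_lower_bound[OF \<epsilon>] \<epsilon> by auto
  define a where "a = \<eta> 0 / \<epsilon> ^ DIM('a) * \<rho>\<^sub>1 * (LINT y|M. \<bar>u y\<bar>) / m"
  define b where "b = \<epsilon>\<^sup>2 / m"
  have ab: "a \<ge> 0" "b \<ge> 0" using \<eta>0 \<epsilon> \<rho>\<^sub>1 m by (auto simp: a_def b_def)
  have "AE x in M. m * \<bar>u x\<bar> \<le> \<eta> 0 / \<epsilon> ^ DIM('a) * \<rho>\<^sub>1 * (LINT y|M. \<bar>u y\<bar>) + \<epsilon>\<^sup>2 * \<bar>h x\<bar>"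
    by (rule pointwise_bound[OF \<epsilon> u sol m(2)])
  then have AE: "AE x in M. \<bar>u x\<bar> \<le> a + b * \<bar>h x\<bar>"
  proof eventually_elim
    case (elim x)
    then show ?case using m(1) by (simp add: a_def b_def field_simps)
  qed
  show ?thesis
  proof (rule Bochner_Integration.integrable_bound)
    show "integrable M (\<lambda>x. 2 powr q * (a powr q + b powr q * \<bar>h x\<bar> powr q))" using hq by simp
    show "AE x in M. norm (\<bar>u x\<bar> powr q) \<le> norm (2 powr q * (a powr q + b powr q * \<bar>h x\<bar> powr q))"
      using AE
    proof eventually_elim
      case (elim x)
      have "\<bar>u x\<bar> powr q \<le> (a + b * \<bar>h x\<bar>) powr q" using elim q by (intro powr_mono2) auto
      also have "\<dots> \<le> 2 powr q * (a powr q + (b * \<bar>h x\<bar>) powr q)" using ab q by (intro powr_add_le) auto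
      finally show ?case using ab by (simp add: powr_mult)
    qed
  qed simp
qed

lemma power_energy_estimate:
  assumes \<epsilon>: "\<epsilon> > 0" and u: "integrable M u" and sol: "solves_nonlocal_poisson \<Omega> \<eta> \<rho> \<epsilon> h u"
    and h[measurable]: "h \<in> borel_measurable M" and q: "q > 1"
    and hq: "integrable M (\<lambda>x. \<bar>h x\<bar> powr q)" and uq: "integrable M (\<lambda>x. \<bar>u x\<bar> powr q)" and \<delta>: "\<delta> > 0"
  shows "(\<integral>\<^sup>+x. (\<integral>\<^sup>+y. ennreal (k \<epsilon> x y * ((u x - u y) * (spow (q - 1) (u x) - spow (q - 1) (u y)))) \<partial>M) \<partial>M)
     \<le> ennreal (C\<^sub>E * \<epsilon>\<^sup>2 * (\<delta> * (LINT x|M. \<bar>u x\<bar> powr q) + \<delta> powr (1 - q) * (LINT x|M. \<bar>h x\<bar> powr q)))"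
proof -
  have [measurable]: "u \<in> borel_measurable M" using u by simp
  have young: "\<bar>h x\<bar> * \<bar>spow (q - 1) (u x)\<bar> \<le> \<delta> * \<bar>u x\<bar> powr q + \<delta> powr (1 - q) * \<bar>h x\<bar> powr q" for x
    using young_powr[of "\<bar>h x\<bar>" "\<bar>u x\<bar>" \<delta> q] \<delta> q by (simp add: abs_spow)
  have bd: "integrable M (\<lambda>x. \<delta> * \<bar>u x\<bar> powr q + \<delta> powr (1 - q) * \<bar>h x\<bar> powr q)" using hq uq by simp
  have hg: "integrable M (\<lambda>x. \<bar>h x\<bar> * \<bar>spow (q - 1) (u x)\<bar>)"
    by (rule Bochner_Integration.integrable_bound[OF bd]) (use young in \<open>auto intro!: AE_I2 order_trans[OF _ abs_ge_self]\<close>)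
  have g: "integrable M (\<lambda>x. spow (q - 1) (u x))"
  proof (subst integrable_abs_iff[symmetric])
    show "integrable M (\<lambda>x. \<bar>spow (q - 1) (u x)\<bar>)"
      unfolding abs_spow by (rule M.integrable_powr_le[OF _ uq]) (use q in auto)
  qed measurable
  have "t * spow (q - 1) t = \<bar>t\<bar> powr q" for t
    using q by (cases "t = 0") (auto simp: spow_def powr_diff sgn_if)
  then have ug: "integrable M (\<lambda>x. u x * spow (q - 1) (u x))" using uq by simp
  have "(\<integral>\<^sup>+x. (\<integral>\<^sup>+y. ennreal (k \<epsilon> x y * ((u x - u y) * (spow (q - 1) (u x) - spow (q - 1) (u y)))) \<partial>M) \<partial>M)
      \<le> ennreal (C\<^sub>E * \<epsilon>\<^sup>2 * (LINT x|M. \<bar>h x\<bar> * \<bar>spow (q - 1) (u x)\<bar>))"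
    unfolding C\<^sub>E_def by (rule energy_estimate[OF \<epsilon> u sol h spow_mono g ug hg]) (use q in simp)
  also have "\<dots> \<le> ennreal (C\<^sub>E * \<epsilon>\<^sup>2 * (LINT x|M. \<delta> * \<bar>u x\<bar> powr q + \<delta> powr (1 - q) * \<bar>h x\<bar> powr q))"
    using C\<^sub>E_pos by (intro ennreal_leI mult_left_mono integral_mono hg bd young) auto
  also have "(LINT x|M. \<delta> * \<bar>u x\<bar> powr q + \<delta> powr (1 - q) * \<bar>h x\<bar> powr q)
     = \<delta> * (LINT x|M. \<bar>u x\<bar> powr q) + \<delta> powr (1 - q) * (LINT x|M. \<bar>h x\<bar> powr q)"
    using hq uq by simp
  finally show ?thesis .
qed

lemma estimate_from_energy:
  assumes "(\<integral>\<^sup>+x. ennreal (\<bar>w x\<bar> powr p) \<partial>M) \<le> ennreal (A * W) + ennreal A * E"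
    and "E \<le> ennreal (\<theta> * X + K * N)" and "(\<integral>\<^sup>+x. ennreal (\<bar>w x\<bar> powr p) \<partial>M) = ennreal X"
    and "(A + 1) * \<theta> \<le> 1/2" "0 \<le> A" "0 \<le> X" "0 \<le> K" "0 \<le> N" "0 \<le> W" "0 \<le> \<theta>"
  shows "(\<integral>\<^sup>+x. ennreal (\<bar>w x\<bar> powr p) \<partial>M) + E \<le>
     ennreal ((2 * A + 2 * (A + 1) * K) * W + (2 * A + 2 * (A + 1) * K) * N)"
proof -
  have "E < top" using assms(2) by (rule le_less_trans) simp
  then obtain e where e: "E = ennreal e" "0 \<le> e" by (cases E) auto
  have 1: "X \<le> A * W + A * e"
    using assms(1) assms e unfolding assms(3)
    by (simp add: e ennreal_mult[symmetric] ennreal_plus[symmetric] del: ennreal_plus)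
  have 2: "e \<le> \<theta> * X + K * N"
    using assms(2) unfolding e(1) by (subst (asm) ennreal_le_iff) (use assms in auto)
  have "X + e \<le> (2 * A + 2 * (A + 1) * K) * W + (2 * A + 2 * (A + 1) * K) * N"
    by (rule absorb[OF 1 2]) (use assms e in auto)
  then show ?thesis unfolding assms(3) e(1)
    using e(2) assms(6) by (simp add: ennreal_plus[symmetric] ennreal_leI del: ennreal_plus)
qed

lemma nn_integral_symmetrised:
  fixes F G :: "'a \<Rightarrow> 'a \<Rightarrow> ennreal"
  assumes [measurable]: "(\<lambda>(x, y). F x y) \<in> borel_measurable (M \<Otimes>\<^sub>M M)"
    "(\<lambda>(x, y). G x y) \<in> borel_measurable (M \<Otimes>\<^sub>M M)"
  shows "(\<integral>\<^sup>+x. (\<integral>\<^sup>+y. a * (F x y + F y x) + b * G x y \<partial>M) \<partial>M) =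
    a * ((\<integral>\<^sup>+x. (\<integral>\<^sup>+y. F x y \<partial>M) \<partial>M) + (\<integral>\<^sup>+x. (\<integral>\<^sup>+y. F x y \<partial>M) \<partial>M))
    + b * (\<integral>\<^sup>+x. (\<integral>\<^sup>+y. G x y \<partial>M) \<partial>M)"
proof -
  have swap: "(\<integral>\<^sup>+x. (\<integral>\<^sup>+y. F y x \<partial>M) \<partial>M) = (\<integral>\<^sup>+x. (\<integral>\<^sup>+y. F x y \<partial>M) \<partial>M)"
    by (rule MM.Fubini') measurable
  have inner: "(\<integral>\<^sup>+y. a * (F x y + F y x) + b * G x y \<partial>M) =
      a * ((\<integral>\<^sup>+y. F x y \<partial>M) + (\<integral>\<^sup>+y. F y x \<partial>M)) + b * (\<integral>\<^sup>+y. G x y \<partial>M)" if x: "x \<in> space M" for x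
  proof -
    have [measurable]: "F x \<in> borel_measurable M" "(\<lambda>y. F y x) \<in> borel_measurable M" "G x \<in> borel_measurable M"
      using measurable_Pair2[OF assms(1) x] measurable_Pair1[OF assms(1) x] measurable_Pair2[OF assms(2) x]
      by simp_all
    show ?thesis by (simp add: nn_integral_cmult nn_integral_add)
  qed
  have outer: "(\<integral>\<^sup>+x. a * ((\<integral>\<^sup>+y. F x y \<partial>M) + (\<integral>\<^sup>+y. F y x \<partial>M)) + b * (\<integral>\<^sup>+y. G x y \<partial>M) \<partial>M) =
      a * ((\<integral>\<^sup>+x. (\<integral>\<^sup>+y. F x y \<partial>M) \<partial>M) + (\<integral>\<^sup>+x. (\<integral>\<^sup>+y. F y x \<partial>M) \<partial>M)) + b * (\<integral>\<^sup>+x. (\<integral>\<^sup>+y. G x y \<partial>M) \<partial>M)"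
  proof -
    have [measurable]: "(\<lambda>x. \<integral>\<^sup>+y. F x y \<partial>M) \<in> borel_measurable M" "(\<lambda>x. \<integral>\<^sup>+y. G x y \<partial>M) \<in> borel_measurable M"
      "(\<lambda>x. \<integral>\<^sup>+y. F y x \<partial>M) \<in> borel_measurable M"
      using M.borel_measurable_nn_integral_fst[OF assms(1)] M.borel_measurable_nn_integral_fst[OF assms(2)]
        M.borel_measurable_nn_integral_fst[OF measurable_pair_swap[OF assms(1)]] by simp_all
    show ?thesis by (simp add: nn_integral_cmult nn_integral_add)
  qed
  have "(\<integral>\<^sup>+x. (\<integral>\<^sup>+y. a * (F x y + F y x) + b * G x y \<partial>M) \<partial>M) =
      (\<integral>\<^sup>+x. a * ((\<integral>\<^sup>+y. F x y \<partial>M) + (\<integral>\<^sup>+y. F y x \<partial>M)) + b * (\<integral>\<^sup>+y. G x y \<partial>M) \<partial>M)"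
    by (rule nn_integral_cong) (rule inner)
  then show ?thesis unfolding outer swap .
qed

text \<open>The quadratic Poincare inequality is applied to the signed power w of order q/2, for
  which |w|^2 = |u|^q and whose L^1 norm is the integral of |u|^(q/2).\<close>

lemma estimate_ge2:
  assumes q: "2 \<le> q" and \<epsilon>0: "\<epsilon>\<^sub>0 > 0"
  shows "\<exists>C>0. \<forall>\<epsilon>\<in>{0<..\<epsilon>\<^sub>0}. \<forall>h u. h \<in> borel_measurable M \<longrightarrow> integrable M (\<lambda>x. \<bar>h x\<bar> powr q) \<longrightarrow>
     integrable M u \<longrightarrow> solves_nonlocal_poisson \<Omega> \<eta> \<rho> \<epsilon> h u \<longrightarrow>
     (\<integral>\<^sup>+x. ennreal (\<bar>u x\<bar> powr q) \<partial>M) + nonlocal_energy \<Omega> \<eta> \<epsilon> 2 (\<lambda>x. spow (q/2) (u x))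
       \<le> ennreal (C * (LINT x|M. \<bar>u x\<bar> powr (q/2))\<^sup>2 + C * (LINT x|M. \<bar>h x\<bar> powr q))"
proof -
  obtain A where A: "A > 0" "\<And>\<epsilon> w. \<lbrakk>\<epsilon> \<in> {0<..\<epsilon>\<^sub>0}; integrable M w\<rbrakk> \<Longrightarrow>
     (\<integral>\<^sup>+x. ennreal (\<bar>w x\<bar> powr 2) \<partial>M) \<le> ennreal (A * (LINT x|M. \<bar>w x\<bar>) powr 2) + ennreal A * nonlocal_energy \<Omega> \<eta> \<epsilon> 2 w"
    using uniform_poincare[of 2 \<epsilon>\<^sub>0] \<epsilon>0 by auto
  \<comment> \<open>The energy returns \<open>q * C\<^sub>E * \<delta>\<close> times the norm, and
    this \<delta> makes (A + 1) \<theta> equal to 1/2.\<close>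
  define \<delta> where "\<delta> = 1 / (2 * (A + 1) * (q * C\<^sub>E))"
  have \<delta>: "\<delta> > 0" using A q C\<^sub>E_pos by (simp add: \<delta>_def)
  define \<theta> where "\<theta> = q * C\<^sub>E * \<delta>"
  define K where "K = q * C\<^sub>E * \<delta> powr (1 - q)"
  have \<theta>: "(A + 1) * \<theta> \<le> 1/2" "0 \<le> \<theta>" using A q C\<^sub>E_pos by (auto simp: \<theta>_def \<delta>_def)
  have K: "0 \<le> K" using q C\<^sub>E_pos by (simp add: K_def)
  show ?thesis
  proof (intro exI[of _ "2 * A + 2 * (A + 1) * K"] conjI ballI allI impI)
    show "2 * A + 2 * (A + 1) * K > 0" using A K by (simp add: add_pos_nonneg)
    fix \<epsilon> h u assume \<epsilon>: "\<epsilon> \<in> {0<..\<epsilon>\<^sub>0}" and h[measurable]: "h \<in> borel_measurable M"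
      and hq: "integrable M (\<lambda>x. \<bar>h x\<bar> powr q)" and u: "integrable M u"
      and sol: "solves_nonlocal_poisson \<Omega> \<eta> \<rho> \<epsilon> h u"
    have e0: "\<epsilon> > 0" using \<epsilon> by simp
    have [measurable]: "u \<in> borel_measurable M" using u by simp
    have q1: "q > 1" using q by simp
    have uq: "integrable M (\<lambda>x. \<bar>u x\<bar> powr q)" by (rule solution_in_Lq[OF e0 u sol h q1 hq])
    let ?w = "\<lambda>x. spow (q/2) (u x)"
    let ?X = "LINT x|M. \<bar>u x\<bar> powr q" and ?N = "LINT x|M. \<bar>h x\<bar> powr q"
    have w2: "\<bar>?w x\<bar> powr 2 = \<bar>u x\<bar> powr q" for x by (simp add: abs_spow powr_powr)
    have wi: "integrable M ?w"
    proof (subst integrable_abs_iff[symmetric])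
      show "integrable M (\<lambda>x. \<bar>spow (q/2) (u x)\<bar>)"
        unfolding abs_spow by (rule M.integrable_powr_le[OF _ uq]) (use q in auto)
    qed measurable
    have X: "(\<integral>\<^sup>+x. ennreal (\<bar>?w x\<bar> powr 2) \<partial>M) = ennreal ?X"
      unfolding w2 by (rule nn_integral_eq_integral[OF uq]) simp
    note [measurable] = k_measurable[OF e0]
    have [measurable]: "(\<lambda>(x, y). ennreal (k \<epsilon> x y * ((u x - u y) * (spow (q - 1) (u x) - spow (q - 1) (u y)))))
        \<in> borel_measurable (M \<Otimes>\<^sub>M M)" by measurable
    have "nonlocal_energy \<Omega> \<eta> \<epsilon> 2 ?w \<le> (\<integral>\<^sup>+x. (\<integral>\<^sup>+y. ennreal (q / \<epsilon>\<^sup>2) *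
        ennreal (k \<epsilon> x y * ((u x - u y) * (spow (q - 1) (u x) - spow (q - 1) (u y)))) \<partial>M) \<partial>M)"
      unfolding nonlocal_energy_eq
    proof (intro nn_integral_mono)
      fix x y
      have "\<bar>(?w y - ?w x) / \<epsilon>\<bar> powr 2 = (?w x - ?w y)\<^sup>2 / \<epsilon>\<^sup>2"
        by (simp add: power_divide power2_commute)
      also have "\<dots> \<le> q * ((u x - u y) * (spow (q - 1) (u x) - spow (q - 1) (u y))) / \<epsilon>\<^sup>2"
        by (intro divide_right_mono spow_half_diff_le q) simp
      finally have "k \<epsilon> x y * \<bar>(?w y - ?w x) / \<epsilon>\<bar> powr 2 \<le>
          k \<epsilon> x y * (q * ((u x - u y) * (spow (q - 1) (u x) - spow (q - 1) (u y))) / \<epsilon>\<^sup>2)"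
        by (rule mult_left_mono) (rule k_nonneg[OF e0])
      also have "\<dots> = q / \<epsilon>\<^sup>2 * (k \<epsilon> x y * ((u x - u y) * (spow (q - 1) (u x) - spow (q - 1) (u y))))"
        by simp
      finally show "ennreal (k \<epsilon> x y * \<bar>(?w y - ?w x) / \<epsilon>\<bar> powr 2) \<le> ennreal (q / \<epsilon>\<^sup>2) *
          ennreal (k \<epsilon> x y * ((u x - u y) * (spow (q - 1) (u x) - spow (q - 1) (u y))))"
        using q by (subst ennreal_mult'[symmetric]) (auto intro: ennreal_leI)
    qed
    also have "\<dots> = ennreal (q / \<epsilon>\<^sup>2) * (\<integral>\<^sup>+x. (\<integral>\<^sup>+y.
        ennreal (k \<epsilon> x y * ((u x - u y) * (spow (q - 1) (u x) - spow (q - 1) (u y)))) \<partial>M) \<partial>M)"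
      by (simp add: nn_integral_cmult)
    also have "\<dots> \<le> ennreal (q / \<epsilon>\<^sup>2) * ennreal (C\<^sub>E * \<epsilon>\<^sup>2 * (\<delta> * ?X + \<delta> powr (1 - q) * ?N))"
      by (intro mult_left_mono power_energy_estimate[OF e0 u sol h q1 hq uq \<delta>]) simp
    also have "\<dots> = ennreal (q / \<epsilon>\<^sup>2 * (C\<^sub>E * \<epsilon>\<^sup>2 * (\<delta> * ?X + \<delta> powr (1 - q) * ?N)))"
      using q by (intro ennreal_mult'[symmetric]) simp
    also have "q / \<epsilon>\<^sup>2 * (C\<^sub>E * \<epsilon>\<^sup>2 * (\<delta> * ?X + \<delta> powr (1 - q) * ?N)) = \<theta> * ?X + K * ?N"
      using e0 by (simp add: \<theta>_def K_def field_simps)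
    finally have E: "nonlocal_energy \<Omega> \<eta> \<epsilon> 2 ?w \<le> ennreal (\<theta> * ?X + K * ?N)" .
    have "(\<integral>\<^sup>+x. ennreal (\<bar>?w x\<bar> powr 2) \<partial>M) + nonlocal_energy \<Omega> \<eta> \<epsilon> 2 ?w \<le>
       ennreal ((2 * A + 2 * (A + 1) * K) * ((LINT x|M. \<bar>?w x\<bar>) powr 2) + (2 * A + 2 * (A + 1) * K) * ?N)"
      by (rule estimate_from_energy[OF A(2)[OF \<epsilon> wi] E X \<theta>(1)]) (use A K \<theta> in auto)
    then show "(\<integral>\<^sup>+x. ennreal (\<bar>u x\<bar> powr q) \<partial>M) + nonlocal_energy \<Omega> \<eta> \<epsilon> 2 ?w
       \<le> ennreal ((2 * A + 2 * (A + 1) * K) * (LINT x|M. \<bar>u x\<bar> powr (q/2))\<^sup>2 + (2 * A + 2 * (A + 1) * K) * ?N)"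
      unfolding w2 unfolding abs_spow by simp
  qed
qed

text \<open>The Poincare inequality with exponent \<open>q\<close> is applied to \<open>u\<close>
  itself. Testing controls only the degenerate quadratic energy, so interpolation trades it for the
  q-energy plus a small multiple of the norm of \<open>u\<close>, and two contributions have to be
  absorbed.\<close>

lemma estimate_lt2:
  assumes q: "1 < q" "q < 2" and \<epsilon>0: "\<epsilon>\<^sub>0 > 0"
  shows "\<exists>C>0. \<forall>\<epsilon>\<in>{0<..\<epsilon>\<^sub>0}. \<forall>h u. h \<in> borel_measurable M \<longrightarrow> integrable M (\<lambda>x. \<bar>h x\<bar> powr q) \<longrightarrow>
     integrable M u \<longrightarrow> solves_nonlocal_poisson \<Omega> \<eta> \<rho> \<epsilon> h u \<longrightarrow>
     (\<integral>\<^sup>+x. ennreal (\<bar>u x\<bar> powr q) \<partial>M) + nonlocal_energy \<Omega> \<eta> \<epsilon> q u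
       \<le> ennreal (C * (LINT x|M. \<bar>u x\<bar>) powr q + C * (LINT x|M. \<bar>h x\<bar> powr q))"
proof -
  obtain A where A: "A > 0" "\<And>\<epsilon> w. \<lbrakk>\<epsilon> \<in> {0<..\<epsilon>\<^sub>0}; integrable M w\<rbrakk> \<Longrightarrow>
     (\<integral>\<^sup>+x. ennreal (\<bar>w x\<bar> powr q) \<partial>M) \<le> ennreal (A * (LINT x|M. \<bar>w x\<bar>) powr q) + ennreal A * nonlocal_energy \<Omega> \<eta> \<epsilon> q w"
    using uniform_poincare[OF q(1) \<epsilon>0] by auto
  \<comment> \<open>\<open>C3\<close> bounds the integral of the kernel in one variable;
    \<open>C4\<close> adds the factor from splitting (|u x| + |u y|)^q and the 2 for its two
    symmetric halves.\<close>
  define C3 where "C3 = \<eta> 0 * unit_ball_vol (real DIM('a)) * 2 ^ DIM('a)"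
  have C3: "C3 > 0" using \<eta>0 by (simp add: C3_def)
  define C4 where "C4 = 2 powr q * (2 * C3)"
  have C4: "C4 > 0" using C3 by (simp add: C4_def)
  \<comment> \<open>Each of the two absorbed terms is given 1/4 after multiplication by A + 1. The
    parameter \<gamma> comes before \<delta> because \<open>B\<close>, which determines \<delta>,
    contains a negative power of \<gamma>.\<close>
  define \<gamma> where "\<gamma> = (1 / (4 * (A + 1) * C4)) powr (1/q)"
  have \<gamma>: "\<gamma> > 0" "\<gamma> powr q = 1 / (4 * (A + 1) * C4)"
    using A C4 q by (auto simp: \<gamma>_def powr_powr)
  define B where "B = \<gamma> powr (q - 2) / (q - 1) * C\<^sub>E"
  have B: "B > 0" using \<gamma> q C\<^sub>E_pos by (simp add: B_def)
  define \<delta> where "\<delta> = 1 / (4 * (A + 1) * B)"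
  have \<delta>: "\<delta> > 0" using A B by (simp add: \<delta>_def)
  define \<theta> where "\<theta> = \<gamma> powr q * C4 + B * \<delta>"
  define K where "K = B * \<delta> powr (1 - q)"
  have \<theta>: "(A + 1) * \<theta> \<le> 1/2" "0 \<le> \<theta>"
  proof -
    have "(A + 1) * \<theta> = (A + 1) * (\<gamma> powr q * C4) + (A + 1) * (B * \<delta>)" by (simp add: \<theta>_def distrib_left)
    also have "(A + 1) * (\<gamma> powr q * C4) = 1/4" using A C4 by (simp add: \<gamma>(2))
    also have "(A + 1) * (B * \<delta>) = 1/4" using A B by (simp add: \<delta>_def)
    finally show "(A + 1) * \<theta> \<le> 1/2" by simp
  qed (use C4 B \<delta> in \<open>simp add: \<theta>_def\<close>)
  have K: "0 \<le> K" using B by (simp add: K_def)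
  show ?thesis
  proof (intro exI[of _ "2 * A + 2 * (A + 1) * K"] conjI ballI allI impI)
    show "2 * A + 2 * (A + 1) * K > 0" using A K by (simp add: add_pos_nonneg)
    fix \<epsilon> h u assume \<epsilon>: "\<epsilon> \<in> {0<..\<epsilon>\<^sub>0}" and h[measurable]: "h \<in> borel_measurable M"
      and hq: "integrable M (\<lambda>x. \<bar>h x\<bar> powr q)" and u: "integrable M u"
      and sol: "solves_nonlocal_poisson \<Omega> \<eta> \<rho> \<epsilon> h u"
    have e0: "\<epsilon> > 0" using \<epsilon> by simp
    have [measurable]: "u \<in> borel_measurable M" using u by simp
    have uq: "integrable M (\<lambda>x. \<bar>u x\<bar> powr q)" by (rule solution_in_Lq[OF e0 u sol h q(1) hq])
    let ?X = "LINT x|M. \<bar>u x\<bar> powr q" and ?N = "LINT x|M. \<bar>h x\<bar> powr q"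
    have X: "(\<integral>\<^sup>+x. ennreal (\<bar>u x\<bar> powr q) \<partial>M) = ennreal ?X"
      by (rule nn_integral_eq_integral[OF uq]) simp
    note [measurable] = k_measurable[OF e0]
    define G where "G x y = ennreal (k \<epsilon> x y * ((u x - u y) * (spow (q - 1) (u x) - spow (q - 1) (u y))))" for x y
    have [measurable]: "(\<lambda>(x, y). G x y) \<in> borel_measurable (M \<Otimes>\<^sub>M M)" unfolding G_def by measurable
    define H where "H x y = ennreal (k \<epsilon> x y) * ennreal (\<bar>u x\<bar> powr q)" for x y
    have [measurable]: "(\<lambda>(x, y). H x y) \<in> borel_measurable (M \<Otimes>\<^sub>M M)" unfolding H_def by measurable
    have "nonlocal_energy \<Omega> \<eta> \<epsilon> q u \<le> (\<integral>\<^sup>+x. (\<integral>\<^sup>+y. ennreal (\<gamma> powr q * 2 powr q) * (H x y + H y x)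
        + ennreal (\<gamma> powr (q - 2) / ((q - 1) * \<epsilon>\<^sup>2)) * G x y \<partial>M) \<partial>M)"
      unfolding nonlocal_energy_eq
    proof (intro nn_integral_mono)
      fix x y
      let ?S = "\<bar>u x\<bar> + \<bar>u y\<bar>" and ?D = "\<bar>(u y - u x) / \<epsilon>\<bar>"
      let ?g = "(u x - u y) * (spow (q - 1) (u x) - spow (q - 1) (u y))"
      have gnn: "0 \<le> ?g"
        using spow_diff_ge[OF q, of "u x" "u y"] q by (smt (verit) mult_nonneg_nonneg powr_ge_zero zero_le_power2)
      have "?D\<^sup>2 * ?S powr (q - 2) = ((u x - u y)\<^sup>2 * ?S powr (q - 2)) / \<epsilon>\<^sup>2"
        by (simp add: power_divide power2_commute)
      also have "\<dots> \<le> (?g / (q - 1)) / \<epsilon>\<^sup>2"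
        using spow_diff_ge[OF q, of "u x" "u y"] q by (intro divide_right_mono) (auto simp: pos_le_divide_eq mult.commute)
      finally have 1: "\<gamma> powr (q - 2) * (?D\<^sup>2 * ?S powr (q - 2)) \<le> \<gamma> powr (q - 2) * ((?g / (q - 1)) / \<epsilon>\<^sup>2)"
        by (rule mult_left_mono) simp
      have 2: "\<gamma> powr q * ?S powr q \<le> \<gamma> powr q * (2 powr q * (\<bar>u x\<bar> powr q + \<bar>u y\<bar> powr q))"
        using q by (intro mult_left_mono powr_add_le) auto
      have "?D powr q \<le> \<gamma> powr q * ?S powr q + \<gamma> powr (q - 2) * (?D\<^sup>2 * ?S powr (q - 2))"
        using \<gamma> q by (intro powr_interpolation) auto
      also have "\<dots> \<le> \<gamma> powr q * (2 powr q * (\<bar>u x\<bar> powr q + \<bar>u y\<bar> powr q)) + \<gamma> powr (q - 2) * ((?g / (q - 1)) / \<epsilon>\<^sup>2)"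
        by (rule add_mono[OF 2 1])
      finally have "k \<epsilon> x y * ?D powr q \<le> k \<epsilon> x y * (\<gamma> powr q * (2 powr q * (\<bar>u x\<bar> powr q + \<bar>u y\<bar> powr q)) + \<gamma> powr (q - 2) * ((?g / (q - 1)) / \<epsilon>\<^sup>2))"
        by (rule mult_left_mono) (rule k_nonneg[OF e0])
      also have "\<dots> = (\<gamma> powr q * 2 powr q) * (k \<epsilon> x y * \<bar>u x\<bar> powr q + k \<epsilon> y x * \<bar>u y\<bar> powr q)
          + \<gamma> powr (q - 2) / ((q - 1) * \<epsilon>\<^sup>2) * (k \<epsilon> x y * ?g)"
      proof -
        have "K' * (a * (b * (U + V)) + c' * ((g / (q - 1)) / \<epsilon>\<^sup>2)) =
            (a * b) * (K' * U + K' * V) + c' / ((q - 1) * \<epsilon>\<^sup>2) * (K' * g)" for K' a b U V c' g :: real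
          by (simp add: distrib_left mult_ac)
        then show ?thesis unfolding k_sym[of \<epsilon> y x] .
      qed
      finally have "ennreal (k \<epsilon> x y * ?D powr q) \<le> ennreal ((\<gamma> powr q * 2 powr q) * (k \<epsilon> x y * \<bar>u x\<bar> powr q + k \<epsilon> y x * \<bar>u y\<bar> powr q)
          + \<gamma> powr (q - 2) / ((q - 1) * \<epsilon>\<^sup>2) * (k \<epsilon> x y * ?g))"
        by (rule ennreal_leI)
      also have "\<dots> = ennreal (\<gamma> powr q * 2 powr q) * (H x y + H y x) + ennreal (\<gamma> powr (q - 2) / ((q - 1) * \<epsilon>\<^sup>2)) * G x y"
      proof -
        have lin: "ennreal (a * (U + V) + b * g) = ennreal a * (ennreal U + ennreal V) + ennreal b * ennreal g"
          if "0 \<le> a" "0 \<le> b" "0 \<le> U" "0 \<le> V" "0 \<le> g" for a b U V g :: real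
          using that by (simp add: ennreal_mult)
        have H: "H x y = ennreal (k \<epsilon> x y * \<bar>u x\<bar> powr q)" for x y
          unfolding H_def using k_nonneg[OF e0] by (intro ennreal_mult[symmetric]) auto
        show ?thesis unfolding H G_def
          using k_nonneg[OF e0, of x y] k_nonneg[OF e0, of y x] gnn q by (intro lin) auto
      qed
      finally show "ennreal (k \<epsilon> x y * ?D powr q) \<le>
          ennreal (\<gamma> powr q * 2 powr q) * (H x y + H y x) + ennreal (\<gamma> powr (q - 2) / ((q - 1) * \<epsilon>\<^sup>2)) * G x y" .
    qed
    also have "\<dots> = ennreal (\<gamma> powr q * 2 powr q) * ((\<integral>\<^sup>+x. (\<integral>\<^sup>+y. H x y \<partial>M) \<partial>M) + (\<integral>\<^sup>+x. (\<integral>\<^sup>+y. H x y \<partial>M) \<partial>M))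
        + ennreal (\<gamma> powr (q - 2) / ((q - 1) * \<epsilon>\<^sup>2)) * (\<integral>\<^sup>+x. (\<integral>\<^sup>+y. G x y \<partial>M) \<partial>M)"
      by (rule nn_integral_symmetrised) measurable
    also have "\<dots> \<le> ennreal (\<gamma> powr q * 2 powr q) * (ennreal (C3 * ?X) + ennreal (C3 * ?X))
        + ennreal (\<gamma> powr (q - 2) / ((q - 1) * \<epsilon>\<^sup>2)) * ennreal (C\<^sub>E * \<epsilon>\<^sup>2 * (\<delta> * ?X + \<delta> powr (1 - q) * ?N))"
    proof -
      have "(\<integral>\<^sup>+x. (\<integral>\<^sup>+y. H x y \<partial>M) \<partial>M) \<le> (\<integral>\<^sup>+x. ennreal C3 * ennreal (\<bar>u x\<bar> powr q) \<partial>M)"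
        using nn_integral_k_le[OF e0] k_section_measurable[OF e0] unfolding H_def C3_def
        by (intro nn_integral_mono) (simp add: nn_integral_multc mult_right_mono)
      also have "\<dots> = ennreal C3 * ennreal ?X" by (subst nn_integral_cmult) (simp_all add: X)
      also have "\<dots> = ennreal (C3 * ?X)" using C3 by (intro ennreal_mult'[symmetric]) simp
      finally have H: "(\<integral>\<^sup>+x. (\<integral>\<^sup>+y. H x y \<partial>M) \<partial>M) \<le> ennreal (C3 * ?X)" .
      have G: "(\<integral>\<^sup>+x. (\<integral>\<^sup>+y. G x y \<partial>M) \<partial>M) \<le> ennreal (C\<^sub>E * \<epsilon>\<^sup>2 * (\<delta> * ?X + \<delta> powr (1 - q) * ?N))"
        unfolding G_def by (rule power_energy_estimate[OF e0 u sol h q(1) hq uq \<delta>])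
      show ?thesis by (intro add_mono mult_left_mono H G) auto
    qed
    also have "\<dots> = ennreal (\<gamma> powr q * 2 powr q * (C3 * ?X + C3 * ?X)
        + \<gamma> powr (q - 2) / ((q - 1) * \<epsilon>\<^sup>2) * (C\<^sub>E * \<epsilon>\<^sup>2 * (\<delta> * ?X + \<delta> powr (1 - q) * ?N)))"
    proof -
      have lin: "ennreal a * (ennreal U + ennreal V) + ennreal b * ennreal g = ennreal (a * (U + V) + b * g)"
        if "0 \<le> a" "0 \<le> b" "0 \<le> U" "0 \<le> V" "0 \<le> g" for a b U V g :: real
        using that by (simp add: ennreal_mult)
      show ?thesis using C3 q C\<^sub>E_pos \<delta> by (intro lin) auto
    qed
    also have "\<gamma> powr q * 2 powr q * (C3 * ?X + C3 * ?X)
        + \<gamma> powr (q - 2) / ((q - 1) * \<epsilon>\<^sup>2) * (C\<^sub>E * \<epsilon>\<^sup>2 * (\<delta> * ?X + \<delta> powr (1 - q) * ?N)) = \<theta> * ?X + K * ?N"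
    proof -
      have B_eq: "\<gamma> powr (q - 2) / ((q - 1) * \<epsilon>\<^sup>2) * (C\<^sub>E * \<epsilon>\<^sup>2 * Y) = B * Y" for Y
        using e0 by (simp add: B_def)
      show ?thesis unfolding B_eq by (simp add: \<theta>_def K_def C4_def algebra_simps)
    qed
    finally have E: "nonlocal_energy \<Omega> \<eta> \<epsilon> q u \<le> ennreal (\<theta> * ?X + K * ?N)" .
    show "(\<integral>\<^sup>+x. ennreal (\<bar>u x\<bar> powr q) \<partial>M) + nonlocal_energy \<Omega> \<eta> \<epsilon> q u
       \<le> ennreal ((2 * A + 2 * (A + 1) * K) * (LINT x|M. \<bar>u x\<bar>) powr q + (2 * A + 2 * (A + 1) * K) * ?N)"
      by (rule estimate_from_energy[OF A(2)[OF \<epsilon> u] E X \<theta>(1)]) (use A K \<theta> in auto)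
  qed
qed

end

section \<open>The bound for bounded right-hand sides\<close>

text \<open>The polynomial form of the Cauchy-Schwarz inequality, with optimal t = I / a. If
  \<open>a\<close> vanishes, a linear function bounded above has slope zero.\<close>

lemma discriminant_le:
  fixes I S a :: real
  assumes "\<And>t. 2 * t * I \<le> S + t\<^sup>2 * a" "0 \<le> a"
  shows "I\<^sup>2 \<le> a * S"
proof (cases "a = 0")
  case True
  have "I = 0"
  proof (rule ccontr)
    assume "I \<noteq> 0"
    then show False using assms(1)[of "(S + 1) / (2 * I)"] True by simp
  qed
  then show ?thesis using True by simp
next
  case False
  then have a: "a > 0" using assms(2) by simp
  have "2 * (I / a) * I \<le> S + (I / a)\<^sup>2 * a" by (rule assms(1))
  then have "a * (2 * (I / a) * I) \<le> a * (S + (I / a)\<^sup>2 * a)" using a by (intro mult_left_mono) auto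
  then show ?thesis using a by (simp add: power2_eq_square distrib_left)
qed

context nonlocal_domain
begin

text \<open>The positive part is monotone and 1-Lipschitz, so the square of its increment is at most
  the product of increments appearing in the energy estimate. Square integrability of
  \<open>u\<close> makes the test function admissible.\<close>

lemma truncation_energy:
  fixes l :: real
  assumes \<epsilon>: "\<epsilon> > 0" and u: "integrable M u" and u2: "integrable M (\<lambda>x. (u x)\<^sup>2)"
    and sol: "solves_nonlocal_poisson \<Omega> \<eta> \<rho> \<epsilon> h u"
    and h[measurable]: "h \<in> borel_measurable M" and H: "AE x in M. \<bar>h x\<bar> \<le> H"
  shows "nonlocal_energy \<Omega> \<eta> \<epsilon> 2 (\<lambda>x. max 0 (u x - l)) \<le> ennreal (C\<^sub>E * (H * (LINT x|M. max 0 (u x - l))))"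
proof -
  define \<phi> where "\<phi> t = max 0 (t - l)" for t :: real
  have [measurable]: "u \<in> borel_measurable M" using u by simp
  have \<phi>[measurable]: "\<phi> \<in> borel_measurable borel" unfolding \<phi>_def by measurable
  have mono: "mono \<phi>" by (auto intro!: monoI simp: \<phi>_def)
  have g: "integrable M (\<lambda>x. \<phi> (u x))" unfolding \<phi>_def using u by (intro integrable_max) auto
  have ug: "integrable M (\<lambda>x. u x * \<phi> (u x))"
  proof (rule Bochner_Integration.integrable_bound)
    show "integrable M (\<lambda>x. (u x)\<^sup>2 + \<bar>l\<bar> * \<bar>u x\<bar>)" using u u2 by simp
    have "\<bar>t * \<phi> t\<bar> \<le> t\<^sup>2 + \<bar>l\<bar> * \<bar>t\<bar>" for t
    proof -
      have "\<bar>t * \<phi> t\<bar> \<le> \<bar>t\<bar> * (\<bar>t\<bar> + \<bar>l\<bar>)"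
        unfolding abs_mult by (intro mult_left_mono) (auto simp: \<phi>_def)
      then show ?thesis by (simp add: distrib_left mult.commute power2_eq_square flip: abs_mult)
    qed
    then show "AE x in M. norm (u x * \<phi> (u x)) \<le> norm ((u x)\<^sup>2 + \<bar>l\<bar> * \<bar>u x\<bar>)"
      by (intro AE_I2) (auto intro: order_trans[OF _ abs_ge_self])
  qed measurable
  have hb: "AE x in M. \<bar>h x\<bar> * \<bar>\<phi> (u x)\<bar> \<le> H * \<phi> (u x)"
    using H by eventually_elim (auto simp: \<phi>_def intro: mult_right_mono)
  have hg: "integrable M (\<lambda>x. \<bar>h x\<bar> * \<bar>\<phi> (u x)\<bar>)"
  proof (rule Bochner_Integration.integrable_bound)
    show "integrable M (\<lambda>x. H * \<phi> (u x))" using g by simp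
    show "AE x in M. norm (\<bar>h x\<bar> * \<bar>\<phi> (u x)\<bar>) \<le> norm (H * \<phi> (u x))" using hb by eventually_elim simp
  qed measurable
  note [measurable] = k_measurable[OF \<epsilon>]
  have [measurable]: "(\<lambda>(x, y). ennreal (k \<epsilon> x y * ((u x - u y) * (\<phi> (u x) - \<phi> (u y))))) \<in> borel_measurable (M \<Otimes>\<^sub>M M)"
    by measurable
  have "nonlocal_energy \<Omega> \<eta> \<epsilon> 2 (\<lambda>x. \<phi> (u x)) \<le>
     (\<integral>\<^sup>+x. (\<integral>\<^sup>+y. ennreal (1 / \<epsilon>\<^sup>2) * ennreal (k \<epsilon> x y * ((u x - u y) * (\<phi> (u x) - \<phi> (u y)))) \<partial>M) \<partial>M)"
    unfolding nonlocal_energy_eq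
  proof (intro nn_integral_mono)
    fix x y
    have lip: "(\<phi> a - \<phi> b)\<^sup>2 \<le> (a - b) * (\<phi> a - \<phi> b)" for a b
    proof -
      consider "0 \<le> \<phi> a - \<phi> b" "\<phi> a - \<phi> b \<le> a - b" | "\<phi> a - \<phi> b \<le> 0" "a - b \<le> \<phi> a - \<phi> b"
        unfolding \<phi>_def by linarith
      then show ?thesis
        by cases (auto simp: power2_eq_square intro: mult_right_mono mult_right_mono_neg)
    qed
    have "\<bar>(\<phi> (u y) - \<phi> (u x)) / \<epsilon>\<bar> powr 2 = (\<phi> (u x) - \<phi> (u y))\<^sup>2 / \<epsilon>\<^sup>2"
      by (simp add: power_divide power2_commute)
    also have "\<dots> \<le> (u x - u y) * (\<phi> (u x) - \<phi> (u y)) / \<epsilon>\<^sup>2"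
      by (intro divide_right_mono lip) simp
    finally have "k \<epsilon> x y * \<bar>(\<phi> (u y) - \<phi> (u x)) / \<epsilon>\<bar> powr 2 \<le> k \<epsilon> x y * ((u x - u y) * (\<phi> (u x) - \<phi> (u y)) / \<epsilon>\<^sup>2)"
      by (rule mult_left_mono) (rule k_nonneg[OF \<epsilon>])
    also have "\<dots> = 1 / \<epsilon>\<^sup>2 * (k \<epsilon> x y * ((u x - u y) * (\<phi> (u x) - \<phi> (u y))))" by simp
    finally show "ennreal (k \<epsilon> x y * \<bar>(\<phi> (u y) - \<phi> (u x)) / \<epsilon>\<bar> powr 2) \<le>
        ennreal (1 / \<epsilon>\<^sup>2) * ennreal (k \<epsilon> x y * ((u x - u y) * (\<phi> (u x) - \<phi> (u y))))"
      by (subst ennreal_mult'[symmetric]) (auto intro: ennreal_leI)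
  qed
  also have "\<dots> = ennreal (1 / \<epsilon>\<^sup>2) * (\<integral>\<^sup>+x. (\<integral>\<^sup>+y. ennreal (k \<epsilon> x y * ((u x - u y) * (\<phi> (u x) - \<phi> (u y)))) \<partial>M) \<partial>M)"
    by (simp add: nn_integral_cmult)
  also have "\<dots> \<le> ennreal (1 / \<epsilon>\<^sup>2) * ennreal (C\<^sub>E * \<epsilon>\<^sup>2 * (LINT x|M. \<bar>h x\<bar> * \<bar>\<phi> (u x)\<bar>))"
    unfolding C\<^sub>E_def by (intro mult_left_mono energy_estimate[OF \<epsilon> u sol h mono g ug hg]) simp
  also have "\<dots> = ennreal (1 / \<epsilon>\<^sup>2 * (C\<^sub>E * \<epsilon>\<^sup>2 * (LINT x|M. \<bar>h x\<bar> * \<bar>\<phi> (u x)\<bar>)))"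
    by (rule ennreal_mult'[symmetric]) simp
  also have "1 / \<epsilon>\<^sup>2 * (C\<^sub>E * \<epsilon>\<^sup>2 * (LINT x|M. \<bar>h x\<bar> * \<bar>\<phi> (u x)\<bar>)) = C\<^sub>E * (LINT x|M. \<bar>h x\<bar> * \<bar>\<phi> (u x)\<bar>)"
    using \<epsilon> by simp
  also have "ennreal \<dots> \<le> ennreal (C\<^sub>E * (LINT x|M. H * \<phi> (u x)))"
    using C\<^sub>E_pos g hg hb by (intro ennreal_leI mult_left_mono integral_mono_AE) auto
  finally show ?thesis by (simp add: \<phi>_def)
qed

text \<open>The operator annihilates constants, so \<open>u\<close> may be replaced by
  \<open>u - l\<close>. Where this is positive, its average is at most the average of the positive
  part, and the excess takes the place of the full L^1 norm.\<close>

lemma pointwise_level_bound: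
  assumes \<epsilon>: "\<epsilon> > 0" and u: "integrable M u" and sol: "solves_nonlocal_poisson \<Omega> \<eta> \<rho> \<epsilon> h u"
    and H: "AE x in M. \<bar>h x\<bar> \<le> H" "0 \<le> H" and m: "0 \<le> m" "\<And>x. x \<in> \<Omega> \<Longrightarrow> m \<le> mass \<epsilon> x"
  shows "AE x in M. m * (u x - l) \<le> \<eta> 0 / \<epsilon> ^ DIM('a) * \<rho>\<^sub>1 * (LINT x|M. max 0 (u x - l)) + \<epsilon>\<^sup>2 * H"
  using poisson_AE[OF \<epsilon> u sol] H(1) AE_space
proof eventually_elim
  case (elim x)
  have v: "integrable M (\<lambda>x. max 0 (u x - l))" using u by (intro integrable_max) auto
  let ?R = "\<eta> 0 / \<epsilon> ^ DIM('a) * \<rho>\<^sub>1 * (LINT x|M. max 0 (u x - l))"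
  have R: "0 \<le> ?R" using \<eta>0 \<epsilon> \<rho>\<^sub>1 by simp
  show ?case
  proof (cases "u x \<le> l")
    case True
    then have "m * (u x - l) \<le> 0" using m(1) by (simp add: mult_nonneg_nonpos)
    then show ?thesis using R H(2) by (smt (verit) mult_nonneg_nonneg zero_le_power2)
  next
    case False
    have "m * (u x - l) \<le> mass \<epsilon> x * (u x - l)"
      using m(2)[of x] elim(3) False by (intro mult_right_mono) auto
    also have "\<dots> = (LINT y|M. k \<epsilon> x y * (u y * \<rho> y)) - l * (LINT y|M. k \<epsilon> x y * \<rho> y) + \<epsilon>\<^sup>2 * h x"
      using elim(1) by (simp add: mass_def algebra_simps)
    also have "(LINT y|M. k \<epsilon> x y * (u y * \<rho> y)) - l * (LINT y|M. k \<epsilon> x y * \<rho> y) =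
        (LINT y|M. k \<epsilon> x y * (u y * \<rho> y) - l * (k \<epsilon> x y * \<rho> y))"
      by (subst Bochner_Integration.integral_diff) (use integrable_k_mult(1)[OF \<epsilon> u] integrable_k[OF \<epsilon>] in simp_all)
    also have "\<dots> \<le> (LINT y|M. k \<epsilon> x y * (max 0 (u y - l) * \<rho> y))"
    proof (rule integral_mono)
      show "integrable M (\<lambda>y. k \<epsilon> x y * (u y * \<rho> y) - l * (k \<epsilon> x y * \<rho> y))"
        using integrable_k_mult(1)[OF \<epsilon> u] integrable_k[OF \<epsilon>] by simp
      show "integrable M (\<lambda>y. k \<epsilon> x y * (max 0 (u y - l) * \<rho> y))" by (rule integrable_k_mult(1)[OF \<epsilon> v])
      fix y assume "y \<in> space M"
      then have "(u y - l) * \<rho> y \<le> max 0 (u y - l) * \<rho> y"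
        using \<rho>_bounds[of y] \<rho>\<^sub>0 by (intro mult_right_mono) auto
      then have "k \<epsilon> x y * ((u y - l) * \<rho> y) \<le> k \<epsilon> x y * (max 0 (u y - l) * \<rho> y)"
        by (rule mult_left_mono) (rule k_nonneg[OF \<epsilon>])
      then show "k \<epsilon> x y * (u y * \<rho> y) - l * (k \<epsilon> x y * \<rho> y) \<le> k \<epsilon> x y * (max 0 (u y - l) * \<rho> y)"
        by (simp add: algebra_simps)
    qed
    also have "\<dots> \<le> ?R" by (rule average_le[OF \<epsilon> v]) simp
    finally have "m * (u x - l) \<le> ?R + \<epsilon>\<^sup>2 * h x" by simp
    moreover have "\<epsilon>\<^sup>2 * h x \<le> \<epsilon>\<^sup>2 * H" using elim(2) by (intro mult_left_mono) auto
    ultimately show ?thesis by linarith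
  qed
qed

definition excess :: "('a \<Rightarrow> real) \<Rightarrow> real \<Rightarrow> real" where
  "excess u l = (LINT x|M. max 0 (u x - l))"

definition level_measure :: "('a \<Rightarrow> real) \<Rightarrow> real \<Rightarrow> real" where
  "level_measure u l = measure M {x \<in> space M. l < u x}"

lemma level_measure_le:
  assumes u: "integrable M u" and l: "l < l'"
  shows "level_measure u l' \<le> excess u l / (l' - l)"
proof -
  have [measurable]: "u \<in> borel_measurable M" using u by simp
  have v: "integrable M (\<lambda>x. max 0 (u x - l))" using u by (intro integrable_max) auto
  have "(l' - l) * level_measure u l' = (LINT x|M. (l' - l) * indicator {x \<in> space M. l' < u x} x)"
    by (simp add: level_measure_def Int_def conj_commute)
  also have "\<dots> \<le> excess u l"
    unfolding excess_def
  proof (rule integral_mono)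
    show "integrable M (\<lambda>x. (l' - l) * indicator {x \<in> space M. l' < u x} x)"
    proof (intro integrable_mult_right integrable_real_indicator)
      show "{x \<in> space M. l' < u x} \<in> sets M" by measurable
    qed (simp add: less_top[symmetric])
  qed (use v l in \<open>auto split: split_indicator\<close>)
  finally show ?thesis using l by (simp add: field_simps)
qed

text \<open>Cauchy-Schwarz on the level set bounds the squared excess I^2 by its measure times the
  quadratic integral S. If the measure is small compared with r^(2d), the L^1 term of the Poincare
  inequality is at most S/2 and is absorbed. The energy leaves S at most a multiple of r^2 H I, and
  one factor I cancels.\<close>

lemma excess_le:
  assumes A: "A > 0" and r: "r > 0" and E: "nonlocal_energy \<Omega> \<eta> \<epsilon> 2 (\<lambda>x. max 0 (u x - l)) \<le> ennreal (C\<^sub>E * (H * excess u l))"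
    and P: "(\<integral>\<^sup>+x. ennreal (\<bar>max 0 (u x - l)\<bar> powr 2) \<partial>M) \<le> ennreal (A * ((LINT x|M. \<bar>max 0 (u x - l)\<bar>) / r ^ DIM('a)) powr 2)
       + ennreal (A * r powr 2) * nonlocal_energy \<Omega> \<eta> \<epsilon> 2 (\<lambda>x. max 0 (u x - l))"
    and u: "integrable M u" and u2: "integrable M (\<lambda>x. (u x)\<^sup>2)" and H: "0 \<le> H"
    and small: "level_measure u l \<le> 1 / (2 * A) * (r ^ DIM('a))\<^sup>2"
  shows "excess u l \<le> 2 * A * C\<^sub>E * r\<^sup>2 * H * level_measure u l"
proof -
  define v where "v x = max 0 (u x - l)" for x
  define I where "I = excess u l"
  define a where "a = level_measure u l"
  define S where "S = (LINT x|M. (v x)\<^sup>2)"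
  have [measurable]: "u \<in> borel_measurable M" using u by simp
  have vm[measurable]: "v \<in> borel_measurable M" unfolding v_def by measurable
  have v: "integrable M v" unfolding v_def using u by (intro integrable_max) auto
  have I: "I = (LINT x|M. v x)" "0 \<le> I" by (simp_all add: I_def excess_def v_def)
  have a: "0 \<le> a" by (simp add: a_def level_measure_def)
  have v2: "integrable M (\<lambda>x. (v x)\<^sup>2)"
  proof (rule Bochner_Integration.integrable_bound)
    show "integrable M (\<lambda>x. 2 * (u x)\<^sup>2 + 2 * l\<^sup>2)" using u2 by simp
    have "(max 0 (t - l))\<^sup>2 \<le> 2 * t\<^sup>2 + 2 * l\<^sup>2" for t :: real
    proof -
      have "(max 0 (t - l))\<^sup>2 \<le> (t - l)\<^sup>2" by (auto simp: max_def)
      also have "\<dots> \<le> 2 * t\<^sup>2 + 2 * l\<^sup>2" using zero_le_power2[of "t + l"] by (simp add: power2_eq_square algebra_simps)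
      finally show ?thesis .
    qed
    then show "AE x in M. norm ((v x)\<^sup>2) \<le> norm (2 * (u x)\<^sup>2 + 2 * l\<^sup>2)" by (intro AE_I2) (simp add: v_def)
  qed measurable
  have S: "0 \<le> S" by (simp add: S_def)
  have CS: "I\<^sup>2 \<le> a * S"
  proof (rule discriminant_le[OF _ a])
    fix t
    let ?f = "\<lambda>x. indicator {x \<in> space M. l < u x} x :: real"
    have fi: "integrable M ?f"
    proof (rule integrable_real_indicator)
      show "{x \<in> space M. l < u x} \<in> sets M" by measurable
    qed (simp add: less_top[symmetric])
    have "2 * t * I = (LINT x|M. 2 * t * v x)" by (simp add: I)
    also have "\<dots> \<le> (LINT x|M. (v x)\<^sup>2 + t\<^sup>2 * ?f x)"
    proof (rule integral_mono)
      fix x assume x: "x \<in> space M"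
      show "2 * t * v x \<le> (v x)\<^sup>2 + t\<^sup>2 * ?f x"
      proof (cases "l < u x")
        case True
        then show ?thesis using x sum_squares_bound[of t "v x"] by simp
      qed (simp add: v_def)
    qed (use v v2 fi in auto)
    also have "\<dots> = S + t\<^sup>2 * a"
      using v2 fi by (simp add: S_def a_def level_measure_def Int_def conj_commute)
    finally show "2 * t * I \<le> S + t\<^sup>2 * a" .
  qed
  have "ennreal S = (\<integral>\<^sup>+x. ennreal (\<bar>v x\<bar> powr 2) \<partial>M)"
    using nn_integral_eq_integral[OF v2] by (simp add: S_def)
  also have "\<dots> \<le> ennreal (A * (I / r ^ DIM('a)) powr 2) + ennreal (A * r powr 2) * nonlocal_energy \<Omega> \<eta> \<epsilon> 2 v"
    using P by (simp add: I v_def[abs_def])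
  also have "\<dots> \<le> ennreal (A * (I / r ^ DIM('a)) powr 2) + ennreal (A * r powr 2) * ennreal (C\<^sub>E * (H * I))"
    using E by (intro add_left_mono mult_left_mono) (simp_all add: v_def[abs_def] I_def)
  also have "\<dots> = ennreal (A * (I / r ^ DIM('a))\<^sup>2 + A * r\<^sup>2 * (C\<^sub>E * (H * I)))"
    using A r I H C\<^sub>E_pos by (simp add: ennreal_mult)
  finally have "S \<le> A * (I / r ^ DIM('a))\<^sup>2 + A * r\<^sup>2 * (C\<^sub>E * (H * I))"
    using A I H C\<^sub>E_pos by (subst (asm) ennreal_le_iff) auto
  also have "A * (I / r ^ DIM('a))\<^sup>2 \<le> S / 2"
  proof -
    have "A * (I / r ^ DIM('a))\<^sup>2 = A * I\<^sup>2 / (r ^ DIM('a))\<^sup>2" by (simp add: power_divide)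
    also have "\<dots> \<le> A * (a * S) / (r ^ DIM('a))\<^sup>2" using A CS by (intro divide_right_mono mult_left_mono) auto
    also have "\<dots> \<le> A * ((1 / (2 * A) * (r ^ DIM('a))\<^sup>2) * S) / (r ^ DIM('a))\<^sup>2"
      using A S small unfolding a_def by (intro divide_right_mono mult_left_mono mult_right_mono) auto
    also have "\<dots> = S / 2" using A r by simp
    finally show ?thesis .
  qed
  finally have "S \<le> 2 * (A * r\<^sup>2 * (C\<^sub>E * (H * I)))" by simp
  also have "\<dots> = 2 * A * C\<^sub>E * r\<^sup>2 * H * I" by (simp add: mult_ac)
  finally have S_le: "S \<le> 2 * A * C\<^sub>E * r\<^sup>2 * H * I" .
  have "I * I \<le> a * S" using CS by (simp add: power2_eq_square)
  also have "\<dots> \<le> a * (2 * A * C\<^sub>E * r\<^sup>2 * H * I)" by (rule mult_left_mono[OF S_le a])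
  finally have "I * I \<le> (2 * A * C\<^sub>E * r\<^sup>2 * H * a) * I" by (simp add: mult_ac)
  moreover have "0 \<le> 2 * A * C\<^sub>E * r\<^sup>2 * H * a" using A C\<^sub>E_pos H a by simp
  ultimately have "I \<le> 2 * A * C\<^sub>E * r\<^sup>2 * H * a"
    using I(2) by (cases "I = 0") auto
  then show ?thesis by (simp add: I_def a_def)
qed

text \<open>De Giorgi iteration on levels \<open>l\<^sub>j\<close> coupled with the length scales \<open>r\<^sub>j = R / 2\<^sup>j\<close>: the Poincare
  inequality is available at scale \<open>r\<^sub>j\<close> only while \<open>r\<^sub>j \<ge> \<epsilon>\<close>, and once \<open>r\<^sub>j\<close> is comparable to \<open>\<epsilon>\<close>
  the equation itself bounds the excess over the last level.\<close>

lemma upper_bound: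
  defines "R \<equiv> c * s\<^sub>0 / 2"
  shows "\<exists>C>0. \<forall>\<epsilon>\<in>{0<..R}. \<forall>H>0. \<forall>h u. h \<in> borel_measurable M \<longrightarrow> (AE x in M. \<bar>h x\<bar> \<le> H) \<longrightarrow>
     integrable M u \<longrightarrow> solves_nonlocal_poisson \<Omega> \<eta> \<rho> \<epsilon> h u \<longrightarrow>
     (AE x in M. u x \<le> C * (LINT x|M. \<bar>u x\<bar>) + C * H)"
proof -
  have R: "R > 0" using c s\<^sub>0 by (simp add: R_def)
  obtain A where A: "A > 0" "\<And>\<epsilon> r w. \<lbrakk>0 < \<epsilon>; \<epsilon> \<le> r; r \<le> R; integrable M w\<rbrakk> \<Longrightarrow>
     (\<integral>\<^sup>+x. ennreal (\<bar>w x\<bar> powr 2) \<partial>M) \<le> ennreal (A * ((LINT x|M. \<bar>w x\<bar>) / r ^ DIM('a)) powr 2)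
       + ennreal (A * r powr 2) * nonlocal_energy \<Omega> \<eta> \<epsilon> 2 w"
    using kernel_poincare[of 2] unfolding R_def by auto
  obtain m where m: "m > 0" "\<And>\<epsilon> x. \<lbrakk>\<epsilon> \<in> {0<..R}; x \<in> \<Omega>\<rbrakk> \<Longrightarrow> m \<le> mass \<epsilon> x"
    using mass_lower_bound[OF R] by blast
  define \<alpha> where "\<alpha> = 1 / (2 * A)"
  define D where "D = 2 * A * C\<^sub>E"
  have \<alpha>: "\<alpha> > 0" and D: "D > 0" using A C\<^sub>E_pos by (auto simp: \<alpha>_def D_def)
  \<comment> \<open>\<open>K0\<close> makes the first level high enough for Markov's inequality to
    start the iteration, \<open>K1\<close> bounds the sum of all gaps, and \<open>K2\<close>,
    \<open>K3\<close> come from the final pointwise step.\<close>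
  define K0 where "K0 = 1 / (\<alpha> * (R ^ DIM('a))\<^sup>2)"
  define K1 where "K1 = 4 ^ DIM('a) * D * R\<^sup>2 * 2"
  define K2 where "K2 = \<eta> 0 * \<rho>\<^sub>1 * D * 4 * \<alpha> * 4 ^ DIM('a) * R ^ DIM('a) * R\<^sup>2"
  define K3 where "K3 = (K2 + R\<^sup>2) / m"
  have K: "K0 > 0" "K1 > 0" "K2 \<ge> 0" "K3 > 0"
    using \<alpha> D R m \<eta>0 \<rho>\<^sub>1 by (auto simp: K0_def K1_def K2_def K3_def intro!: divide_pos_pos add_nonneg_pos)
  show ?thesis
  proof (intro exI[of _ "K0 + K1 + K3"] conjI ballI allI impI)
    fix \<epsilon> H :: real and h u :: "'a \<Rightarrow> real"
    assume \<epsilon>: "\<epsilon> \<in> {0<..R}" and H: "H > 0" and h[measurable]: "h \<in> borel_measurable M"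
      and hH: "AE x in M. \<bar>h x\<bar> \<le> H" and u: "integrable M u"
      and sol: "solves_nonlocal_poisson \<Omega> \<eta> \<rho> \<epsilon> h u"
    have e0: "\<epsilon> > 0" "\<epsilon> \<le> R" using \<epsilon> by auto
    have "integrable M (\<lambda>x. \<bar>h x\<bar> powr 2)"
    proof (rule M.integrable_const_bound)
      show "AE x in M. norm (\<bar>h x\<bar> powr 2) \<le> H\<^sup>2" using hH by eventually_elim (simp add: abs_le_square_iff[symmetric])
    qed measurable
    then have "integrable M (\<lambda>x. \<bar>u x\<bar> powr 2)" by (intro solution_in_Lq[OF e0(1) u sol h]) auto
    then have u2: "integrable M (\<lambda>x. (u x)\<^sup>2)" by simp
    define U where "U = (LINT x|M. \<bar>u x\<bar>)"
    have U: "U \<ge> 0" by (simp add: U_def)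
    define r where "r j = R / 2 ^ j" for j :: nat
    \<comment> \<open>The gap between successive levels is 4^d times the factor in the excess bound.
      Chebyshev's inequality then shrinks the level measure by 4^d, exactly the decrease of r^(2d)
      when r is halved, and the gaps form a geometric series because r^2 does.\<close>
    define l where "l j = K0 * (U + H) + 4 ^ DIM('a) * D * R\<^sup>2 * H * (\<Sum>i<j. (1/4) ^ i)" for j :: nat
    have r_pos: "r j > 0" for j using R by (simp add: r_def)
    have r_le: "r j \<le> R" for j using R by (simp add: r_def field_simps)
    have l_Suc: "l (Suc j) = l j + 4 ^ DIM('a) * D * (r j)\<^sup>2 * H" for j
    proof -
      have "((2::real) ^ j)\<^sup>2 = 4 ^ j" by (simp add: power_even_eq[symmetric] power_mult)
      then have "(r j)\<^sup>2 = R\<^sup>2 * (1/4) ^ j" by (simp add: r_def power_divide)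
      then show ?thesis by (simp add: l_def distrib_left mult_ac)
    qed
    have l_le: "l j \<le> K0 * (U + H) + K1 * H" for j
    proof -
      have "(\<Sum>i<j. (1/4::real) ^ i) = 4/3 - 4/3 * (1/4) ^ j"
      proof (induction j)
        case (Suc j)
        then show ?case unfolding sum.lessThan_Suc power_Suc by linarith
      qed simp
      moreover have "(0::real) \<le> (1/4) ^ j" by simp
      ultimately have "(\<Sum>i<j. (1/4::real) ^ i) \<le> 2" by linarith
      then have "4 ^ DIM('a) * D * R\<^sup>2 * H * (\<Sum>i<j. (1/4) ^ i) \<le> 4 ^ DIM('a) * D * R\<^sup>2 * H * 2"
        using D H by (intro mult_left_mono) auto
      then show ?thesis by (simp add: l_def K1_def mult_ac)
    qed
    have ex: "excess u (l j) \<le> D * (r j)\<^sup>2 * H * level_measure u (l j)"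
      if "\<epsilon> \<le> r j" "level_measure u (l j) \<le> \<alpha> * (r j ^ DIM('a))\<^sup>2" for j
    proof -
      have v: "integrable M (\<lambda>x. max 0 (u x - l j))" using u by (intro integrable_max) auto
      show ?thesis unfolding D_def
        by (rule excess_le[OF A(1) r_pos _ A(2)[OF e0(1) that(1) r_le v] u u2])
          (use truncation_energy[OF e0(1) u u2 sol h hH, of "l j"] that(2) H in \<open>simp_all add: excess_def \<alpha>_def\<close>)
    qed
    have level: "level_measure u (l j) \<le> \<alpha> * (r j ^ DIM('a))\<^sup>2" if "\<And>i. i < j \<Longrightarrow> \<epsilon> \<le> r i" for j
      using that
    proof (induction j)
      case 0
      have K0: "K0 * (U + H) > 0" using K U H by simp
      have "level_measure u (l 0) \<le> excess u 0 / (l 0 - 0)"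
        by (rule level_measure_le[OF u]) (use K0 in \<open>simp add: l_def\<close>)
      also have "\<dots> \<le> U / (K0 * (U + H))"
      proof -
        have "excess u 0 \<le> U"
          unfolding excess_def U_def by (intro integral_mono integrable_max) (use u in auto)
        then show ?thesis using K0 by (simp add: l_def divide_right_mono)
      qed
      also have "\<dots> \<le> (U + H) / (K0 * (U + H))" using K0 H by (intro divide_right_mono) auto
      also have "\<dots> = 1 / K0" using U H by simp
      also have "\<dots> = \<alpha> * (r 0 ^ DIM('a))\<^sup>2" by (simp add: K0_def r_def)
      finally show ?case .
    next
      case (Suc j)
      have IH: "level_measure u (l j) \<le> \<alpha> * (r j ^ DIM('a))\<^sup>2" using Suc by simp
      have rj: "\<epsilon> \<le> r j" using Suc.prems by simp
      let ?\<Delta> = "4 ^ DIM('a) * (D * (r j)\<^sup>2 * H)"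
      have gap: "l (Suc j) - l j = ?\<Delta>" and pos: "D * (r j)\<^sup>2 * H > 0"
        using D H r_pos[of j] by (simp_all add: l_Suc)
      have "?\<Delta> > 0" using pos by (intro mult_pos_pos[OF _ pos]) simp
      then have lt: "l j < l (Suc j)" using gap by linarith
      have "level_measure u (l (Suc j)) \<le> excess u (l j) / (l (Suc j) - l j)"
        by (rule level_measure_le[OF u lt])
      also have "\<dots> \<le> (D * (r j)\<^sup>2 * H * level_measure u (l j)) / ?\<Delta>"
        unfolding gap using ex[OF rj IH] pos by (intro divide_right_mono) auto
      also have "\<dots> = level_measure u (l j) / 4 ^ DIM('a)" using D H r_pos[of j] by simp
      also have "\<dots> \<le> \<alpha> * (r j ^ DIM('a))\<^sup>2 / 4 ^ DIM('a)" using IH by (rule divide_right_mono) simp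
      also have "\<dots> = \<alpha> * (r (Suc j) ^ DIM('a))\<^sup>2"
      proof -
        have four: "((2::real) ^ DIM('a))\<^sup>2 = 4 ^ DIM('a)" by (simp add: power_even_eq[symmetric] power_mult)
        have half: "r (Suc j) = r j / 2" by (simp add: r_def)
        show ?thesis unfolding half power_divide four by simp
      qed
      finally show ?case .
    qed
    have "\<exists>j. r j < \<epsilon>"
    proof -
      obtain j where "R / \<epsilon> < 2 ^ j" using real_arch_pow[of 2 "R / \<epsilon>"] by auto
      then have "r j < \<epsilon>" using e0 by (simp add: r_def field_simps)
      then show ?thesis ..
    qed
    \<comment> \<open>The index before the first scale below \<epsilon> has its scale between
      \<epsilon> and 2 \<epsilon>. It exists since the initial scale \<open>R\<close> is at least
      \<epsilon>.\<close>
    define N where "N = (LEAST j. r j < \<epsilon>)"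
    have N: "r N < \<epsilon>" "\<And>i. i < N \<Longrightarrow> \<epsilon> \<le> r i"
      unfolding N_def using LeastI_ex[OF \<open>\<exists>j. r j < \<epsilon>\<close>] not_less_Least by force+
    have "N \<noteq> 0" using N(1) e0 by (cases N) (auto simp: r_def)
    then obtain J where J: "N = Suc J" using not0_implies_Suc by blast
    have rJ: "\<epsilon> \<le> r J" "r J \<le> 2 * \<epsilon>" using N J by (auto simp: r_def)
    have lev: "level_measure u (l J) \<le> \<alpha> * (r J ^ DIM('a))\<^sup>2" using N J by (intro level) auto
    have "excess u (l J) \<le> D * (r J)\<^sup>2 * H * level_measure u (l J)" by (rule ex[OF rJ(1) lev])
    also have "\<dots> \<le> D * (2 * \<epsilon>)\<^sup>2 * H * (\<alpha> * ((2 * \<epsilon>) ^ DIM('a))\<^sup>2)"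
    proof (intro mult_mono mult_left_mono mult_right_mono power_mono)
      have "level_measure u (l J) \<le> \<alpha> * (r J ^ DIM('a))\<^sup>2" by (rule lev)
      also have "\<dots> \<le> \<alpha> * ((2 * \<epsilon>) ^ DIM('a))\<^sup>2"
        using \<alpha> rJ r_pos[of J] by (intro mult_left_mono power_mono) auto
      finally show "level_measure u (l J) \<le> \<alpha> * ((2 * \<epsilon>) ^ DIM('a))\<^sup>2" .
    qed (use D H rJ r_pos[of J] e0 in \<open>auto simp: level_measure_def\<close>)
    also have "\<dots> = D * 4 * \<alpha> * 4 ^ DIM('a) * (\<epsilon> ^ DIM('a) * \<epsilon> ^ DIM('a)) * \<epsilon>\<^sup>2 * H"
    proof -
      have four: "(4::real) ^ DIM('a) = 2 ^ DIM('a) * 2 ^ DIM('a)" by (simp flip: power_mult_distrib)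
      show ?thesis unfolding power_mult_distrib power2_eq_square four by (simp add: mult_ac)
    qed
    finally have exc: "excess u (l J) \<le> D * 4 * \<alpha> * 4 ^ DIM('a) * (\<epsilon> ^ DIM('a) * \<epsilon> ^ DIM('a)) * \<epsilon>\<^sup>2 * H" .
    \<comment> \<open>The last excess is of order \<epsilon>^(2d+2), so it outweighs the factor
      \<epsilon>^(-d) of the averaging bound and the result stays bounded.\<close>
    have "\<eta> 0 / \<epsilon> ^ DIM('a) * \<rho>\<^sub>1 * excess u (l J) \<le>
        \<eta> 0 / \<epsilon> ^ DIM('a) * \<rho>\<^sub>1 * (D * 4 * \<alpha> * 4 ^ DIM('a) * (\<epsilon> ^ DIM('a) * \<epsilon> ^ DIM('a)) * \<epsilon>\<^sup>2 * H)"
      using exc \<eta>0 \<rho>\<^sub>1 e0 by (intro mult_left_mono) auto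
    also have "\<dots> = \<eta> 0 * \<rho>\<^sub>1 * D * 4 * \<alpha> * 4 ^ DIM('a) * \<epsilon> ^ DIM('a) * \<epsilon>\<^sup>2 * H"
      using e0 by (simp add: mult_ac)
    also have "\<dots> \<le> \<eta> 0 * \<rho>\<^sub>1 * D * 4 * \<alpha> * 4 ^ DIM('a) * R ^ DIM('a) * R\<^sup>2 * H"
      using e0 \<eta>0 \<rho>\<^sub>1 D \<alpha> H R by (intro mult_mono mult_right_mono power_mono) auto
    finally have K2: "\<eta> 0 / \<epsilon> ^ DIM('a) * \<rho>\<^sub>1 * excess u (l J) \<le> K2 * H" by (simp add: K2_def)
    have "AE x in M. m * (u x - l J) \<le> \<eta> 0 / \<epsilon> ^ DIM('a) * \<rho>\<^sub>1 * (LINT x|M. max 0 (u x - l J)) + \<epsilon>\<^sup>2 * H"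
      by (rule pointwise_level_bound[OF e0(1) u sol hH]) (use H m \<epsilon> in auto)
    then show "AE x in M. u x \<le> (K0 + K1 + K3) * (LINT x|M. \<bar>u x\<bar>) + (K0 + K1 + K3) * H"
    proof eventually_elim
      case (elim x)
      have "\<epsilon>\<^sup>2 * H \<le> R\<^sup>2 * H" using e0 H by (intro mult_right_mono power_mono) auto
      then have "m * (u x - l J) \<le> (K2 + R\<^sup>2) * H"
        using elim K2 by (simp add: excess_def distrib_right)
      then have "u x - l J \<le> K3 * H" using m(1) by (simp add: K3_def field_simps)
      then have "u x \<le> K0 * U + (K0 + K1 + K3) * H" using l_le[of J] by (simp add: algebra_simps)
      also have "\<dots> \<le> (K0 + K1 + K3) * U + (K0 + K1 + K3) * H"
        using K U by (intro add_right_mono mult_right_mono) auto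
      finally show ?case by (simp add: U_def)
    qed
  qed (use K in simp)
qed

lemma solves_minus:
  assumes "solves_nonlocal_poisson \<Omega> \<eta> \<rho> \<epsilon> h u"
  shows "solves_nonlocal_poisson \<Omega> \<eta> \<rho> \<epsilon> (\<lambda>x. - h x) (\<lambda>x. - u x)"
proof -
  have "nonlocal_laplacian \<Omega> \<eta> \<rho> \<epsilon> (\<lambda>x. - u x) x = - nonlocal_laplacian \<Omega> \<eta> \<rho> \<epsilon> u x" for x
  proof -
    have "rescaled_kernel DIM('a) \<eta> \<epsilon> (norm (x - y)) * (- u y - - u x) * \<rho> y =
        - (rescaled_kernel DIM('a) \<eta> \<epsilon> (norm (x - y)) * (u y - u x) * \<rho> y)" for y
      by (simp add: algebra_simps)
    then show ?thesis unfolding nonlocal_laplacian_def by (simp only: integral_minus)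
  qed
  then show ?thesis using assms unfolding solves_nonlocal_poisson_def by (auto elim!: eventually_mono)
qed

text \<open>For small \<epsilon> the one-sided bound is applied to \<open>u\<close> and, by
  linearity, to its negative. For larger \<epsilon> the factor \<epsilon>^(-d) is bounded and the
  pointwise bound suffices.\<close>

lemma uniform_bound:
  assumes \<epsilon>0: "\<epsilon>\<^sub>0 > 0"
  shows "\<exists>C>0. \<forall>\<epsilon>\<in>{0<..\<epsilon>\<^sub>0}. \<forall>H>0. \<forall>h u. h \<in> borel_measurable M \<longrightarrow> (AE x in M. \<bar>h x\<bar> \<le> H) \<longrightarrow>
     integrable M u \<longrightarrow> solves_nonlocal_poisson \<Omega> \<eta> \<rho> \<epsilon> h u \<longrightarrow>
     (AE x in M. \<bar>u x\<bar> \<le> C * (LINT x|M. \<bar>u x\<bar>) + C * H)"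
proof -
  define R where "R = c * s\<^sub>0 / 2"
  have R: "R > 0" using c s\<^sub>0 by (simp add: R_def)
  obtain C where C: "C > 0" "\<And>\<epsilon> H h u. \<lbrakk>\<epsilon> \<in> {0<..R}; H > 0; h \<in> borel_measurable M; AE x in M. \<bar>h x\<bar> \<le> H;
     integrable M u; solves_nonlocal_poisson \<Omega> \<eta> \<rho> \<epsilon> h u\<rbrakk> \<Longrightarrow>
     AE x in M. u x \<le> C * (LINT x|M. \<bar>u x\<bar>) + C * H"
    using upper_bound unfolding R_def by blast
  obtain m where m: "m > 0" "\<And>\<epsilon> x. \<lbrakk>\<epsilon> \<in> {0<..\<epsilon>\<^sub>0}; x \<in> \<Omega>\<rbrakk> \<Longrightarrow> m \<le> mass \<epsilon> x"
    using mass_lower_bound[OF \<epsilon>0] by blast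
  define K where "K = (\<eta> 0 / R ^ DIM('a) * \<rho>\<^sub>1 + \<epsilon>\<^sub>0\<^sup>2) / m"
  have K: "K \<ge> 0" using \<eta>0 \<rho>\<^sub>1 R m by (simp add: K_def)
  show ?thesis
  proof (intro exI[of _ "C + K"] conjI ballI allI impI)
    fix \<epsilon> H :: real and h u :: "'a \<Rightarrow> real"
    assume \<epsilon>: "\<epsilon> \<in> {0<..\<epsilon>\<^sub>0}" and H: "H > 0" and h[measurable]: "h \<in> borel_measurable M"
      and hH: "AE x in M. \<bar>h x\<bar> \<le> H" and u: "integrable M u"
      and sol: "solves_nonlocal_poisson \<Omega> \<eta> \<rho> \<epsilon> h u"
    define U where "U = (LINT x|M. \<bar>u x\<bar>)"
    have U: "U \<ge> 0" by (simp add: U_def)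
    have "AE x in M. \<bar>u x\<bar> \<le> C * U + C * H \<or> \<bar>u x\<bar> \<le> K * U + K * H"
    proof (cases "\<epsilon> \<le> R")
      case True
      then have \<epsilon>': "\<epsilon> \<in> {0<..R}" using \<epsilon> by simp
      have "AE x in M. u x \<le> C * U + C * H" unfolding U_def by (rule C(2)[OF \<epsilon>' H h hH u sol])
      moreover have "AE x in M. - u x \<le> C * (LINT x|M. \<bar>- u x\<bar>) + C * H"
        by (rule C(2)[OF \<epsilon>' H _ _ _ solves_minus[OF sol]]) (use hH u in auto)
      ultimately show ?thesis by eventually_elim (auto simp: U_def)
    next
      case False
      have e0: "\<epsilon> > 0" using \<epsilon> by simp
      have "AE x in M. m * \<bar>u x\<bar> \<le> \<eta> 0 / \<epsilon> ^ DIM('a) * \<rho>\<^sub>1 * (LINT y|M. \<bar>u y\<bar>) + \<epsilon>\<^sup>2 * \<bar>h x\<bar>"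
        by (rule pointwise_bound[OF e0 u sol m(2)[OF \<epsilon>]])
      then show ?thesis using hH
      proof eventually_elim
        case (elim x)
        have "\<eta> 0 / \<epsilon> ^ DIM('a) * \<rho>\<^sub>1 * U \<le> \<eta> 0 / R ^ DIM('a) * \<rho>\<^sub>1 * U"
          using False R \<eta>0 \<rho>\<^sub>1 U e0 by (intro mult_right_mono divide_left_mono power_mono) auto
        moreover have "\<epsilon>\<^sup>2 * \<bar>h x\<bar> \<le> \<epsilon>\<^sub>0\<^sup>2 * H" using \<epsilon> elim(2) H by (intro mult_mono power_mono) auto
        ultimately have "m * \<bar>u x\<bar> \<le> \<eta> 0 / R ^ DIM('a) * \<rho>\<^sub>1 * U + \<epsilon>\<^sub>0\<^sup>2 * H"
          using elim(1) by (simp add: U_def)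
        also have "\<dots> \<le> (\<eta> 0 / R ^ DIM('a) * \<rho>\<^sub>1 + \<epsilon>\<^sub>0\<^sup>2) * U + (\<eta> 0 / R ^ DIM('a) * \<rho>\<^sub>1 + \<epsilon>\<^sub>0\<^sup>2) * H"
          using U H \<eta>0 \<rho>\<^sub>1 R by (intro add_mono mult_right_mono) auto
        also have "\<dots> = m * (K * U + K * H)" using m(1) by (simp add: K_def distrib_left)
        finally show ?case using m(1) by simp
      qed
    qed
    then show "AE x in M. \<bar>u x\<bar> \<le> (C + K) * (LINT x|M. \<bar>u x\<bar>) + (C + K) * H"
    proof eventually_elim
      case (elim x)
      have "0 \<le> C * U + C * H" "0 \<le> K * U + K * H" using C(1) K U H by auto
      then show ?case using elim unfolding U_def[symmetric] by (auto simp: distrib_right)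
    qed
  qed (use C K in simp)
qed

end

section \<open>Essential supremum norms and assembly of the three estimates\<close>

lemma (in cone_domain) emeasure_M_nonzero: "emeasure M (space M) \<noteq> 0"
proof -
  obtain x where x: "x \<in> \<Omega>" using nonempty_\<Omega> by blast
  have "0 < \<kappa> * s\<^sub>0 ^ DIM('a)" using \<kappa>_pos s\<^sub>0 by simp
  also have "\<dots> \<le> measure M (\<Omega> \<inter> ball x s\<^sub>0)" using x s\<^sub>0 by (intro measure_density) auto
  also have "\<dots> \<le> measure M \<Omega>" by (intro M.finite_measure_mono) auto
  finally show ?thesis by (simp add: M.emeasure_eq_measure)
qed

text \<open>The iteration works with H > 0, since its gaps are proportional to H. Hence H is taken
  slightly above the norm of \<open>h\<close>, which may be zero, and the surplus tends to
  zero.\<close>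

lemma (in nonlocal_domain) Linf_norm_le:
  assumes C: "C > 0" "\<And>H. H > 0 \<Longrightarrow> AE x in M. \<bar>h x\<bar> \<le> H \<Longrightarrow> AE x in M. \<bar>u x\<bar> \<le> C * U + C * H"
    and [measurable]: "h \<in> borel_measurable M" "u \<in> borel_measurable M" and fin: "Linf_norm M h < \<infinity>"
  shows "Linf_norm M u \<le> ereal (C * U) + ereal C * Linf_norm M h"
proof -
  have "0 \<le> Linf_norm M h"
    using esssup_mono[of "\<lambda>_. 0" M "\<lambda>x. ereal \<bar>h x\<bar>"] esssup_const[OF emeasure_M_nonzero, of "0::ereal"]
    by (simp add: Linf_norm_def)
  then obtain N where N: "Linf_norm M h = ereal N" "0 \<le> N" using fin by (cases "Linf_norm M h") auto
  have hN: "AE x in M. \<bar>h x\<bar> \<le> N"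
    using esssup_AE[of "\<lambda>x. ereal \<bar>h x\<bar>" M] N(1) by (simp add: Linf_norm_def)
  have "Linf_norm M u \<le> ereal (C * U + C * N) + ereal e" if e: "e > 0" for e
  proof -
    have "AE x in M. \<bar>h x\<bar> \<le> N + e / C" using hN
    proof eventually_elim
      case (elim x)
      then show ?case using e C(1) by (smt (verit) divide_pos_pos)
    qed
    moreover have "N + e / C > 0" using N e C(1) by (simp add: add_nonneg_pos)
    ultimately have "AE x in M. \<bar>u x\<bar> \<le> C * U + C * (N + e / C)" using C(2) by blast
    then have "Linf_norm M u \<le> ereal (C * U + C * (N + e / C))"
      unfolding Linf_norm_def by (intro esssup_I) auto
    then show ?thesis using C(1) by (simp add: distrib_left add.assoc)
  qed
  then have "Linf_norm M u \<le> ereal (C * U + C * N)" by (rule ereal_le_epsilon2)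
  then show ?thesis using N by simp
qed

lemma nonlocal_domain_exists:
  fixes \<Omega> :: "'a::euclidean_space set"
  assumes \<Omega>: "smooth_bounded_domain \<Omega>" and \<eta>: "kernel_profile \<eta>" and \<rho>: "positive_C1_density \<Omega> \<rho>"
  shows "\<exists>c s\<^sub>0 T \<rho>\<^sub>0 \<rho>\<^sub>1. nonlocal_domain \<Omega> c s\<^sub>0 T \<eta> \<rho> \<rho>\<^sub>0 \<rho>\<^sub>1"
proof -
  have op: "open \<Omega>" and bd: "bounded \<Omega>" and C1: "C1_boundary \<Omega>"
    using \<Omega> by (auto simp: smooth_bounded_domain_def)
  have ne: "\<Omega> \<noteq> {}"
  proof
    assume "\<Omega> = {}"
    then show False using \<rho> by (simp add: positive_C1_density_def)
  qed
  obtain c s\<^sub>0 T where uc: "uniform_cone \<Omega> c s\<^sub>0 T" using uniform_cone_exists[OF op bd C1 ne] by blast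
  have cont: "continuous_on \<Omega> \<rho>"
    using \<rho> closure_subset unfolding positive_C1_density_def C1_closure_def by (meson continuous_on_subset)
  have meas: "\<rho> \<in> borel_measurable (lebesgue_on \<Omega>)"
    using cont op by (intro continuous_imp_measurable_on_sets_lebesgue) (auto intro: sets_completionI_sets)
  obtain \<rho>\<^sub>1 where \<rho>\<^sub>1: "\<And>x. x \<in> \<Omega> \<Longrightarrow> \<rho> x \<le> \<rho>\<^sub>1"
    using \<rho> unfolding positive_C1_density_def bdd_above_def by auto
  have \<rho>\<^sub>0: "(INF x\<in>\<Omega>. \<rho> x) \<le> \<rho> x" if "x \<in> \<Omega>" for x
    using \<rho> that unfolding positive_C1_density_def by (intro cINF_lower) auto
  have "nonlocal_domain \<Omega> c s\<^sub>0 T \<eta> \<rho> (INF x\<in>\<Omega>. \<rho> x) \<rho>\<^sub>1"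
    by unfold_locales (use op bd ne uc \<eta> meas \<rho> \<rho>\<^sub>0 \<rho>\<^sub>1 in \<open>auto simp: positive_C1_density_def\<close>)
  then show ?thesis by blast
qed

text \<open>For a given \<open>q\<close> only one of the three implications has a true premise; this
  passes from its conclusion to the full conjunction under the quantifiers.\<close>

lemma estimates_mono:
  assumes "\<And>\<epsilon>\<^sub>0::real. \<epsilon>\<^sub>0 > 0 \<Longrightarrow> \<exists>C>0::real. \<forall>\<epsilon>\<in>{0<..\<epsilon>\<^sub>0}. \<forall>h u. A h \<longrightarrow> B u \<longrightarrow> S \<epsilon> h u \<longrightarrow> R C \<epsilon> h u"
    and "\<And>C \<epsilon> h u. R C \<epsilon> h u \<Longrightarrow> R' C \<epsilon> h u"
  shows "\<forall>\<epsilon>\<^sub>0>0. \<exists>C>0. \<forall>\<epsilon>\<in>{0<..\<epsilon>\<^sub>0}. \<forall>h u. A h \<longrightarrow> B u \<longrightarrow> S \<epsilon> h u \<longrightarrow> R' C \<epsilon> h u"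
  using assms by meson

theorem theorem4p1:
  fixes \<Omega> :: "'a::euclidean_space set"
    and \<eta> :: "real \<Rightarrow> real"
    and \<rho> :: "'a \<Rightarrow> real"
    and q :: ereal
  assumes "DIM('a) \<ge> 2"
    and "smooth_bounded_domain \<Omega>"
    and "kernel_profile \<eta>"
    and "positive_C1_density \<Omega> \<rho>"
    and "1 < q"
  shows "(\<forall>\<epsilon>>0. \<forall>h u. h \<in> Lq_space (lebesgue_on \<Omega>) q \<longrightarrow> u \<in> Lq_space (lebesgue_on \<Omega>) 1 \<longrightarrow>
            solves_nonlocal_poisson \<Omega> \<eta> \<rho> \<epsilon> h u \<longrightarrow> u \<in> Lq_space (lebesgue_on \<Omega>) q)
       \<and> (\<forall>\<epsilon>\<^sub>0>0. \<exists>C>0. \<forall>\<epsilon>\<in>{0<..\<epsilon>\<^sub>0}. \<forall>h u.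
            h \<in> Lq_space (lebesgue_on \<Omega>) q \<longrightarrow> u \<in> Lq_space (lebesgue_on \<Omega>) 1 \<longrightarrow>
            solves_nonlocal_poisson \<Omega> \<eta> \<rho> \<epsilon> h u \<longrightarrow>
            (q < 2 \<longrightarrow>
               (\<integral>\<^sup>+ x. ennreal (\<bar>u x\<bar> powr real_of_ereal q) \<partial>lebesgue_on \<Omega>)
                 + nonlocal_energy \<Omega> \<eta> \<epsilon> (real_of_ereal q) u
               \<le> ennreal (C * (LINT x|lebesgue_on \<Omega>. \<bar>u x\<bar>) powr real_of_ereal q
                   + C * (LINT x|lebesgue_on \<Omega>. \<bar>h x\<bar> powr real_of_ereal q) + C)) \<and>
            (2 \<le> q \<and> q < \<infinity> \<longrightarrow>
               (\<integral>\<^sup>+ x. ennreal (\<bar>u x\<bar> powr real_of_ereal q) \<partial>lebesgue_on \<Omega>)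
                 + nonlocal_energy \<Omega> \<eta> \<epsilon> 2 (\<lambda>x. \<bar>u x\<bar> powr ((real_of_ereal q - 2) / 2) * u x)
               \<le> ennreal (C * (LINT x|lebesgue_on \<Omega>. \<bar>u x\<bar> powr (real_of_ereal q / 2))\<^sup>2
                   + C * (LINT x|lebesgue_on \<Omega>. \<bar>h x\<bar> powr real_of_ereal q))) \<and>
            (q = \<infinity> \<longrightarrow>
               Linf_norm (lebesgue_on \<Omega>) u
               \<le> ereal (C * (LINT x|lebesgue_on \<Omega>. \<bar>u x\<bar>))
                   + ereal C * Linf_norm (lebesgue_on \<Omega>) h))"
proof -
  obtain c s\<^sub>0 T \<rho>\<^sub>0 \<rho>\<^sub>1 where "nonlocal_domain \<Omega> c s\<^sub>0 T \<eta> \<rho> \<rho>\<^sub>0 \<rho>\<^sub>1"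
    using nonlocal_domain_exists[OF assms(2-4)] by blast
  then interpret nonlocal_domain \<Omega> c s\<^sub>0 T \<eta> \<rho> \<rho>\<^sub>0 \<rho>\<^sub>1 .
  have L1: "integrable M u" if "u \<in> Lq_space M 1" for u
  proof -
    have "u \<in> borel_measurable M" "integrable M (\<lambda>x. \<bar>u x\<bar>)" using that by (auto simp: Lq_space_def)
    then show ?thesis by (simp add: integrable_abs_iff)
  qed
  show ?thesis
  proof (cases "q = \<infinity>")
    case True
    have *: "\<exists>C>0. \<forall>\<epsilon>\<in>{0<..\<epsilon>\<^sub>0}. \<forall>h u. h \<in> Lq_space M q \<longrightarrow> u \<in> Lq_space M 1 \<longrightarrow> solves_nonlocal_poisson \<Omega> \<eta> \<rho> \<epsilon> h u \<longrightarrow>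
       Linf_norm M u \<le> ereal (C * (LINT x|M. \<bar>u x\<bar>)) + ereal C * Linf_norm M h" if \<epsilon>0: "\<epsilon>\<^sub>0 > 0" for \<epsilon>\<^sub>0
    proof -
      obtain C where C: "C > 0" "\<And>\<epsilon> H h u. \<lbrakk>\<epsilon> \<in> {0<..\<epsilon>\<^sub>0}; H > 0; h \<in> borel_measurable M; AE x in M. \<bar>h x\<bar> \<le> H;
         integrable M u; solves_nonlocal_poisson \<Omega> \<eta> \<rho> \<epsilon> h u\<rbrakk> \<Longrightarrow>
         AE x in M. \<bar>u x\<bar> \<le> C * (LINT x|M. \<bar>u x\<bar>) + C * H"
        using uniform_bound[OF \<epsilon>0] by blast
      show ?thesis
      proof (intro exI[of _ C] conjI ballI allI impI)
        fix \<epsilon> h u assume \<epsilon>: "\<epsilon> \<in> {0<..\<epsilon>\<^sub>0}" and h: "h \<in> Lq_space M q" and u: "u \<in> Lq_space M 1"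
          and sol: "solves_nonlocal_poisson \<Omega> \<eta> \<rho> \<epsilon> h u"
        show "Linf_norm M u \<le> ereal (C * (LINT x|M. \<bar>u x\<bar>)) + ereal C * Linf_norm M h"
        proof (rule Linf_norm_le[OF C(1)])
          show "AE x in M. \<bar>u x\<bar> \<le> C * (LINT x|M. \<bar>u x\<bar>) + C * H" if "H > 0" "AE x in M. \<bar>h x\<bar> \<le> H" for H
            using C(2)[OF \<epsilon> that(1) _ that(2) L1[OF u] sol] h by (simp add: Lq_space_def)
        qed (use h u True in \<open>auto simp: Lq_space_def\<close>)
      qed (rule C(1))
    qed
    have "u \<in> Lq_space M q" if e0: "\<epsilon> > 0" and h: "h \<in> Lq_space M q" and u: "u \<in> Lq_space M 1"
      and sol: "solves_nonlocal_poisson \<Omega> \<eta> \<rho> \<epsilon> h u" for \<epsilon> h u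
    proof -
      \<comment> \<open>Membership is claimed for every \<epsilon> without an upper bound; the
        estimate with \<epsilon> itself as the bound gives it.\<close>
      obtain C where C: "C > 0" "\<forall>\<epsilon>'\<in>{0<..\<epsilon>}. \<forall>h u. h \<in> Lq_space M q \<longrightarrow> u \<in> Lq_space M 1 \<longrightarrow> solves_nonlocal_poisson \<Omega> \<eta> \<rho> \<epsilon>' h u \<longrightarrow>
          Linf_norm M u \<le> ereal (C * (LINT x|M. \<bar>u x\<bar>)) + ereal C * Linf_norm M h"
        using *[OF e0] by blast
      have "\<epsilon> \<in> {0<..\<epsilon>}" using e0 by simp
      then have "Linf_norm M u \<le> ereal (C * (LINT x|M. \<bar>u x\<bar>)) + ereal C * Linf_norm M h"
        using C(2) h u sol by blast
      also have "\<dots> < \<infinity>"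
        using h True C(1) by (cases "Linf_norm M h") (auto simp: Lq_space_def)
      finally show ?thesis using u True by (simp add: Lq_space_def)
    qed
    then have mem: "\<forall>\<epsilon>>0. \<forall>h u. h \<in> Lq_space M q \<longrightarrow> u \<in> Lq_space M 1 \<longrightarrow> solves_nonlocal_poisson \<Omega> \<eta> \<rho> \<epsilon> h u \<longrightarrow> u \<in> Lq_space M q"
      by blast
    have "\<not> q < 2" "\<not> q < \<infinity>" using True by auto
    then show ?thesis
      by (intro conjI[OF mem estimates_mono[OF *]]) blast+
  next
    case False
    define p where "p = real_of_ereal q"
    have q: "q = ereal p" and p: "1 < p" using False assms(5) by (cases q; simp add: p_def)+
    have Lp: "h \<in> Lq_space M q \<longleftrightarrow> h \<in> borel_measurable M \<and> integrable M (\<lambda>x. \<bar>h x\<bar> powr p)" for h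
      by (simp add: Lq_space_def q)
    have "u \<in> Lq_space M q" if "\<epsilon> > 0" "h \<in> Lq_space M q" "u \<in> Lq_space M 1" "solves_nonlocal_poisson \<Omega> \<eta> \<rho> \<epsilon> h u" for \<epsilon> h u
      using solution_in_Lq[OF that(1) L1[OF that(3)] that(4) _ p] that(2,3) unfolding Lp by (auto simp: Lq_space_def)
    then have mem: "\<forall>\<epsilon>>0. \<forall>h u. h \<in> Lq_space M q \<longrightarrow> u \<in> Lq_space M 1 \<longrightarrow> solves_nonlocal_poisson \<Omega> \<eta> \<rho> \<epsilon> h u \<longrightarrow> u \<in> Lq_space M q"
      by blast
    have "2 = ereal 2" by simp
    then have q2: "q < 2 \<longleftrightarrow> p < 2" "2 \<le> q \<longleftrightarrow> 2 \<le> p" unfolding q by (simp_all only: ereal_less_eq less_ereal.simps)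
    show ?thesis
    proof (cases "p < 2")
      case True
      have est: "\<exists>C>0. \<forall>\<epsilon>\<in>{0<..\<epsilon>\<^sub>0}. \<forall>h u. h \<in> Lq_space M q \<longrightarrow> u \<in> Lq_space M 1 \<longrightarrow> solves_nonlocal_poisson \<Omega> \<eta> \<rho> \<epsilon> h u \<longrightarrow>
         (\<integral>\<^sup>+x. ennreal (\<bar>u x\<bar> powr p) \<partial>M) + nonlocal_energy \<Omega> \<eta> \<epsilon> p u
         \<le> ennreal (C * (LINT x|M. \<bar>u x\<bar>) powr p + C * (LINT x|M. \<bar>h x\<bar> powr p) + C)" if \<epsilon>0: "\<epsilon>\<^sub>0 > 0" for \<epsilon>\<^sub>0
      proof -
        obtain C where C: "C > 0" "\<And>\<epsilon> h u. \<lbrakk>\<epsilon> \<in> {0<..\<epsilon>\<^sub>0}; h \<in> borel_measurable M; integrable M (\<lambda>x. \<bar>h x\<bar> powr p);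
           integrable M u; solves_nonlocal_poisson \<Omega> \<eta> \<rho> \<epsilon> h u\<rbrakk> \<Longrightarrow>
           (\<integral>\<^sup>+x. ennreal (\<bar>u x\<bar> powr p) \<partial>M) + nonlocal_energy \<Omega> \<eta> \<epsilon> p u
           \<le> ennreal (C * (LINT x|M. \<bar>u x\<bar>) powr p + C * (LINT x|M. \<bar>h x\<bar> powr p))"
          using estimate_lt2[OF p True \<epsilon>0] by blast
        show ?thesis
        proof (intro exI[of _ C] conjI ballI allI impI)
          fix \<epsilon> h u assume \<epsilon>: "\<epsilon> \<in> {0<..\<epsilon>\<^sub>0}" and h: "h \<in> Lq_space M q" and u: "u \<in> Lq_space M 1"
            and sol: "solves_nonlocal_poisson \<Omega> \<eta> \<rho> \<epsilon> h u"
          have "(\<integral>\<^sup>+x. ennreal (\<bar>u x\<bar> powr p) \<partial>M) + nonlocal_energy \<Omega> \<eta> \<epsilon> p u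
             \<le> ennreal (C * (LINT x|M. \<bar>u x\<bar>) powr p + C * (LINT x|M. \<bar>h x\<bar> powr p))"
            using h unfolding Lp by (intro C(2)[OF \<epsilon> _ _ L1[OF u] sol]) auto
          also have "\<dots> \<le> ennreal (C * (LINT x|M. \<bar>u x\<bar>) powr p + C * (LINT x|M. \<bar>h x\<bar> powr p) + C)"
            using C(1) by (intro ennreal_leI) simp
          finally show "(\<integral>\<^sup>+x. ennreal (\<bar>u x\<bar> powr p) \<partial>M) + nonlocal_energy \<Omega> \<eta> \<epsilon> p u
             \<le> ennreal (C * (LINT x|M. \<bar>u x\<bar>) powr p + C * (LINT x|M. \<bar>h x\<bar> powr p) + C)" .
        qed (rule C(1))
      qed
      have "\<not> 2 \<le> q" using True q2 by simp
      then show ?thesis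
        unfolding p_def[symmetric] using False by (intro conjI[OF mem estimates_mono[OF est]]) blast+
    next
      case ge: False
      have w: "\<bar>t\<bar> powr ((p - 2) / 2) * t = spow (p/2) t" for t
        using ge by (cases "t = 0") (auto simp: spow_def sgn_if diff_divide_distrib powr_diff)
      have est: "\<exists>C>0. \<forall>\<epsilon>\<in>{0<..\<epsilon>\<^sub>0}. \<forall>h u. h \<in> Lq_space M q \<longrightarrow> u \<in> Lq_space M 1 \<longrightarrow> solves_nonlocal_poisson \<Omega> \<eta> \<rho> \<epsilon> h u \<longrightarrow>
         (\<integral>\<^sup>+x. ennreal (\<bar>u x\<bar> powr p) \<partial>M) + nonlocal_energy \<Omega> \<eta> \<epsilon> 2 (\<lambda>x. \<bar>u x\<bar> powr ((p - 2) / 2) * u x)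
         \<le> ennreal (C * (LINT x|M. \<bar>u x\<bar> powr (p/2))\<^sup>2 + C * (LINT x|M. \<bar>h x\<bar> powr p))" if \<epsilon>0: "\<epsilon>\<^sub>0 > 0" for \<epsilon>\<^sub>0
      proof -
        have p2: "2 \<le> p" using ge by simp
        obtain C where C: "C > 0" "\<And>\<epsilon> h u. \<lbrakk>\<epsilon> \<in> {0<..\<epsilon>\<^sub>0}; h \<in> borel_measurable M; integrable M (\<lambda>x. \<bar>h x\<bar> powr p);
           integrable M u; solves_nonlocal_poisson \<Omega> \<eta> \<rho> \<epsilon> h u\<rbrakk> \<Longrightarrow>
           (\<integral>\<^sup>+x. ennreal (\<bar>u x\<bar> powr p) \<partial>M) + nonlocal_energy \<Omega> \<eta> \<epsilon> 2 (\<lambda>x. spow (p/2) (u x))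
           \<le> ennreal (C * (LINT x|M. \<bar>u x\<bar> powr (p/2))\<^sup>2 + C * (LINT x|M. \<bar>h x\<bar> powr p))"
          using estimate_ge2[OF p2 \<epsilon>0] by blast
        show ?thesis
        proof (intro exI[of _ C] conjI ballI allI impI)
          fix \<epsilon> h u assume \<epsilon>: "\<epsilon> \<in> {0<..\<epsilon>\<^sub>0}" and h: "h \<in> Lq_space M q" and u: "u \<in> Lq_space M 1"
            and sol: "solves_nonlocal_poisson \<Omega> \<eta> \<rho> \<epsilon> h u"
          show "(\<integral>\<^sup>+x. ennreal (\<bar>u x\<bar> powr p) \<partial>M) + nonlocal_energy \<Omega> \<eta> \<epsilon> 2 (\<lambda>x. \<bar>u x\<bar> powr ((p - 2) / 2) * u x)
             \<le> ennreal (C * (LINT x|M. \<bar>u x\<bar> powr (p/2))\<^sup>2 + C * (LINT x|M. \<bar>h x\<bar> powr p))"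
            using h unfolding Lp w by (intro C(2)[OF \<epsilon> _ _ L1[OF u] sol]) auto
        qed (rule C(1))
      qed
      have "\<not> q < 2" using ge q2 by simp
      then show ?thesis
        unfolding p_def[symmetric] using False by (intro conjI[OF mem estimates_mono[OF est]]) blast+
    qed
  qed
qed

end
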